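(* Let $\kappa,\lambda$ be infinite cardinals with $\kappa>\aleph_0$ and $\lambda\leq\kappa$. Then there exist families $\mathcal{F}_\kappa$ and $\mathcal{G}_\lambda$, each consisting of incomparable, totally pathwise disconnected linearly ordered continua, such that $|\mathcal{F}_\kappa|=|\mathcal{G}_\lambda|=2^\kappa$, and $w(X)=\kappa$ for every space $X$ in $\mathcal{F}_\kappa\cup\mathcal{G}_\lambda$, and $|X|=\max\{\kappa,2^{\aleph_0}\}$ for every $X\in\mathcal{F}_\kappa$, and $|X|=\lambda^{\nu(\lambda,\kappa)}$ (and hence $w(X)<|X|$) for every $X\in\mathcal{G}_\lambda$.
   Context: $w(X)$ denotes the weight of a space $X$. For infinite cardinals $\lambda\leq\kappa$, $\nu(\lambda,\kappa)$ denotes the smallest infinite cardinal $\mu$ such that $\lambda^\mu>\kappa$. A linearly ordered space is a topological space whose topology is the order topology of some linear ordering of its point set. A continuum is a compact connected Hausdorff space with more than one point. A linearly ordered continuum is a linearly ordered space that is a continuum. A space is totally pathwise disconnected if all its path components are singletons. Spaces $X_i$ $(i\in I)$ are called incomparable if $X_i$ is not homeomorphic to a subspace of $X_j$ whenever $i,j\in I$ and $i\neq j$. *)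

theory Defs
  imports "HOL-Analysis.Analysis"
begin

unbundle cardinal_syntax

(* Cardinals are cardinal orders in the sense of BNF_Cardinal_Order_Relation; they are compared
   with <o, \<le>o, =o, so equality of cardinals is order isomorphism =o.  The values of the
   functions nu and weight below are chosen representatives, unique up to =o. *)

text \<open>The representative of \<open>\<nu>(l, \<kappa>)\<close> is chosen on the type of \<open>\<kappa>\<close>.  This
  is no restriction, since \<open>\<nu>(l, \<kappa>) \<le> \<kappa>\<close>; lemma \<open>nu_least\<close> gives
  minimality among cardinals on all types.\<close>

definition nu :: "'l rel \<Rightarrow> 'k rel \<Rightarrow> 'k rel" where
  "nu l \<kappa> = (SOME \<mu>. Cinfinite \<mu> \<and> \<kappa> <o l ^c \<mu> \<and>
     (\<forall>\<mu>' :: 'k rel. Cinfinite \<mu>' \<and> \<kappa> <o l ^c \<mu>' \<longrightarrow> \<mu> \<le>o \<mu>'))"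

definition is_max_card :: "'a rel \<Rightarrow> 'b rel \<Rightarrow> 'c rel \<Rightarrow> bool" where
  "is_max_card m r s \<longleftrightarrow> (m =o r \<and> s \<le>o r) \<or> (m =o s \<and> r \<le>o s)"

definition is_base :: "'a topology \<Rightarrow> 'a set set \<Rightarrow> bool" where
  "is_base X \<B> \<longleftrightarrow> (\<forall>V\<in>\<B>. openin X V) \<and>
     (\<forall>U x. openin X U \<and> x \<in> U \<longrightarrow> (\<exists>V\<in>\<B>. x \<in> V \<and> V \<subseteq> U))"

definition weight :: "'a topology \<Rightarrow> 'a set rel" where
  "weight X = |SOME \<B>. is_base X \<B> \<and> (\<forall>\<B>'. is_base X \<B>' \<longrightarrow> |\<B>| \<le>o |\<B>'| )|"

text \<open>The relation \<open>r\<close> is a non-strict order.  The whole set \<open>A\<close> is included in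
  the subbase because the open rays do not cover a one-point set.\<close>

definition order_topology_on :: "'a set \<Rightarrow> 'a rel \<Rightarrow> 'a topology" where
  "order_topology_on A r = topology_generated_by
     (insert A ((\<lambda>a. {x \<in> A. (x, a) \<in> r \<and> x \<noteq> a}) ` A \<union>
                (\<lambda>a. {x \<in> A. (a, x) \<in> r \<and> x \<noteq> a}) ` A))"

definition linearly_ordered_space :: "'a topology \<Rightarrow> bool" where
  "linearly_ordered_space X \<longleftrightarrow>
     (\<exists>r. linear_order_on (topspace X) r \<and> X = order_topology_on (topspace X) r)"

definition continuum :: "'a topology \<Rightarrow> bool" where
  "continuum X \<longleftrightarrow> compact_space X \<and> connected_space X \<and> Hausdorff_space X \<and>
     (\<exists>x\<in>topspace X. \<exists>y\<in>topspace X. x \<noteq> y)"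

definition linearly_ordered_continuum :: "'a topology \<Rightarrow> bool" where
  "linearly_ordered_continuum X \<longleftrightarrow> linearly_ordered_space X \<and> continuum X"

definition totally_pathwise_disconnected :: "'a topology \<Rightarrow> bool" where
  "totally_pathwise_disconnected X \<longleftrightarrow> (\<forall>C\<in>path_components_of X. \<exists>x. C = {x})"

definition incomparable :: "'a topology set \<Rightarrow> bool" where
  "incomparable \<F> \<longleftrightarrow> (\<forall>X\<in>\<F>. \<forall>Y\<in>\<F>. X \<noteq> Y \<longrightarrow>
     \<not> (\<exists>S\<subseteq>topspace Y. X homeomorphic_space subtopology Y S))"

lemma nu_exists:
  fixes l :: "'l rel" and \<kappa> :: "'k rel"
  assumes "Cinfinite l" and "Cinfinite \<kappa>"
  shows "\<exists>\<mu> :: 'k rel. Cinfinite \<mu> \<and> \<kappa> <o l ^c \<mu> \<and>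
     (\<forall>\<mu>' :: 'k rel. Cinfinite \<mu>' \<and> \<kappa> <o l ^c \<mu>' \<longrightarrow> \<mu> \<le>o \<mu>')"
proof -
  have "ctwo \<le>o l"
    using assms(1) by (simp add: ctwo_ordLeq_Cinfinite)
  then have "ctwo ^c \<kappa> \<le>o l ^c \<kappa>"
    using assms(2) by (intro cexp_mono1) auto
  then have "\<kappa> <o l ^c \<kappa>"
    using assms(2) ordLess_ctwo_cexp ordLess_ordLeq_trans by blast
  then have "{\<mu> :: 'k rel. Cinfinite \<mu> \<and> \<kappa> <o l ^c \<mu>} \<noteq> {}"
    using assms(2) by blast
  from exists_minim_Card_order[OF this] show ?thesis by blast
qed

lemma nu_props:
  assumes "Cinfinite l" and "Cinfinite \<kappa>"
  shows "Cinfinite (nu l \<kappa>)" and "\<kappa> <o l ^c nu l \<kappa>"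
  using someI_ex[OF nu_exists[OF assms]] unfolding nu_def by blast+

lemma nu_least:
  fixes l :: "'l rel" and \<kappa> :: "'k rel" and \<mu> :: "'m rel"
  assumes "Cinfinite l" and "Cinfinite \<kappa>" and "Cinfinite \<mu>" and "\<kappa> <o l ^c \<mu>"
  shows "nu l \<kappa> \<le>o \<mu>"
proof (rule ccontr)
  assume "\<not> nu l \<kappa> \<le>o \<mu>"
  then have less: "\<mu> <o nu l \<kappa>"
    using assms nu_props(1)[OF assms(1,2)]
    by (metis card_order_on_well_order_on not_ordLeq_iff_ordLess)
  then have "|Field \<mu>| \<le>o |Field (nu l \<kappa>)|"
    using assms nu_props(1)[OF assms(1,2)] by (metis card_of_mono2 ordLess_imp_ordLeq)
  then obtain f where f: "inj_on f (Field \<mu>)" "f ` Field \<mu> \<subseteq> Field (nu l \<kappa>)"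
    by (meson card_of_ordLeq)
  define \<mu>' where "\<mu>' = |f ` Field \<mu>|"
  have "|Field \<mu>| =o \<mu>'"
    unfolding \<mu>'_def using f(1) card_of_ordIso inj_on_imp_bij_betw by blast
  then have iso: "\<mu> =o \<mu>'"
    using assms(3) card_of_Field_ordIso ordIso_symmetric ordIso_transitive by blast
  have "Cinfinite \<mu>'"
    using assms(3) iso Cinfinite_cong by blast
  moreover have "l ^c \<mu> =o l ^c \<mu>'"
    using assms iso cexp_cong2 by (metis \<open>Cinfinite \<mu>'\<close>)
  then have "\<kappa> <o l ^c \<mu>'"
    using assms(4) ordLess_ordIso_trans by blast
  ultimately have "nu l \<kappa> \<le>o \<mu>'"
    using someI_ex[OF nu_exists[OF assms(1,2)]] unfolding nu_def by blast
  then have "nu l \<kappa> \<le>o \<mu>"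
    using iso ordIso_symmetric ordLeq_ordIso_trans by blast
  with less show False
    using not_ordLess_ordLeq by blast
qed

lemma weight_props:
  shows "\<exists>\<B>. is_base X \<B> \<and> weight X =o |\<B>|"
    and "is_base X \<B>' \<Longrightarrow> weight X \<le>o |\<B>'|"
proof -
  have "is_base X {U. openin X U}"
    unfolding is_base_def by blast
  then have "card_of ` {\<B>. is_base X \<B>} \<noteq> {}" by blast
  from exists_minim_Card_order[OF this]
  have "\<exists>\<B>. is_base X \<B> \<and> (\<forall>\<B>'. is_base X \<B>' \<longrightarrow> |\<B>| \<le>o |\<B>'| )"
    using card_of_Card_order by blast
  from someI_ex[OF this]
  show "\<exists>\<B>. is_base X \<B> \<and> weight X =o |\<B>|"
    and "is_base X \<B>' \<Longrightarrow> weight X \<le>o |\<B>'|"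
    unfolding weight_def using card_of_refl by blast+
qed

lemma topspace_order_topology_on [simp]: "topspace (order_topology_on A r) = A"
  unfolding order_topology_on_def topology_generated_by_topspace by blast

end

theory Submission
  imports Defs
begin

text \<open>
  All spaces are built as linear orders that are dense, complete and have end points; their order
  topologies are exactly the linearly ordered continua.

  An embedding of one such continuum into another has a connected, hence convex, image, and it is
  monotone or antitone (\<open>homeomorphic_subspace_convex_embedding\<close>).  It therefore preserves, up to
  reversal, which interior points have uncountable cofinality from below (\<open>ucof\<close>) and from above.  Incomparability is
  thus achieved by writing a code \<open>A \<subseteq> \<kappa>\<close> into a continuum by means of these characters.

  The building block is the set of sequences \<open>f : \<omega> \<rightarrow> \<omega>\<^sub>1 + 1\<close> in lexicographic order with all jumps
  collapsed.  In it the points with uncountable cofinality from below are dense, whereas no point has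
  uncountable cofinality from above.  For every \<open>\<beta> < \<kappa>\<close> a half-open initial segment
  of this block is followed by the reverse of such a segment.  The point where the two meet is a switch: to
  its left no point has uncountable cofinality from above, to its right none from below.  There are no
  other switches, and their definition is symmetric under reversal.  Since the end point of a segment may or
  may not have uncountable cofinality, each switch can carry two bits; the one from the left says
  whether \<open>\<beta> \<in> A\<close>, the one from the right whether \<open>\<beta> = 0\<close>.  An embedding sends switches to
  switches, and the switches of an interval form an interval of the ordinal \<open>\<kappa>\<close>.  An antitone embedding would
  make \<open>\<kappa>\<close> descend infinitely; a monotone one must send the marked first switch to
  the first switch, so it sends each switch to the switch with the same index, and the two codes agree
  (\<open>code_eq_if_homeomorphic\<close>).  This gives \<open>2\<^sup>\<kappa>\<close> incomparable continua for regular and singular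
  \<open>\<kappa>\<close> alike.

  The sum of these pieces is closed by an end piece of lexicographic sequences of length
  \<open>\<nu>\<close> with values in \<open>m + 1\<close>, where \<open>m\<close> is an uncountable cardinal.  It has no switches,
  contributes \<open>m\<^sup>\<nu>\<close> points, and has the eventually zero sequences as a dense subset.  With \<open>m = \<aleph>\<^sub>1\<close>
  and \<open>\<nu> = \<omega>\<close> it has size \<open>2\<close> to the \<open>\<aleph>\<^sub>0\<close>, which yields the first family.  With
  \<open>m = max(l, \<aleph>\<^sub>1)\<close> and \<open>\<nu> = nu l \<kappa>\<close> minimality of \<open>\<nu>\<close> bounds the dense subset
  by \<open>\<kappa>\<close>, and the size is \<open>l\<^sup>\<nu>\<close>, which yields the second.

  No interval admits a path across it: points of uncountable cofinality from one side are dense, and a path through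
  such a point would have a separable image on which a countable set is cofinal below that point
  (\<open>ucof_not_inside_path\<close>).
\<close>

section \<open>Dense complete linear orders\<close>

text \<open>The strict order holds only between points of the carrier, so that no further
  membership premises are needed when inequalities are chained.\<close>

locale lin_ord =
  fixes X :: "'a set" and lt :: "'a \<Rightarrow> 'a \<Rightarrow> bool"  (infix "\<sqsubset>" 50)
  assumes lt_in1: "x \<sqsubset> y \<Longrightarrow> x \<in> X"
    and lt_in2: "x \<sqsubset> y \<Longrightarrow> y \<in> X"
    and lt_irrefl [simp]: "\<not> x \<sqsubset> x"
    and lt_trans: "x \<sqsubset> y \<Longrightarrow> y \<sqsubset> z \<Longrightarrow> x \<sqsubset> z"
    and lt_total: "x \<in> X \<Longrightarrow> y \<in> X \<Longrightarrow> x \<sqsubset> y \<or> x = y \<or> y \<sqsubset> x"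
begin

lemma lt_asym: "x \<sqsubset> y \<Longrightarrow> \<not> y \<sqsubset> x"
  using lt_trans lt_irrefl by blast

lemma not_lt_trans: "x \<sqsubset> y \<Longrightarrow> z \<in> X \<Longrightarrow> \<not> z \<sqsubset> y \<Longrightarrow> x \<sqsubset> z"
  using lt_trans lt_total lt_in2 by blast

lemma not_lt_trans': "y \<sqsubset> x \<Longrightarrow> z \<in> X \<Longrightarrow> \<not> y \<sqsubset> z \<Longrightarrow> z \<sqsubset> x"
  using lt_trans lt_total lt_in1 by blast

lemma rev_lin_ord: "lin_ord X (conversep lt)"
proof
  show "lt\<inverse>\<inverse> x z" if "lt\<inverse>\<inverse> x y" "lt\<inverse>\<inverse> y z" for x y z
    using that lt_trans[of z y x] by simp
  show "lt\<inverse>\<inverse> x y \<or> x = y \<or> lt\<inverse>\<inverse> y x" if "x \<in> X" "y \<in> X" for x y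
    using lt_total[OF that] by auto
qed (auto intro: lt_in1 lt_in2)

end

locale dense_complete = lin_ord +
  assumes lt_dense: "x \<sqsubset> y \<Longrightarrow> \<exists>z. x \<sqsubset> z \<and> z \<sqsubset> y"
    and lt_complete: "S \<subseteq> X \<Longrightarrow> S \<noteq> {} \<Longrightarrow> u \<in> X \<Longrightarrow> (\<forall>x\<in>S. \<not> u \<sqsubset> x) \<Longrightarrow>
      \<exists>s\<in>X. (\<forall>x\<in>S. \<not> s \<sqsubset> x) \<and> (\<forall>v. v \<sqsubset> s \<longrightarrow> (\<exists>x\<in>S. v \<sqsubset> x))"
begin

text \<open>Everything below is stated for one direction of the order and applied to the reverse order
  for the other direction.\<close>

lemma rev_dense_complete: "dense_complete X (conversep lt)"
proof -
  interpret R: lin_ord X "conversep lt" by (rule rev_lin_ord)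
  show ?thesis
  proof unfold_locales
    show "\<exists>z. lt\<inverse>\<inverse> x z \<and> lt\<inverse>\<inverse> z y" if "lt\<inverse>\<inverse> x y" for x y
      using that lt_dense by auto
  next
    fix S u assume S: "S \<subseteq> X" "S \<noteq> {}" "u \<in> X" "\<forall>x\<in>S. \<not> lt\<inverse>\<inverse> u x"
    \<comment> \<open>The infimum of a set is the supremum of its lower bounds.\<close>
    let ?B = "{v \<in> X. \<forall>x\<in>S. \<not> x \<sqsubset> v}"
    obtain w where w: "w \<in> S" using S by blast
    have "\<exists>s\<in>X. (\<forall>x\<in>?B. \<not> s \<sqsubset> x) \<and> (\<forall>v. v \<sqsubset> s \<longrightarrow> (\<exists>x\<in>?B. v \<sqsubset> x))"
      by (rule lt_complete[of _ w]) (use S w in auto)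
    then obtain s where s: "s \<in> X" "\<And>x. x \<in> ?B \<Longrightarrow> \<not> s \<sqsubset> x"
      "\<And>v. v \<sqsubset> s \<Longrightarrow> \<exists>x\<in>?B. v \<sqsubset> x" by blast
    have "\<not> x \<sqsubset> s" if "x \<in> S" for x
      using s(3)[of x] that by blast
    moreover have "\<exists>x\<in>S. x \<sqsubset> v" if "s \<sqsubset> v" for v
      using s(2)[of v] that lt_in2 by blast
    ultimately show "\<exists>s\<in>X. (\<forall>x\<in>S. \<not> lt\<inverse>\<inverse> s x) \<and> (\<forall>v. lt\<inverse>\<inverse> v s \<longrightarrow> (\<exists>x\<in>S. lt\<inverse>\<inverse> v x))"
      using s(1) by auto
  qed
qed

end

locale order_continuum = dense_complete +
  fixes bt tp
  assumes bt_in: "bt \<in> X" and tp_in: "tp \<in> X"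
    and bt_least: "\<not> x \<sqsubset> bt" and tp_greatest: "\<not> tp \<sqsubset> x" and bt_tp: "bt \<sqsubset> tp"

section \<open>Countable and uncountable cofinality of points\<close>

text \<open>The point \<open>x\<close> has uncountable cofinality from below. The witness \<open>y\<close> is
  required even for \<open>C = {}\<close>, so a least element does not qualify.\<close>

definition ucof :: "('a \<Rightarrow> 'a \<Rightarrow> bool) \<Rightarrow> 'a \<Rightarrow> bool" where
  "ucof lt x \<longleftrightarrow> (\<forall>C. countable C \<and> (\<forall>c\<in>C. lt c x) \<longrightarrow> (\<exists>y. lt y x \<and> (\<forall>c\<in>C. lt c y)))"

text \<open>Cofinality from below depends only on the order type of an arbitrarily short half-open interval
  below the point: a countable set can be replaced by its trace there together with \<open>a\<close>.\<close>

lemma ucof_transfer: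
  assumes "lin_ord X lt" and "lin_ord Y lt'" and ax: "lt a x"
    and mono: "\<And>y z. lt y z \<Longrightarrow> y = a \<or> lt a y \<Longrightarrow> lt z x \<Longrightarrow> lt' (f y) (f z)"
    and into: "\<And>y. y = a \<or> lt a y \<Longrightarrow> lt y x \<Longrightarrow> lt' (f y) x'"
    and onto: "\<And>v. lt' (f a) v \<Longrightarrow> lt' v x' \<Longrightarrow> \<exists>y. lt a y \<and> lt y x \<and> f y = v"
  shows "ucof lt x \<longleftrightarrow> ucof lt' x'"
proof -
  interpret A: lin_ord X lt by fact
  interpret B: lin_ord Y lt' by fact
  show ?thesis
  proof
    assume L: "ucof lt x"
    show "ucof lt' x'"
      unfolding ucof_def
    proof (intro allI impI, elim conjE)
      fix C assume C: "countable C" "\<forall>c\<in>C. lt' c x'"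
      define g where "g v = (SOME y. lt a y \<and> lt y x \<and> f y = v)" for v
      have g: "lt a (g v) \<and> lt (g v) x \<and> f (g v) = v" if "v \<in> C" "lt' (f a) v" for v
        unfolding g_def by (rule someI_ex) (use onto C that in blast)
      let ?D = "insert a (g ` {v\<in>C. lt' (f a) v})"
      have "countable ?D" using C by auto
      moreover have "\<forall>d\<in>?D. lt d x" using g ax by auto
      ultimately obtain y where y: "lt y x" "\<forall>d\<in>?D. lt d y"
        using L unfolding ucof_def by blast
      have fa: "lt' (f a) (f y)" using y mono[of a y] by auto
      have "lt' c (f y)" if "c \<in> C" for c
      proof (cases "lt' (f a) c")
        case True
        then have "lt (g c) y" "lt a (g c)" "f (g c) = c" using y g that by auto
        then show ?thesis using mono[of "g c" y] y by auto
      next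
        case False
        then show ?thesis
          using fa C(2) that B.lt_total[of "f a" c] B.lt_in1 B.lt_trans by blast
      qed
      moreover have "lt' (f y) x'" using into[of y] y by auto
      ultimately show "\<exists>y. lt' y x' \<and> (\<forall>c\<in>C. lt' c y)" by blast
    qed
  next
    assume L: "ucof lt' x'"
    show "ucof lt x"
      unfolding ucof_def
    proof (intro allI impI, elim conjE)
      fix C assume C: "countable C" "\<forall>c\<in>C. lt c x"
      let ?D = "insert (f a) (f ` {v\<in>C. v = a \<or> lt a v})"
      have "countable ?D" using C by auto
      moreover have "\<forall>d\<in>?D. lt' d x'" using C into[of a] into ax by auto
      ultimately obtain v where v: "lt' v x'" "\<forall>d\<in>?D. lt' d v"
        using L unfolding ucof_def by blast
      then obtain y where y: "lt a y" "lt y x" "f y = v" using onto[of v] by auto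
      have "lt c y" if c: "c \<in> C" for c
      proof (cases "c = a \<or> lt a c")
        case True
        then have less: "lt' (f c) (f y)" using v y that c by auto
        have "\<not> lt y c" using mono[of y c] y C(2) c less B.lt_asym by blast
        have "c \<in> X" "y \<in> X" using C(2) c y A.lt_in1 by blast+
        then show ?thesis using \<open>\<not> lt y c\<close> less A.lt_total[of c y] B.lt_irrefl by blast
      next
        case False
        then have "lt c a" using A.lt_total[of c a] A.lt_in1 C(2) c ax by blast
        then show ?thesis using y A.lt_trans by blast
      qed
      then show "\<exists>y. lt y x \<and> (\<forall>c\<in>C. lt c y)" using y by blast
    qed
  qed
qed

text \<open>The two halves are exchanged when the order is reversed; this makes switches visible
  to antitone embeddings as well.\<close>

definition switch :: "('a \<Rightarrow> 'a \<Rightarrow> bool) \<Rightarrow> 'a \<Rightarrow> bool" where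
  "switch lt x \<longleftrightarrow> (\<exists>a. lt a x \<and> (\<forall>y. lt a y \<and> lt y x \<longrightarrow> \<not> ucof (conversep lt) y)) \<and>
                   (\<exists>b. lt x b \<and> (\<forall>y. lt x y \<and> lt y b \<longrightarrow> \<not> ucof lt y))"

lemma switch_rev: "switch (conversep lt) x \<longleftrightarrow> switch lt x"
  unfolding switch_def by auto

text \<open>The order-theoretic shadow of a topological embedding of a continuum.\<close>

locale convex_embedding = A: lin_ord X lt + B: lin_ord Y lt'
  for X :: "'a set" and lt and Y :: "'b set" and lt' +
  fixes f :: "'a \<Rightarrow> 'b"
  assumes emb_in: "x \<in> X \<Longrightarrow> f x \<in> Y"
    and emb_mono: "lt x y \<Longrightarrow> lt' (f x) (f y)"
    and emb_convex: "x \<in> X \<Longrightarrow> y \<in> X \<Longrightarrow> lt' (f x) v \<Longrightarrow> lt' v (f y) \<Longrightarrow> v \<in> f ` X"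
begin

lemma emb_less_iff: "x \<in> X \<Longrightarrow> y \<in> X \<Longrightarrow> lt' (f x) (f y) \<longleftrightarrow> lt x y"
  using emb_mono[of x y] emb_mono[of y x] A.lt_total[of x y] B.lt_asym[of "f x" "f y"] by auto

lemma emb_between: 
  assumes "x \<in> X" "y \<in> X" "lt' (f x) v" "lt' v (f y)"
  obtains u where "lt x u" "lt u y" "f u = v"
proof -
  obtain u where "u \<in> X" "v = f u" using emb_convex[OF assms] by blast
  then show ?thesis using assms emb_less_iff that by blast
qed

lemma rev_emb: "convex_embedding X (conversep lt) Y (conversep lt') f"
proof -
  interpret A': lin_ord X "conversep lt" by (rule A.rev_lin_ord)
  interpret B': lin_ord Y "conversep lt'" by (rule B.rev_lin_ord)
  show ?thesis
    by unfold_locales (auto simp: emb_in emb_mono intro: emb_convex)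
qed

text \<open>The point \<open>a\<close> guarantees that \<open>f x\<close> is not the left end of the image, where
  the cofinality from below may change.\<close>

lemma ucof_emb:
  assumes "lt a x"
  shows "ucof lt' (f x) \<longleftrightarrow> ucof lt x"
proof -
  have x: "x \<in> X" "a \<in> X" using assms A.lt_in1 A.lt_in2 by auto
  have "ucof lt x \<longleftrightarrow> ucof lt' (f x)"
    by (rule ucof_transfer[OF A.lin_ord_axioms B.lin_ord_axioms assms, of f])
       (use x assms in \<open>auto intro: emb_mono elim: emb_between\<close>)
  then show ?thesis by simp
qed

end

context convex_embedding begin

lemma ucof_emb_rev:
  assumes "lt x a"
  shows "ucof (conversep lt') (f x) \<longleftrightarrow> ucof (conversep lt) x"
proof -
  interpret R: convex_embedding X "conversep lt" Y "conversep lt'" f by (rule rev_emb)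
  show ?thesis using R.ucof_emb[of a x] assms by simp
qed

text \<open>A witness \<open>a\<close> in the target may lie outside the image; the image of \<open>p\<close> then
  serves instead.\<close>

lemma switch_half:
  assumes "lt p x" 
  shows "(\<exists>a. lt' a (f x) \<and> (\<forall>y. lt' a y \<and> lt' y (f x) \<longrightarrow> \<not> ucof (conversep lt') y)) \<longleftrightarrow>
     (\<exists>a. lt a x \<and> (\<forall>y. lt a y \<and> lt y x \<longrightarrow> \<not> ucof (conversep lt) y))" (is "?l \<longleftrightarrow> ?r")
proof
  assume ?l
  then obtain a where a: "lt' a (f x)" "\<And>y. lt' a y \<Longrightarrow> lt' y (f x) \<Longrightarrow> \<not> ucof (conversep lt') y"
    by blast
  have inX: "p \<in> X" "x \<in> X" using assms A.lt_in1 A.lt_in2 by auto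
  obtain b where b: "lt b x" "f b = a \<or> lt' a (f b)"
  proof (cases "lt' (f p) a")
    case True
    then obtain u where "lt p u" "lt u x" "f u = a" using emb_between[of p x a] a inX by blast
    then show ?thesis using that by blast
  next
    case False
    then have "f p = a \<or> lt' a (f p)"
      using B.lt_total[of "f p" a] emb_in[OF inX(1)] B.lt_in1[OF a(1)] by blast
    then show ?thesis using that assms by blast
  qed
  have "\<not> ucof (conversep lt) y" if "lt b y" "lt y x" for y
  proof -
    have "lt' a (f y)" using b emb_mono[OF that(1)] B.lt_trans by blast
    then have "\<not> ucof (conversep lt') (f y)" using a(2) emb_mono[OF that(2)] by blast
    then show ?thesis using ucof_emb_rev[OF that(2)] by blast
  qed
  then show ?r using b by blast
next
  assume ?r
  then obtain a where a: "lt a x" "\<And>y. lt a y \<Longrightarrow> lt y x \<Longrightarrow> \<not> ucof (conversep lt) y"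
    by blast
  have inX: "a \<in> X" "x \<in> X" using a A.lt_in1 A.lt_in2 by auto
  have "\<not> ucof (conversep lt') y" if y: "lt' (f a) y" "lt' y (f x)" for y
  proof -
    obtain u where u: "lt a u" "lt u x" "f u = y" using emb_between[OF inX y] by blast
    then show ?thesis using a(2) ucof_emb_rev[OF u(2)] by blast
  qed
  then show ?l using emb_mono[OF a(1)] by blast
qed

lemma switch_emb:
  assumes "lt p x" "lt x q"
  shows "switch lt' (f x) \<longleftrightarrow> switch lt x"
proof -
  interpret R: convex_embedding X "conversep lt" Y "conversep lt'" f by (rule rev_emb)
  show ?thesis
    unfolding switch_def using switch_half[OF assms(1)] R.switch_half[of q x] assms(2)
    by (simp add: conj_commute)
qed

end

section \<open>The order topology of a continuous order\<close>

definition topo :: "'a set \<Rightarrow> ('a \<Rightarrow> 'a \<Rightarrow> bool) \<Rightarrow> 'a topology" where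
  "topo X lt = order_topology_on X {(x, y). x \<in> X \<and> y \<in> X \<and> (lt x y \<or> x = y)}"

lemma topspace_topo [simp]: "topspace (topo X lt) = X"
  by (simp add: topo_def)

context lin_ord begin

lemma topo_alt: "topo X lt = topology_generated_by
   (insert X ((\<lambda>a. {x. x \<sqsubset> a}) ` X \<union> (\<lambda>a. {x. a \<sqsubset> x}) ` X))"
proof -
  have "{x \<in> X. (x, a) \<in> {(x, y). x \<in> X \<and> y \<in> X \<and> (lt x y \<or> x = y)} \<and> x \<noteq> a} = {x. x \<sqsubset> a}"
    "{x \<in> X. (a, x) \<in> {(x, y). x \<in> X \<and> y \<in> X \<and> (lt x y \<or> x = y)} \<and> x \<noteq> a} = {x. a \<sqsubset> x}"
    if "a \<in> X" for a
    using that lt_in1 lt_in2 by auto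
  then show ?thesis unfolding topo_def order_topology_on_def by (simp cong: image_cong)
qed

lemma topo_rev: "topo X (conversep lt) = topo X lt"
proof -
  interpret R: lin_ord X "conversep lt" by (rule rev_lin_ord)
  show ?thesis unfolding topo_alt R.topo_alt by (simp add: Un_commute conversep_iff[abs_def])
qed

lemma open_below: "a \<in> X \<Longrightarrow> openin (topo X lt) {x. x \<sqsubset> a}"
  unfolding topo_alt by (rule topology_generated_by_Basis) auto

lemma open_above: "a \<in> X \<Longrightarrow> openin (topo X lt) {x. a \<sqsubset> x}"
  unfolding topo_alt by (rule topology_generated_by_Basis) auto

lemma open_between: "a \<in> X \<Longrightarrow> b \<in> X \<Longrightarrow> openin (topo X lt) {x. a \<sqsubset> x \<and> x \<sqsubset> b}"
  using openin_Int[OF open_above open_below, of a b] by (simp add: Int_def)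

lemma open_left_nbhd:
  assumes "openin (topo X lt) U" "x \<in> U" "z \<sqsubset> x"
  shows "\<exists>a. a \<sqsubset> x \<and> (\<forall>y. a \<sqsubset> y \<and> y \<sqsubset> x \<longrightarrow> y \<in> U)"
proof -
  have "generate_topology_on (insert X ((\<lambda>a. {x. x \<sqsubset> a}) ` X \<union> (\<lambda>a. {x. a \<sqsubset> x}) ` X)) U"
    using assms(1) unfolding topo_alt openin_topology_generated_by_iff .
  then show ?thesis using assms(2)
  proof (induction rule: generate_topology_on.induct)
    case Empty
    then show ?case by simp
  next
    case (Int U V)
    then obtain a b where "a \<sqsubset> x" "\<forall>y. a \<sqsubset> y \<and> y \<sqsubset> x \<longrightarrow> y \<in> U"
      "b \<sqsubset> x" "\<forall>y. b \<sqsubset> y \<and> y \<sqsubset> x \<longrightarrow> y \<in> V" by blast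
    moreover have "a \<sqsubset> b \<or> a = b \<or> b \<sqsubset> a" using calculation lt_total lt_in1 by blast
    ultimately show ?case using lt_trans by blast
  next
    case (UN K)
    then show ?case by blast
  next
    case (Basis s)
    then consider "s = X" | a where "a \<in> X" "s = {x. x \<sqsubset> a}" | a where "a \<in> X" "s = {x. a \<sqsubset> x}"
      by blast
    then show ?case
    proof cases
      case 1
      then show ?thesis using assms(3) lt_in1 by blast
    next
      case 2
      then show ?thesis using assms(3) Basis lt_trans by blast
    next
      case 3
      then show ?thesis using Basis by blast
    qed
  qed
qed

lemma open_right_nbhd:
  assumes "openin (topo X lt) U" "x \<in> U" "x \<sqsubset> z"
  shows "\<exists>a. x \<sqsubset> a \<and> (\<forall>y. x \<sqsubset> y \<and> y \<sqsubset> a \<longrightarrow> y \<in> U)"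
proof -
  interpret R: lin_ord X "conversep lt" by (rule rev_lin_ord)
  show ?thesis using R.open_left_nbhd[of U x z] assms unfolding topo_rev by auto
qed

lemma linearly_ordered_space_topo: "linearly_ordered_space (topo X lt)"
proof -
  let ?r = "{(x, y). x \<in> X \<and> y \<in> X \<and> (lt x y \<or> x = y)}"
  have "refl_on X ?r" by (auto simp: refl_on_def)
  moreover have "trans ?r" unfolding trans_def using lt_trans by blast
  moreover have "antisym ?r" unfolding antisym_def using lt_asym by blast
  moreover have "total_on X ?r" using lt_total by (auto simp: total_on_def)
  ultimately have "linear_order_on X ?r"
    by (auto simp: linear_order_on_def partial_order_on_def preorder_on_def)
  moreover have "topo X lt = order_topology_on X ?r" by (simp add: topo_def)
  ultimately show ?thesis unfolding linearly_ordered_space_def topspace_topo by blast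
qed

lemma connectedin_convex:
  assumes "connectedin (topo X lt) C" "a \<in> C" "c \<in> C" "a \<sqsubset> b" "b \<sqsubset> c"
  shows "b \<in> C"
proof (rule ccontr)
  assume "b \<notin> C"
  have b: "b \<in> X" using assms lt_in1 by blast
  have CX: "C \<subseteq> X" using connectedin_subset_topspace[OF assms(1)] by simp
  have sub: "C \<subseteq> {x. x \<sqsubset> b} \<union> {x. b \<sqsubset> x}" using CX \<open>b \<notin> C\<close> b lt_total by blast
  have "{x. x \<sqsubset> b} \<inter> {x. b \<sqsubset> x} \<inter> C = {}" using lt_asym by blast
  moreover have "{x. x \<sqsubset> b} \<inter> C \<noteq> {}" "{x. b \<sqsubset> x} \<inter> C \<noteq> {}" using assms by blast+
  ultimately show False
    using sub assms(1) open_below[OF b] open_above[OF b] unfolding connectedin by blast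
qed

end

context dense_complete begin

text \<open>The usual supremum argument: \<open>S\<close> collects the points up to which the interval from \<open>u\<close> stays
  inside \<open>U\<close>, and its supremum can belong neither to \<open>U\<close> nor to \<open>V\<close>.\<close>

lemma no_separation:
  assumes conv: "\<And>a b c. a \<in> C \<Longrightarrow> c \<in> C \<Longrightarrow> a \<sqsubset> b \<Longrightarrow> b \<sqsubset> c \<Longrightarrow> b \<in> C"
    and U: "openin (topo X lt) U" and V: "openin (topo X lt) V" and cov: "C \<subseteq> U \<union> V"
    and disj: "U \<inter> V \<inter> C = {}" and u: "u \<in> U" "u \<in> C" and v: "v \<in> V" "v \<in> C" and uv: "u \<sqsubset> v"
  shows False
proof -
  define S where "S = {x. (x = u \<or> u \<sqsubset> x) \<and> x \<sqsubset> v \<and> (\<forall>y. u \<sqsubset> y \<and> y \<sqsubset> x \<longrightarrow> y \<in> U) \<and> x \<in> U}"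
  have uS: "u \<in> S" unfolding S_def using uv u by (auto dest: lt_asym)
  have vX: "v \<in> X" using uv lt_in2 by blast
  have SX: "S \<subseteq> X" unfolding S_def using lt_in1 by blast
  have "\<exists>s\<in>X. (\<forall>x\<in>S. \<not> s \<sqsubset> x) \<and> (\<forall>v. v \<sqsubset> s \<longrightarrow> (\<exists>x\<in>S. v \<sqsubset> x))"
    by (rule lt_complete[of S v]) (use SX uS vX in \<open>auto simp: S_def dest: lt_asym\<close>)
  then obtain s where s: "s \<in> X" "\<And>x. x \<in> S \<Longrightarrow> \<not> s \<sqsubset> x" "\<And>v. v \<sqsubset> s \<Longrightarrow> \<exists>x\<in>S. v \<sqsubset> x" by blast
  have us: "u = s \<or> u \<sqsubset> s" using s(2)[OF uS] lt_total s(1) uS SX by blast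
  have sv: "s = v \<or> s \<sqsubset> v"
  proof -
    have "\<not> v \<sqsubset> s" using s(3)[of v] lt_asym unfolding S_def by blast
    then show ?thesis using lt_total[OF s(1) vX] by blast
  qed
  have sC: "s \<in> C" using us sv u v conv by blast
  have below: "y \<in> U" if y: "u \<sqsubset> y" "y \<sqsubset> s" for y
  proof -
    obtain x where "x \<in> S" "y \<sqsubset> x" using s(3) y by blast
    then show ?thesis using y unfolding S_def by blast
  qed
  consider "s \<in> U" | "s \<in> V" using sC cov by blast
  then show False
  proof cases
    case 1
    then have "s \<noteq> v" using disj v by blast
    then have sv: "s \<sqsubset> v" using sv by blast
    obtain b where b: "s \<sqsubset> b" "\<And>y. s \<sqsubset> y \<Longrightarrow> y \<sqsubset> b \<Longrightarrow> y \<in> U"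
      using open_right_nbhd[OF U 1 sv] by blast
    obtain c where c: "s \<sqsubset> c" "c = b \<and> b \<sqsubset> v \<or> c = v \<and> \<not> b \<sqsubset> v" using b sv by blast
    obtain y where y: "s \<sqsubset> y" "y \<sqsubset> c" using lt_dense c by blast
    have yb: "y \<sqsubset> b" "y \<sqsubset> v"
      using y c lt_trans not_lt_trans[of y v b] lt_in2[OF b(1)] by blast+
    have "y \<in> S" unfolding S_def
    proof (intro CollectI conjI allI impI)
      show "y = u \<or> u \<sqsubset> y" using y us lt_trans by blast
      show "y \<sqsubset> v" by fact
      show "y \<in> U" using b y yb by blast
      fix z assume z: "u \<sqsubset> z \<and> z \<sqsubset> y"
      then show "z \<in> U"
        using below[of z] 1 b(2)[of z] lt_trans[of z y b] yb lt_total[of z s] s(1) lt_in1 by blast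
    qed
    then show False using s(2) y by blast
  next
    case 2
    then have "u \<noteq> s" using disj u by blast
    then have us: "u \<sqsubset> s" using us by blast
    obtain a where a: "a \<sqsubset> s" "\<And>y. a \<sqsubset> y \<Longrightarrow> y \<sqsubset> s \<Longrightarrow> y \<in> V"
      using open_left_nbhd[OF V 2 us] by blast
    obtain x where x: "x \<in> S" "a \<sqsubset> x" using s(3)[OF a(1)] by blast
    then have "x \<in> C" using u v conv[of u v x] unfolding S_def by blast
    moreover have "x \<in> V" using x a 2 s(2)[of x] lt_total[of x s] s(1) lt_in2 by blast
    moreover have "x \<in> U" using x unfolding S_def by blast
    ultimately show False using disj by blast
  qed
qed

lemma connectedin_if_convex:
  assumes CX: "C \<subseteq> X"
    and conv: "\<And>a b c. a \<in> C \<Longrightarrow> c \<in> C \<Longrightarrow> a \<sqsubset> b \<Longrightarrow> b \<sqsubset> c \<Longrightarrow> b \<in> C"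
  shows "connectedin (topo X lt) C"
proof -
  have False
    if sep: "openin (topo X lt) U" "openin (topo X lt) V" "C \<subseteq> U \<union> V" "U \<inter> V \<inter> C = {}"
      "U \<inter> C \<noteq> {}" "V \<inter> C \<noteq> {}" for U V
  proof -
    obtain u v where uv: "u \<in> U" "u \<in> C" "v \<in> V" "v \<in> C" using sep by blast
    then have "u \<noteq> v" using sep by blast
    then consider "u \<sqsubset> v" | "v \<sqsubset> u" using lt_total uv CX by blast
    then show False
    proof cases
      case 1
      show False by (rule no_separation[OF conv sep(1-4) uv 1])
    next
      case 2
      show False by (rule no_separation[OF conv sep(2,1) _ _ uv(3,4,1,2) 2]) (use sep in auto)
    qed
  qed
  then show ?thesis unfolding connectedin using CX by (simp) blast
qed

lemma Hausdorff_topo: "Hausdorff_space (topo X lt)"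
proof -
  have sep: "\<exists>U V. openin (topo X lt) U \<and> openin (topo X lt) V \<and> x \<in> U \<and> y \<in> V \<and> disjnt U V"
    if xy: "x \<sqsubset> y" for x y
  proof -
    obtain z where z: "x \<sqsubset> z" "z \<sqsubset> y" using lt_dense xy by blast
    then have "z \<in> X" using lt_in1 by blast
    moreover have "disjnt {x. x \<sqsubset> z} {x. z \<sqsubset> x}" using lt_asym by (auto simp: disjnt_def)
    ultimately show ?thesis using open_below open_above z by blast
  qed
  show ?thesis
    unfolding Hausdorff_space_def topspace_topo
  proof (intro allI impI, elim conjE)
    fix x y assume "x \<in> X" "y \<in> X" "x \<noteq> y"
    then consider "x \<sqsubset> y" | "y \<sqsubset> x" using lt_total by blast
    then show "\<exists>U V. openin (topo X lt) U \<and> openin (topo X lt) V \<and> x \<in> U \<and> y \<in> V \<and> disjnt U V"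
    proof cases
      case 1
      then show ?thesis by (rule sep)
    next
      case 2
      then obtain U V where "openin (topo X lt) U" "openin (topo X lt) V" "y \<in> U" "x \<in> V" "disjnt U V"
        using sep by blast
      then show ?thesis by (intro exI[of _ V] exI[of _ U]) (auto simp: disjnt_sym)
    qed
  qed
qed

end

context order_continuum begin

text \<open>Again a supremum argument, for the set of points up to which finitely many members of the cover
  suffice.\<close>

lemma compact_topo: "compact_space (topo X lt)"
  unfolding compact_space_alt topspace_topo
proof (intro allI impI, elim conjE)
  fix \<U> assume \<U>: "\<forall>U\<in>\<U>. openin (topo X lt) U" and cov: "X \<subseteq> \<Union>\<U>"
  define S where "S = {x\<in>X. \<exists>\<F>. finite \<F> \<and> \<F> \<subseteq> \<U> \<and> {y\<in>X. \<not> x \<sqsubset> y} \<subseteq> \<Union>\<F>}"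
  have "{y\<in>X. \<not> bt \<sqsubset> y} = {bt}" using lt_total bt_in bt_least by blast
  moreover obtain U where "U \<in> \<U>" "bt \<in> U" using cov bt_in by blast
  ultimately have btS: "bt \<in> S" unfolding S_def
    using bt_in by (auto intro!: exI[of _ "{U}"])
  have "\<exists>s\<in>X. (\<forall>x\<in>S. \<not> s \<sqsubset> x) \<and> (\<forall>v. v \<sqsubset> s \<longrightarrow> (\<exists>x\<in>S. v \<sqsubset> x))"
    by (rule lt_complete[of S tp]) (use btS tp_in tp_greatest in \<open>auto simp: S_def\<close>)
  then obtain s where s: "s \<in> X" "\<And>x. x \<in> S \<Longrightarrow> \<not> s \<sqsubset> x" "\<And>v. v \<sqsubset> s \<Longrightarrow> \<exists>x\<in>S. v \<sqsubset> x" by blast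
  obtain U where U: "U \<in> \<U>" "s \<in> U" using cov s by blast
  have Uo: "openin (topo X lt) U" using U \<U> by blast
  have "\<exists>x\<in>S. \<forall>y. x \<sqsubset> y \<and> y \<sqsubset> s \<longrightarrow> y \<in> U"
  proof (cases "bt \<sqsubset> s")
    case True
    then obtain a where a: "a \<sqsubset> s" "\<And>y. a \<sqsubset> y \<Longrightarrow> y \<sqsubset> s \<Longrightarrow> y \<in> U"
      using open_left_nbhd[OF Uo U(2)] by blast
    then obtain x where "x \<in> S" "a \<sqsubset> x" using s by blast
    then show ?thesis using a lt_trans by blast
  next
    case False
    then show ?thesis using lt_total[OF bt_in s(1)] btS bt_least by blast
  qed
  then obtain x where x: "x \<in> S" "\<And>y. x \<sqsubset> y \<Longrightarrow> y \<sqsubset> s \<Longrightarrow> y \<in> U" by blast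
  then obtain \<F> where F: "finite \<F>" "\<F> \<subseteq> \<U>" "{y\<in>X. \<not> x \<sqsubset> y} \<subseteq> \<Union>\<F>" unfolding S_def by blast
  have F': "finite (insert U \<F>)" "insert U \<F> \<subseteq> \<U>" using F U by auto
  have cs: "y \<in> \<Union>(insert U \<F>)" if "y \<in> X" "\<not> s \<sqsubset> y" for y
    using that x(2)[of y] F(3) U(2) lt_total[OF s(1), of y] by auto
  show "\<exists>\<F>. finite \<F> \<and> \<F> \<subseteq> \<U> \<and> X \<subseteq> \<Union>\<F>"
  proof (cases "s \<sqsubset> tp")
    case True
    then obtain b where b: "s \<sqsubset> b" "\<And>y. s \<sqsubset> y \<Longrightarrow> y \<sqsubset> b \<Longrightarrow> y \<in> U"
      using open_right_nbhd[OF Uo U(2)] by blast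
    obtain c where c: "s \<sqsubset> c" "c \<sqsubset> b" using b lt_dense by blast
    have "{y\<in>X. \<not> c \<sqsubset> y} \<subseteq> \<Union>(insert U \<F>)"
    proof
      fix y assume y: "y \<in> {y\<in>X. \<not> c \<sqsubset> y}"
      show "y \<in> \<Union>(insert U \<F>)"
      proof (cases "s \<sqsubset> y")
        case True
        then show ?thesis using b(2)[of y] not_lt_trans'[of c b y] c y by auto
      next
        case False
        then show ?thesis using cs y by blast
      qed
    qed
    then have "c \<in> S" unfolding S_def using F' lt_in1[OF c(2)] by blast
    then show ?thesis using s(2) c by blast
  next
    case False
    then have "\<not> s \<sqsubset> y" if "y \<in> X" for y
      using lt_total[OF s(1) tp_in] tp_greatest by blast
    then show ?thesis using cs F' by blast
  qed
qed

lemma linearly_ordered_continuum_topo: "linearly_ordered_continuum (topo X lt)"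
proof -
  have "connectedin (topo X lt) X"
    by (rule connectedin_if_convex) (auto intro: lt_in1)
  then have "connected_space (topo X lt)"
    using connectedin_topspace[of "topo X lt"] by simp
  moreover have "bt \<noteq> tp" using bt_tp by auto
  ultimately show ?thesis
    unfolding linearly_ordered_continuum_def continuum_def
    using linearly_ordered_space_topo compact_topo Hausdorff_topo bt_in tp_in by auto
qed

end

section \<open>Topological embeddings of continuous orders\<close>

text \<open>The images of the intervals on both sides of \<open>b\<close> are connected, hence convex. If \<open>f b\<close> were
  outside the interval between \<open>f a\<close> and \<open>f c\<close>, one of the latter values would be attained twice.\<close>

lemma continuous_inj_between:
  assumes "dense_complete X lt" and "lin_ord Y lt'"
    and cont: "continuous_map (topo X lt) (topo Y lt') f" and inj: "inj_on f X"
    and abc: "lt a b" "lt b c" and less: "lt' (f a) (f c)"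
  shows "lt' (f a) (f b)" and "lt' (f b) (f c)"
proof -
  interpret A: dense_complete X lt by fact
  interpret B: lin_ord Y lt' by fact
  have inX: "a \<in> X" "b \<in> X" "c \<in> X" using abc A.lt_in1 A.lt_in2 by auto
  have fY: "f x \<in> Y" if "x \<in> X" for x
    using continuous_map_image_subset_topspace[OF cont] that by auto
  have ac: "lt a c" using abc A.lt_trans by blast
  have con: "connectedin (topo Y lt') (f ` {z. (z = x \<or> lt x z) \<and> (z = y \<or> lt z y)})"
    if xy: "lt x y" for x y
  proof (rule connectedin_continuous_map_image[OF cont], rule A.connectedin_if_convex)
    show "{z. (z = x \<or> lt x z) \<and> (z = y \<or> lt z y)} \<subseteq> X"
      using A.lt_in1 A.lt_in2 xy by blast
    fix u v w assume "u \<in> {z. (z = x \<or> lt x z) \<and> (z = y \<or> lt z y)}"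
      "w \<in> {z. (z = x \<or> lt x z) \<and> (z = y \<or> lt z y)}" "lt u v" "lt v w"
    then show "v \<in> {z. (z = x \<or> lt x z) \<and> (z = y \<or> lt z y)}"
      using A.lt_trans by blast
  qed
  have ne: "f a \<noteq> f b" "f b \<noteq> f c"
    using inj inX abc A.lt_irrefl by (metis inj_onD)+
  have "\<not> lt' (f b) (f a)"
  proof
    assume ba: "lt' (f b) (f a)"
    have "f a \<in> f ` {z. (z = b \<or> lt b z) \<and> (z = c \<or> lt z c)}"
      by (rule B.connectedin_convex[OF con[OF abc(2)] _ _ ba less]) (use abc in auto)
    then obtain z where z: "z = b \<or> lt b z" "f z = f a" by force
    then have "lt a z" using abc A.lt_trans by blast
    then show False using z inj inX A.lt_in2 A.lt_irrefl by (metis inj_onD)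
  qed
  then show "lt' (f a) (f b)" using B.lt_total[OF fY fY, of a b] inX ne by blast
  have "\<not> lt' (f c) (f b)"
  proof
    assume cb: "lt' (f c) (f b)"
    have "f c \<in> f ` {z. (z = a \<or> lt a z) \<and> (z = b \<or> lt z b)}"
      by (rule B.connectedin_convex[OF con[OF abc(1)] _ _ less cb]) (use abc in auto)
    then obtain z where z: "z = b \<or> lt z b" "f z = f c" by force
    then have "lt z c" using abc A.lt_trans by blast
    then show False using z inj inX A.lt_in1 A.lt_irrefl by (metis inj_onD)
  qed
  then show "lt' (f b) (f c)" using B.lt_total[OF fY fY, of c b] inX ne by metis
qed

text \<open>Betweenness determines the order of all images once the images of the end points are ordered.\<close>

lemma continuous_inj_convex_embedding:
  assumes "order_continuum X lt bt tp" and "lin_ord Y lt'"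
    and cont: "continuous_map (topo X lt) (topo Y lt') f" and inj: "inj_on f X"
    and less: "lt' (f bt) (f tp)"
  shows "convex_embedding X lt Y lt' f"
proof -
  interpret A: order_continuum X lt bt tp by fact
  interpret B: lin_ord Y lt' by fact
  note between = continuous_inj_between[OF A.dense_complete_axioms B.lin_ord_axioms cont inj]
  have bt_less: "lt' (f bt) (f x)" if x: "lt bt x" for x
  proof (cases "x = tp")
    case False
    then have "lt x tp" using A.lt_total[OF A.lt_in2[OF x] A.tp_in] A.tp_greatest by blast
    then show ?thesis using between(1)[OF x _ less] by blast
  qed (simp add: less)
  have mono: "lt' (f x) (f y)" if xy: "lt x y" for x y
  proof (cases "x = bt")
    case True
    then show ?thesis using bt_less xy by blast
  next
    case False
    then have "lt bt x" using A.lt_total[OF A.bt_in A.lt_in1[OF xy]] A.bt_least by blast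
    moreover have "lt bt y" using calculation xy A.lt_trans by blast
    ultimately show ?thesis using between(2)[OF _ xy bt_less] by blast
  qed
  have con: "connectedin (topo Y lt') (f ` X)"
    by (rule connectedin_continuous_map_image[OF cont], rule A.connectedin_if_convex)
       (auto intro: A.lt_in1)
  show ?thesis
  proof
    show "f x \<in> Y" if "x \<in> X" for x
      using continuous_map_image_subset_topspace[OF cont] that by auto
    show "v \<in> f ` X" if "x \<in> X" "y \<in> X" "lt' (f x) v" "lt' v (f y)" for x y v
      by (rule B.connectedin_convex[OF con _ _ that(3,4)]) (use that in auto)
  qed (rule mono)
qed

lemma homeomorphic_subspace_convex_embedding:
  assumes X: "order_continuum X lt bt tp" and Y: "lin_ord Y lt'"
    and "topo X lt homeomorphic_space subtopology (topo Y lt') S"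
  obtains f where "convex_embedding X lt Y lt' f"
  | f where "convex_embedding X lt Y (conversep lt') f"
proof -
  interpret A: order_continuum X lt bt tp by fact
  interpret B: lin_ord Y lt' by fact
  obtain f where f: "homeomorphic_map (topo X lt) (subtopology (topo Y lt') S) f"
    using assms(3) homeomorphic_space by blast
  have cont: "continuous_map (topo X lt) (topo Y lt') f"
    using homeomorphic_imp_continuous_map[OF f] continuous_map_into_fulltopology by blast
  have inj: "inj_on f X" using homeomorphic_imp_injective_map[OF f] by simp
  have fY: "f x \<in> Y" if "x \<in> X" for x
    using continuous_map_image_subset_topspace[OF cont] that by auto
  have "f bt \<noteq> f tp" using inj A.bt_in A.tp_in A.bt_tp A.lt_irrefl by (metis inj_onD)
  then consider "lt' (f bt) (f tp)" | "lt' (f tp) (f bt)"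
    using B.lt_total[OF fY fY, of bt tp] A.bt_in A.tp_in by blast
  then show thesis
  proof cases
    case 1
    then show thesis using that(1) continuous_inj_convex_embedding[OF X Y cont inj] by blast
  next
    case 2
    then show thesis
      using that(2) continuous_inj_convex_embedding[OF X B.rev_lin_ord _ inj] cont
      by (simp add: B.topo_rev)
  qed
qed

section \<open>Paths\<close>

text \<open>A path is separable. The image of a countable dense set of parameters meets every open interval
  inside the path, so its part below \<open>p\<close> would be countable and cofinal.\<close>

lemma (in dense_complete) ucof_not_inside_path:
  assumes g: "continuous_map (subtopology euclideanreal {0..1}) (topo X lt) g"
    and a: "a \<in> g ` {0..1}" and b: "b \<in> g ` {0..1}" and p: "a \<sqsubset> p" "p \<sqsubset> b"
  shows "\<not> ucof lt p"
proof
  assume u: "ucof lt p"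
  obtain T :: "real set" where T: "countable T" "T \<subseteq> {0..1}" "{0..1} \<subseteq> closure T"
    using separable[of "{0..1::real}"] by blast
  have con: "connectedin (topo X lt) (g ` {0..1})"
    by (rule connectedin_continuous_map_image[OF g]) (simp add: connectedin_subtopology)
  let ?C = "insert a {d \<in> g ` T. d \<sqsubset> p}"
  have "countable ?C" using T by auto
  moreover have "\<forall>c\<in>?C. c \<sqsubset> p" using p by blast
  ultimately obtain q where q: "q \<sqsubset> p" "\<forall>c\<in>?C. c \<sqsubset> q"
    using u[unfolded ucof_def, rule_format, of ?C] by blast
  obtain m where m: "q \<sqsubset> m" "m \<sqsubset> p" using lt_dense q by blast
  have "a \<sqsubset> m" "m \<sqsubset> b" using q m p lt_trans by blast+
  then have "m \<in> g ` {0..1}" using connectedin_convex[OF con a b] by blast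
  then obtain s where s: "s \<in> {0..1}" "m = g s" by blast
  let ?V = "{x. q \<sqsubset> x \<and> x \<sqsubset> p}"
  have "openin (topo X lt) ?V" using open_between q lt_in1 lt_in2 by blast
  then have "openin (subtopology euclideanreal {0..1}) {x \<in> topspace (subtopology euclideanreal {0..1}). g x \<in> ?V}"
    using openin_continuous_map_preimage[OF g] by blast
  then obtain O' where O': "open O'" "{x \<in> {0..1}. g x \<in> ?V} = O' \<inter> {0..1}"
    by (auto simp: openin_subtopology)
  have "s \<in> O'" using O' s m by blast
  then have "O' \<inter> T \<noteq> {}"
    using open_Int_closure_eq_empty[OF O'(1), of T] T s by blast
  then obtain r where "r \<in> T" "q \<sqsubset> g r" "g r \<sqsubset> p" using O' T by blast
  then show False using q lt_asym by blast
qed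

lemma (in dense_complete) totally_pathwise_disconnected_topo:
  assumes ud: "\<And>x y. x \<sqsubset> y \<Longrightarrow> \<exists>p. x \<sqsubset> p \<and> p \<sqsubset> y \<and> (ucof lt p \<or> ucof (conversep lt) p)"
  shows "totally_pathwise_disconnected (topo X lt)"
proof -
  have no: False
    if g: "continuous_map (subtopology euclideanreal {0..1}) (topo X lt) g"
      "a \<in> g ` {0..1}" "b \<in> g ` {0..1}" "a \<sqsubset> b" for a b g
  proof -
    obtain p where p: "a \<sqsubset> p" "p \<sqsubset> b" "ucof lt p \<or> ucof (conversep lt) p" using ud g by blast
    interpret R: dense_complete X "conversep lt" by (rule rev_dense_complete)
    show False
      using p ucof_not_inside_path[OF g(1-3)] R.ucof_not_inside_path[of g b a p] g
      by (auto simp: topo_rev)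
  qed
  have eq: "x = y" if xy: "path_component_of (topo X lt) x y" for x y
  proof (rule ccontr)
    assume ne: "x \<noteq> y"
    obtain g where g: "continuous_map (subtopology euclideanreal {0..1}) (topo X lt) g" "g 0 = x" "g 1 = y"
      using xy unfolding path_component_of_def pathin_def by blast
    have im: "x \<in> g ` {0..1}" "y \<in> g ` {0..1}" using g by force+
    moreover have "x \<in> X" "y \<in> X"
      using im continuous_map_image_subset_topspace[OF g(1)] by auto
    ultimately consider "x \<sqsubset> y" | "y \<sqsubset> x" using lt_total ne by blast
    then show False using no[OF g(1)] im by cases auto
  qed
  have "\<exists>x. C = {x}" if "C \<in> path_components_of (topo X lt)" for C
  proof -
    obtain x where "x \<in> X" "C = Collect (path_component_of (topo X lt) x)"
      using \<open>C \<in> _\<close> unfolding path_components_of_def by auto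
    then have "C = {x}" using eq[of x] path_component_of_refl[of "topo X lt" x] by auto
    then show ?thesis by blast
  qed
  then show ?thesis unfolding totally_pathwise_disconnected_def by blast
qed

section \<open>Weight\<close>

text \<open>The intervals with end points in the dense set, or without an end point on
  one or both sides, form a base.\<close>

lemma (in lin_ord) weight_le_dense:
  assumes "D \<subseteq> X" and dense: "\<And>x y. x \<sqsubset> y \<Longrightarrow> \<exists>d\<in>D. x \<sqsubset> d \<and> d \<sqsubset> y"
    and D: "|D| \<le>o \<kappa>" and \<kappa>: "Cinfinite \<kappa>"
  shows "weight (topo X lt) \<le>o \<kappa>"
proof -
  let ?iv = "\<lambda>(p, q). {x \<in> X. (\<forall>a. p = Some a \<longrightarrow> a \<sqsubset> x) \<and> (\<forall>b. q = Some b \<longrightarrow> x \<sqsubset> b)}"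
  let ?E = "{None} \<union> Some ` D"
  have inf: "infinite (Field \<kappa>)" and co: "Card_order \<kappa>" using \<kappa> by (auto simp: cinfinite_def)
  have "|Some ` D| \<le>o \<kappa>" using card_of_image D ordLeq_transitive by blast
  moreover have "|{None :: 'a option}| \<le>o \<kappa>"
    by (rule ordLess_imp_ordLeq, rule finite_ordLess_infinite)
      (use inf co in \<open>auto simp: card_order_on_def Field_card_of card_of_well_order_on\<close>)
  ultimately have E: "|?E| \<le>o \<kappa>" using card_of_Un_ordLeq_infinite_Field[OF inf _ _ co] by blast
  then have "|?E \<times> ?E| \<le>o \<kappa>" using card_of_Times_ordLeq_infinite_Field[OF inf E E co] by blast
  then have card: "|?iv ` (?E \<times> ?E)| \<le>o \<kappa>" using card_of_image ordLeq_transitive by blast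
  have op: "openin (topo X lt) (?iv (p, q))" if "p \<in> ?E" "q \<in> ?E" for p q
  proof -
    have X: "openin (topo X lt) X" by (metis openin_topspace topspace_topo)
    have "openin (topo X lt) {x \<in> X. \<forall>a. p = Some a \<longrightarrow> a \<sqsubset> x}"
    proof (cases p)
      case (Some a)
      then have "{x \<in> X. \<forall>a. p = Some a \<longrightarrow> a \<sqsubset> x} = {x. a \<sqsubset> x}" using lt_in2 by auto
      then show ?thesis using open_above[of a] that Some \<open>D \<subseteq> X\<close> by auto
    qed (use X in simp)
    moreover have "openin (topo X lt) {x \<in> X. \<forall>b. q = Some b \<longrightarrow> x \<sqsubset> b}"
    proof (cases q)
      case (Some a)
      then have "{x \<in> X. \<forall>b. q = Some b \<longrightarrow> x \<sqsubset> b} = {x. x \<sqsubset> a}" using lt_in1 by auto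
      then show ?thesis using open_below[of a] that Some \<open>D \<subseteq> X\<close> by auto
    qed (use X in simp)
    moreover have "?iv (p, q) = {x \<in> X. \<forall>a. p = Some a \<longrightarrow> a \<sqsubset> x} \<inter> {x \<in> X. \<forall>b. q = Some b \<longrightarrow> x \<sqsubset> b}"
      by auto
    ultimately show ?thesis by (simp add: openin_Int)
  qed
  have "is_base (topo X lt) (?iv ` (?E \<times> ?E))"
    unfolding is_base_def
  proof (intro conjI allI impI ballI)
    show "openin (topo X lt) V" if "V \<in> ?iv ` (?E \<times> ?E)" for V
      using that op by blast
  next
    fix U x assume Ux: "openin (topo X lt) U \<and> x \<in> U"
    then have xX: "x \<in> X" using openin_subset by fastforce
    obtain p where p: "p \<in> ?E" "\<forall>a. p = Some a \<longrightarrow> a \<sqsubset> x"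
      "\<And>y. y \<sqsubset> x \<Longrightarrow> \<forall>a. p = Some a \<longrightarrow> a \<sqsubset> y \<Longrightarrow> y \<in> U"
    proof (cases "\<exists>z. z \<sqsubset> x")
      case True
      then obtain a where a: "a \<sqsubset> x" "\<And>y. a \<sqsubset> y \<Longrightarrow> y \<sqsubset> x \<Longrightarrow> y \<in> U"
        using open_left_nbhd[of U x] Ux by blast
      then obtain d where d: "d \<in> D" "a \<sqsubset> d" "d \<sqsubset> x" using dense by blast
      show thesis
      proof (rule that[of "Some d"])
        show "y \<in> U" if "y \<sqsubset> x" "\<forall>a. Some d = Some a \<longrightarrow> a \<sqsubset> y" for y
          using that a(2)[of y] lt_trans[OF d(2)] by simp
      qed (use d in auto)
    next
      case False
      then show thesis using that[of None] by blast
    qed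
    obtain q where q: "q \<in> ?E" "\<forall>a. q = Some a \<longrightarrow> x \<sqsubset> a"
      "\<And>y. x \<sqsubset> y \<Longrightarrow> \<forall>a. q = Some a \<longrightarrow> y \<sqsubset> a \<Longrightarrow> y \<in> U"
    proof (cases "\<exists>z. x \<sqsubset> z")
      case True
      then obtain a where a: "x \<sqsubset> a" "\<And>y. x \<sqsubset> y \<Longrightarrow> y \<sqsubset> a \<Longrightarrow> y \<in> U"
        using open_right_nbhd[of U x] Ux by blast
      then obtain d where d: "d \<in> D" "x \<sqsubset> d" "d \<sqsubset> a" using dense by blast
      show thesis
      proof (rule that[of "Some d"])
        show "y \<in> U" if "x \<sqsubset> y" "\<forall>a. Some d = Some a \<longrightarrow> y \<sqsubset> a" for y
          using that a(2)[of y] lt_trans[OF _ d(3)] by simp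
      qed (use d in auto)
    next
      case False
      then show thesis using that[of None] by blast
    qed
    have "x \<in> ?iv (p, q)" using xX p q by auto
    moreover have "?iv (p, q) \<subseteq> U"
    proof
      fix y assume y: "y \<in> ?iv (p, q)"
      then have "y \<in> X" "\<forall>a. p = Some a \<longrightarrow> a \<sqsubset> y" "\<forall>b. q = Some b \<longrightarrow> y \<sqsubset> b" by auto
      then show "y \<in> U" using p(3)[of y] q(3)[of y] lt_total[OF xX, of y] Ux by blast
    qed
    ultimately show "\<exists>V\<in>?iv ` (?E \<times> ?E). x \<in> V \<and> V \<subseteq> U"
      by (intro bexI[of _ "?iv (p, q)"] conjI imageI SigmaI p(1) q(1))
  qed
  then show ?thesis using weight_props(2) card ordLeq_transitive by blast
qed

text \<open>Pick for every \<open>\<beta> < k\<close> a basic neighbourhood of \<open>w \<beta>\<close> below the next value of \<open>w\<close>.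
  Different indices give different neighbourhoods, because the later point is missing from
  the earlier neighbourhood.\<close>

lemma (in lin_ord) weight_ge_increasing:
  fixes w :: "'w::wellorder \<Rightarrow> 'a"
  assumes mono: "\<And>\<beta> \<gamma>. \<beta> < \<gamma> \<Longrightarrow> \<gamma> < k \<Longrightarrow> w \<beta> \<sqsubset> w \<gamma>"
    and lim: "\<And>\<beta>. \<beta> < k \<Longrightarrow> \<exists>\<gamma><k. \<beta> < \<gamma>"
  shows "|{..<k}| \<le>o weight (topo X lt)"
proof -
  obtain B where B: "is_base (topo X lt) B" "weight (topo X lt) =o |B|"
    using weight_props(1) by blast
  define nxt where "nxt \<beta> = (LEAST \<gamma>. \<beta> < \<gamma>)" for \<beta> :: 'w
  have nxt: "\<beta> < nxt \<beta>" "nxt \<beta> < k" if \<beta>: "\<beta> < k" for \<beta>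
  proof -
    obtain \<gamma> where \<gamma>: "\<gamma> < k" "\<beta> < \<gamma>" using lim[OF \<beta>] by blast
    show "\<beta> < nxt \<beta>" unfolding nxt_def by (rule LeastI[of _ \<gamma>]) (rule \<gamma>)
    have "nxt \<beta> \<le> \<gamma>" unfolding nxt_def by (rule Least_le) (rule \<gamma>)
    then show "nxt \<beta> < k" using \<gamma> by simp
  qed
  have nxt_le: "nxt \<beta> \<le> \<gamma>" if "\<beta> < \<gamma>" for \<beta> \<gamma> unfolding nxt_def using that by (rule Least_le)
  have "\<exists>V\<in>B. w \<beta> \<in> V \<and> V \<subseteq> {x. x \<sqsubset> w (nxt \<beta>)}" if True: "\<beta> < k" for \<beta>
  proof -
    have less: "w \<beta> \<sqsubset> w (nxt \<beta>)" using mono[OF nxt[OF True]] .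
    have "openin (topo X lt) {x. x \<sqsubset> w (nxt \<beta>)}" "w \<beta> \<in> {x. x \<sqsubset> w (nxt \<beta>)}"
      using open_below lt_in2[OF less] less by auto
    then show ?thesis
      using B(1)[unfolded is_base_def, THEN conjunct2, rule_format] by blast
  qed
  then have "\<exists>V. \<forall>\<beta>\<in>{..<k}. V \<beta> \<in> B \<and> w \<beta> \<in> V \<beta> \<and> V \<beta> \<subseteq> {x. x \<sqsubset> w (nxt \<beta>)}"
    by (intro bchoice) auto
  then obtain V where V: "\<And>\<beta>. \<beta> < k \<Longrightarrow> V \<beta> \<in> B" "\<And>\<beta>. \<beta> < k \<Longrightarrow> w \<beta> \<in> V \<beta>"
    "\<And>\<beta>. \<beta> < k \<Longrightarrow> V \<beta> \<subseteq> {x. x \<sqsubset> w (nxt \<beta>)}"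
    by auto
  have ne: "V \<beta> \<noteq> V \<gamma>" if "\<beta> < \<gamma>" "\<gamma> < k" for \<beta> \<gamma>
  proof
    assume "V \<beta> = V \<gamma>"
    moreover have "\<beta> < k" using that by simp
    ultimately have less: "w \<gamma> \<sqsubset> w (nxt \<beta>)" using V(2)[of \<gamma>] V(3)[of \<beta>] that by blast
    have "nxt \<beta> = \<gamma> \<or> nxt \<beta> < \<gamma>" using nxt_le[OF that(1)] by auto
    then show False using less mono[of "nxt \<beta>" \<gamma>] that lt_asym[OF less] by auto
  qed
  have "inj_on V {..<k}"
  proof (rule inj_onI)
    fix \<beta> \<gamma> assume "\<beta> \<in> {..<k}" "\<gamma> \<in> {..<k}" "V \<beta> = V \<gamma>"
    then show "\<beta> = \<gamma>" using ne[of \<beta> \<gamma>] ne[of \<gamma> \<beta>] by (cases \<beta> \<gamma> rule: linorder_cases) auto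
  qed
  then have "|{..<k}| \<le>o |B|" using V(1) card_of_ordLeqI[of V "{..<k}" B] by auto
  then show ?thesis by (rule ordLeq_ordIso_trans[OF _ ordIso_symmetric[OF B(2)]])
qed

section \<open>Continua that carry a code\<close>

text \<open>The switches are enumerated increasingly by \<open>w\<close>. Their cofinality from below spells the
  code \<open>A\<close>, and their cofinality from above singles out the first of them.\<close>

locale coded_continuum = order_continuum X lt bt tp
  for X :: "'a set" and lt bt tp +
  fixes k :: "'w::wellorder" and A :: "'w set" and w :: "'w \<Rightarrow> 'a"
  assumes ucof_dense: "lt x y \<Longrightarrow> \<exists>p. lt x p \<and> lt p y \<and> (ucof lt p \<or> ucof (conversep lt) p)"
    and w_mono: "\<beta> < \<gamma> \<Longrightarrow> \<gamma> < k \<Longrightarrow> lt (w \<beta>) (w \<gamma>)"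
    and w_switch: "switch lt x \<longleftrightarrow> (\<exists>\<beta><k. x = w \<beta>)"
    and w_code: "\<beta> < k \<Longrightarrow> ucof lt (w \<beta>) \<longleftrightarrow> \<beta> \<in> A"
    and w_first: "\<beta> < k \<Longrightarrow> ucof (conversep lt) (w \<beta>) \<longleftrightarrow> (\<forall>\<gamma>. \<beta> \<le> \<gamma>)"
    and code_sub: "A \<subseteq> {..<k}"
    and k_limit: "\<beta> < k \<Longrightarrow> \<exists>\<gamma><k. \<beta> < \<gamma>"

text \<open>Between switches \<open>f\<close> induces a strictly increasing map \<open>h\<close> on the ordinal \<open>k\<close> whose
  range is convex. It fixes the least ordinal because the first switch is marked,
  hence it is the identity.\<close>

lemma code_eq_if_embedding:
  fixes k :: "'w::wellorder"
  assumes "coded_continuum X lt bt tp k A w" "coded_continuum Y lt' bt' tp' k B v"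
    and "convex_embedding X lt Y lt' f"
  shows "A = B"
proof -
  interpret A: coded_continuum X lt bt tp k A w by fact
  interpret B: coded_continuum Y lt' bt' tp' k B v by fact
  interpret E: convex_embedding X lt Y lt' f by fact
  have sw: "\<exists>p q. lt p (w \<beta>) \<and> lt (w \<beta>) q" if "\<beta> < k" for \<beta>
    using A.w_switch[of "w \<beta>"] that unfolding switch_def by blast
  have "\<exists>\<gamma>. \<beta> < k \<longrightarrow> \<gamma> < k \<and> f (w \<beta>) = v \<gamma>" for \<beta>
    using sw[of \<beta>] E.switch_emb[of _ "w \<beta>"] A.w_switch[of "w \<beta>"] B.w_switch[of "f (w \<beta>)"] by blast
  then obtain h where h: "\<And>\<beta>. \<beta> < k \<Longrightarrow> h \<beta> < k" "\<And>\<beta>. \<beta> < k \<Longrightarrow> f (w \<beta>) = v (h \<beta>)" by metis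
  have v_less: "\<beta> < \<gamma>" if "lt' (v \<beta>) (v \<gamma>)" "\<beta> < k" "\<gamma> < k" for \<beta> \<gamma>
    using that B.w_mono[of \<gamma> \<beta>] B.lt_asym[OF that(1)] B.lt_irrefl by (cases \<beta> \<gamma> rule: linorder_cases) auto
  have w_less: "\<beta> < \<gamma>" if "lt (w \<beta>) (w \<gamma>)" "\<beta> < k" "\<gamma> < k" for \<beta> \<gamma>
    using that A.w_mono[of \<gamma> \<beta>] A.lt_asym[OF that(1)] A.lt_irrefl by (cases \<beta> \<gamma> rule: linorder_cases) auto
  have h_mono: "h \<beta> < h \<gamma>" if "\<beta> < \<gamma>" "\<gamma> < k" for \<beta> \<gamma>
  proof (rule v_less)
    have "lt' (f (w \<beta>)) (f (w \<gamma>))" using that A.w_mono E.emb_mono by blast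
    then show "lt' (v (h \<beta>)) (v (h \<gamma>))" using h that by simp
  qed (use h that in auto)
  define z :: 'w where "z = (LEAST z. True)"
  have z: "z \<le> \<gamma>" for \<gamma> unfolding z_def by (rule Least_le) simp
  have hz: "h z = z" if "z < k"
  proof -
    have "ucof (conversep lt) (w z)" using A.w_first that z by blast
    then have "ucof (conversep lt') (f (w z))" using E.ucof_emb_rev sw[OF that] by blast
    then have "\<forall>\<gamma>. h z \<le> \<gamma>" using h that B.w_first[of "h z"] by simp
    then show ?thesis using z antisym by blast
  qed
  have h_id: "\<beta> < k \<Longrightarrow> h \<beta> = \<beta>" for \<beta>
  proof (induction \<beta> rule: less_induct)
    case (less \<beta>)
    have zk: "z < k" using z less.prems le_less_trans by blast
    have "\<not> h \<beta> < \<beta>"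
    proof
      assume hb: "h \<beta> < \<beta>"
      then have "h (h \<beta>) = h \<beta>" using less by (meson less_trans)
      then show False using h_mono[OF hb less.prems] by simp
    qed
    moreover have "\<not> \<beta> < h \<beta>"
    proof
      assume hb: "\<beta> < h \<beta>"
      have zb: "z < \<beta>" using hb hz z zk by (metis le_less)
      have "lt' (f (w z)) (v \<beta>)" "lt' (v \<beta>) (f (w \<beta>))"
        using h hz zk less.prems zb hb B.w_mono by simp_all
      then obtain u where u: "lt (w z) u" "lt u (w \<beta>)" "f u = v \<beta>"
        using E.emb_between[of "w z" "w \<beta>" "v \<beta>"] A.lt_in1 A.lt_in2 sw zk less.prems by metis
      have "switch lt u" using E.switch_emb[OF u(1,2)] B.w_switch u(3) less.prems by auto
      then obtain \<gamma> where \<gamma>: "\<gamma> < k" "u = w \<gamma>" using A.w_switch by blast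
      then have "\<gamma> < \<beta>" using w_less u less.prems by blast
      then have "v \<beta> = v \<gamma>" using less.IH \<gamma> u h by metis
      then show False using B.w_mono[OF \<open>\<gamma> < \<beta>\<close> less.prems] by simp
    qed
    ultimately show ?case by (meson linorder_neqE)
  qed
  have "\<beta> \<in> A \<longleftrightarrow> \<beta> \<in> B" if "\<beta> < k" for \<beta>
    using A.w_code[OF that] B.w_code[OF that] E.ucof_emb[of _ "w \<beta>"] sw[OF that] h[OF that] h_id[OF that]
    by auto
  then show ?thesis using A.code_sub B.code_sub by blast
qed

text \<open>An antitone embedding would make the map on the indices of switches strictly decreasing on an
  ordinal without last element.\<close>

lemma no_reversing_embedding:
  fixes k :: "'w::wellorder"
  assumes "coded_continuum X lt bt tp k A w" "coded_continuum Y lt' bt' tp' k B v" and k: "\<exists>\<beta>. \<beta> < k"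
  shows "\<not> convex_embedding X lt Y (conversep lt') f"
proof
  assume "convex_embedding X lt Y (conversep lt') f"
  then interpret E: convex_embedding X lt Y "conversep lt'" f .
  interpret A: coded_continuum X lt bt tp k A w by fact
  interpret B: coded_continuum Y lt' bt' tp' k B v by fact
  have sw: "\<exists>p q. lt p (w \<beta>) \<and> lt (w \<beta>) q" if "\<beta> < k" for \<beta>
    using A.w_switch[of "w \<beta>"] that unfolding switch_def by blast
  have "\<exists>\<gamma>. \<beta> < k \<longrightarrow> \<gamma> < k \<and> f (w \<beta>) = v \<gamma>" for \<beta>
    using sw[of \<beta>] E.switch_emb[of _ "w \<beta>"] A.w_switch[of "w \<beta>"] B.w_switch[of "f (w \<beta>)"]
    unfolding switch_rev by blast
  then obtain h where h: "\<And>\<beta>. \<beta> < k \<Longrightarrow> h \<beta> < k" "\<And>\<beta>. \<beta> < k \<Longrightarrow> f (w \<beta>) = v (h \<beta>)" by metis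
  have v_less: "\<beta> < \<gamma>" if "lt' (v \<beta>) (v \<gamma>)" "\<beta> < k" "\<gamma> < k" for \<beta> \<gamma>
    using that B.w_mono[of \<gamma> \<beta>] B.lt_asym[OF that(1)] B.lt_irrefl by (cases \<beta> \<gamma> rule: linorder_cases) auto
  have h_anti: "h \<gamma> < h \<beta>" if "\<beta> < \<gamma>" "\<gamma> < k" for \<beta> \<gamma>
  proof (rule v_less)
    have "lt' (f (w \<gamma>)) (f (w \<beta>))" using that A.w_mono E.emb_mono by blast
    then show "lt' (v (h \<gamma>)) (v (h \<beta>))" using h that by simp
  qed (use h that in auto)
  define m where "m = (LEAST m. \<exists>\<beta><k. h \<beta> = m)"
  have "\<exists>\<beta><k. h \<beta> = m" unfolding m_def by (rule LeastI_ex) (use k in blast)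
  then obtain \<beta> where \<beta>: "\<beta> < k" "h \<beta> = m" by blast
  then obtain \<gamma> where \<gamma>: "\<beta> < \<gamma>" "\<gamma> < k" using A.k_limit by blast
  then have "h \<gamma> < m" using h_anti \<beta> by blast
  moreover have "m \<le> h \<gamma>" unfolding m_def by (rule Least_le) (use \<gamma> in blast)
  ultimately show False by simp
qed

lemma code_eq_if_homeomorphic:
  fixes k :: "'w::wellorder"
  assumes X: "coded_continuum X lt bt tp k A w" and Y: "coded_continuum Y lt' bt' tp' k B v"
    and k: "\<exists>\<beta>. \<beta> < k"
    and hom: "topo X lt homeomorphic_space subtopology (topo Y lt') S"
  shows "A = B"
proof -
  interpret A: coded_continuum X lt bt tp k A w by fact
  interpret B: coded_continuum Y lt' bt' tp' k B v by fact
  show ?thesis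
    using homeomorphic_subspace_convex_embedding[OF A.order_continuum_axioms B.lin_ord_axioms hom]
      code_eq_if_embedding[OF X Y] no_reversing_embedding[OF X Y k] by blast
qed

text \<open>The continua are first constructed on a large type of transfinite sequences and then copied to
  any type with enough elements.\<close>

lemma coded_continuum_transport:
  fixes k :: "'w::wellorder" and g :: "'a \<Rightarrow> 'b"
  assumes "coded_continuum X lt bt tp k A w" and g: "inj_on g X"
  defines "lt' \<equiv> \<lambda>u v. \<exists>x y. u = g x \<and> v = g y \<and> lt x y"
  shows "coded_continuum (g ` X) lt' (g bt) (g tp) k A (g \<circ> w)" and "convex_embedding X lt (g ` X) lt' g"
proof -
  interpret A: coded_continuum X lt bt tp k A w by fact
  have iff: "lt' (g x) (g y) \<longleftrightarrow> lt x y" if "x \<in> X" "y \<in> X" for x y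
    unfolding lt'_def using g that A.lt_in1 A.lt_in2 unfolding inj_on_def by blast
  have lt'E: "\<exists>x y. x \<in> X \<and> y \<in> X \<and> u = g x \<and> v = g y \<and> lt x y" if "lt' u v" for u v
    using that A.lt_in1 A.lt_in2 unfolding lt'_def by blast
  interpret B: lin_ord "g ` X" lt'
  proof
    show "\<not> lt' x x" for x using lt'E[of x x] iff A.lt_irrefl by blast
    show "lt' x z" if "lt' x y" "lt' y z" for x y z
      using lt'E[OF that(1)] lt'E[OF that(2)] A.lt_trans iff that by blast
    show "lt' x y \<or> x = y \<or> lt' y x" if "x \<in> g ` X" "y \<in> g ` X" for x y
      using that A.lt_total iff by blast
  qed (use lt'E in blast)+
  interpret E: convex_embedding X lt "g ` X" lt' g
  proof
    show "lt' (g x) (g y)" if "lt x y" for x y using that iff A.lt_in1 A.lt_in2 by blast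
    show "v \<in> g ` X" if "lt' (g x) v" for x v using B.lt_in2 that by blast
  qed blast
  show "convex_embedding X lt (g ` X) lt' g" ..
  show "coded_continuum (g ` X) lt' (g bt) (g tp) k A (g \<circ> w)"
  proof
    show "\<exists>z. lt' x z \<and> lt' z y" if "lt' x y" for x y
      using lt'E[OF that] A.lt_dense E.emb_mono by blast
  next
    fix S u assume S: "S \<subseteq> g ` X" "S \<noteq> {}" "u \<in> g ` X" "\<forall>x\<in>S. \<not> lt' u x"
    obtain T where T: "T \<subseteq> X" "S = g ` T" using S(1) by (meson subset_imageE)
    obtain t where t: "t \<in> X" "u = g t" using S(3) by blast
    have "\<exists>s\<in>X. (\<forall>x\<in>T. \<not> lt s x) \<and> (\<forall>v. lt v s \<longrightarrow> (\<exists>x\<in>T. lt v x))"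
      by (rule A.lt_complete[of T t]) (use T S t E.emb_mono in auto)
    then obtain s where s: "s \<in> X" "\<And>x. x \<in> T \<Longrightarrow> \<not> lt s x" "\<And>v. lt v s \<Longrightarrow> \<exists>x\<in>T. lt v x" by blast
    have "\<not> lt' (g s) x" if "x \<in> S" for x
      using that T s(1,2) E.emb_less_iff by blast
    moreover have "\<exists>x\<in>S. lt' v x" if v: "lt' v (g s)" for v
    proof -
      obtain v' where "v' \<in> X" "v = g v'" using B.lt_in1[OF v] by blast
      then show ?thesis using v s(1,3) T E.emb_less_iff by blast
    qed
    ultimately show "\<exists>s\<in>g ` X. (\<forall>x\<in>S. \<not> lt' s x) \<and> (\<forall>v. lt' v s \<longrightarrow> (\<exists>x\<in>S. lt' v x))"
      using s(1) by blast
  next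
    show "g bt \<in> g ` X" "g tp \<in> g ` X" using A.bt_in A.tp_in by auto
    show "\<not> lt' x (g bt)" for x using B.lt_in1[of x "g bt"] E.emb_less_iff A.bt_in A.bt_least by blast
    show "\<not> lt' (g tp) x" for x using B.lt_in2[of "g tp" x] E.emb_less_iff A.tp_in A.tp_greatest by blast
    show "lt' (g bt) (g tp)" using A.bt_tp E.emb_mono by blast
  next
    fix u v assume "lt' u v"
    then obtain x y where xy: "u = g x" "v = g y" "lt x y" using lt'E by blast
    then obtain p where "lt x p" "lt p y" "ucof lt p \<or> ucof (conversep lt) p" using A.ucof_dense by blast
    then show "\<exists>p. lt' u p \<and> lt' p v \<and> (ucof lt' p \<or> ucof (conversep lt') p)"
      using xy E.ucof_emb E.ucof_emb_rev E.emb_mono by blast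
  next
    show "lt' ((g \<circ> w) \<beta>) ((g \<circ> w) \<gamma>)" if "\<beta> < \<gamma>" "\<gamma> < k" for \<beta> \<gamma>
      using that A.w_mono E.emb_mono by simp
  next
    fix u
    show "switch lt' u \<longleftrightarrow> (\<exists>\<beta><k. u = (g \<circ> w) \<beta>)"
    proof
      assume sw: "switch lt' u"
      then obtain p q where pq: "lt' p u" "lt' u q" unfolding switch_def by blast
      obtain x where "u = g x" "x \<in> X" using B.lt_in1[OF pq(2)] by blast
      moreover obtain y where "p = g y" "y \<in> X" using B.lt_in1[OF pq(1)] by blast
      moreover obtain z where "q = g z" "z \<in> X" using B.lt_in2[OF pq(2)] by blast
      ultimately
      show "\<exists>\<beta><k. u = (g \<circ> w) \<beta>"
        using sw pq E.switch_emb[of y x z] E.emb_less_iff A.w_switch by auto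
    next
      assume "\<exists>\<beta><k. u = (g \<circ> w) \<beta>"
      then obtain \<beta> where \<beta>: "\<beta> < k" "u = g (w \<beta>)" by auto
      then have sw: "switch lt (w \<beta>)" using A.w_switch by blast
      then show "switch lt' u" using \<beta> E.switch_emb unfolding switch_def[of lt] by blast
    qed
  next
    fix \<beta> assume \<beta>: "\<beta> < k"
    then have sw: "switch lt (w \<beta>)" using A.w_switch by blast
    then obtain p q where "lt p (w \<beta>)" "lt (w \<beta>) q" unfolding switch_def by blast
    then show "ucof lt' ((g \<circ> w) \<beta>) \<longleftrightarrow> \<beta> \<in> A" "ucof (conversep lt') ((g \<circ> w) \<beta>) \<longleftrightarrow> (\<forall>\<gamma>. \<beta> \<le> \<gamma>)"
      using A.w_code[OF \<beta>] A.w_first[OF \<beta>] E.ucof_emb E.ucof_emb_rev by auto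
  next
    show "A \<subseteq> {..<k}" by (rule A.code_sub)
    show "\<exists>\<gamma><k. \<beta> < \<gamma>" if "\<beta> < k" for \<beta> using A.k_limit that by blast
  qed
qed

section \<open>Lexicographically ordered transfinite sequences\<close>

text \<open>Ordinals are represented by the elements of a type of class \<open>wellorder\<close>, each
  standing for the order type of its initial segment. This is the ordinal zero.\<close>

definition zero_elt :: "'a::wellorder" where "zero_elt = (LEAST x. True)"

lemma zero_elt_le [simp]: "zero_elt \<le> (x::'a::wellorder)"
  unfolding zero_elt_def by (rule Least_le) simp

lemma not_less_zero_elt [simp]: "\<not> (x::'a::wellorder) < zero_elt"
  by (simp add: not_less)

text \<open>The ordinal successor, provided that there is a larger element at all.\<close>

definition succ_elt :: "'a::wellorder \<Rightarrow> 'a" where "succ_elt x = (LEAST y. x < y)"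

lemma succ_elt_le: "x < y \<Longrightarrow> succ_elt x \<le> (y::'a::wellorder)"
  unfolding succ_elt_def by (rule Least_le)

lemma less_succ_elt: "x < y \<Longrightarrow> x < succ_elt (x::'a::wellorder)"
  unfolding succ_elt_def by (rule LeastI)

lemma less_succ_eltD: "y < succ_elt x \<Longrightarrow> y \<le> (x::'a::wellorder)"
  unfolding succ_elt_def using not_less_Least not_le by blast

definition lex_less :: "('i::wellorder \<Rightarrow> 'v::wellorder) \<Rightarrow> ('i \<Rightarrow> 'v) \<Rightarrow> bool" where
  "lex_less f g \<longleftrightarrow> (\<exists>i. f i < g i \<and> (\<forall>j<i. f j = g j))"

lemma lexI: "f i < g i \<Longrightarrow> (\<And>j. j < i \<Longrightarrow> f j = g j) \<Longrightarrow> lex_less f g"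
  unfolding lex_less_def by blast

lemma first_difference:
  fixes f g :: "'i::wellorder \<Rightarrow> 'v"
  assumes "f \<noteq> g"
  obtains i where "f i \<noteq> g i" "\<And>j. j < i \<Longrightarrow> f j = g j"
proof -
  have "\<exists>i. f i \<noteq> g i" using assms by auto
  then have "f (LEAST i. f i \<noteq> g i) \<noteq> g (LEAST i. f i \<noteq> g i)" by (rule LeastI_ex)
  then show thesis using that not_less_Least[of _ "\<lambda>i. f i \<noteq> g i"] by blast
qed

lemma lex_irrefl [simp]: "\<not> lex_less f f"
  unfolding lex_less_def by simp

lemma lex_trans:
  assumes "lex_less f g" "lex_less g h"
  shows "lex_less f h"
proof -
  obtain i where i: "f i < g i" "\<forall>j<i. f j = g j" using assms unfolding lex_less_def by blast
  obtain k where k: "g k < h k" "\<forall>j<k. g j = h j" using assms unfolding lex_less_def by blast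
  show ?thesis
  proof (cases i k rule: linorder_cases)
    case less
    then show ?thesis using i k by (intro lexI[of _ i]) auto
  next
    case equal
    then show ?thesis using i k by (intro lexI[of _ i]) auto
  next
    case greater
    then show ?thesis using i k by (intro lexI[of _ k]) auto
  qed
qed

lemma lex_total: "f \<noteq> g \<Longrightarrow> lex_less f g \<or> lex_less g f"
proof -
  assume "f \<noteq> g"
  then obtain i where i: "f i \<noteq> g i" "\<And>j. j < i \<Longrightarrow> f j = g j"
    using first_difference[of f g] by blast
  then show ?thesis using lexI[of f i g] lexI[of g i f] by (metis neq_iff)
qed

lemma lex_asym: "lex_less f g \<Longrightarrow> \<not> lex_less g f"
  using lex_trans lex_irrefl by blast

text \<open>The supremum of \<open>S\<close> among all sequences, entry by entry: the next entry is the supremum of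
  the next entries of those members of \<open>S\<close> that agree with what has been found so far. There may be
  no such members, and all later entries are then zero.\<close>

definition lexsup :: "('i::wellorder \<Rightarrow> 'v::wellorder) set \<Rightarrow> 'i \<Rightarrow> 'v" where
  "lexsup S = wfrec {(x, y). x < y} (\<lambda>g i. LEAST u. \<forall>f\<in>S. (\<forall>j<i. f j = g j) \<longrightarrow> f i \<le> u)"

lemma lexsup_rec:
  fixes S :: "('i::wellorder \<Rightarrow> 'v::wellorder) set"
  shows "lexsup S i = (LEAST u. \<forall>f\<in>S. (\<forall>j<i. f j = lexsup S j) \<longrightarrow> f i \<le> u)"
proof -
  have "wf {(x, y::'i). x < y}" by (rule wf)
  then show ?thesis unfolding lexsup_def by (subst wfrec) (auto simp: cut_apply)
qed

lemma lexsup_upper: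
  assumes bd: "\<And>f. f \<in> S \<Longrightarrow> f i \<le> u" 
    and f: "f \<in> S" "\<And>j. j < i \<Longrightarrow> f j = lexsup S j"
  shows "f i \<le> lexsup S i"
proof -
  have "\<forall>f\<in>S. (\<forall>j<i. f j = lexsup S j) \<longrightarrow> f i \<le> lexsup S i"
    unfolding lexsup_rec[of S i] by (rule LeastI[of _ u]) (use bd in blast)
  then show ?thesis using f by blast
qed

lemma lexsup_le:
  assumes "\<And>f. f \<in> S \<Longrightarrow> (\<And>j. j < i \<Longrightarrow> f j = lexsup S j) \<Longrightarrow> f i \<le> u"
  shows "lexsup S i \<le> u"
  by (subst lexsup_rec, rule Least_le) (use assms in blast)

text \<open>Sequences of length \<open>n\<close> with values up to \<open>t\<close>, extended by zero. A sequence with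
  a last entry below \<open>t\<close> is the lower end of a jump of the lexicographic order, its upper end being
  obtained by raising that entry and continuing with zeros. The last clause collapses the
  jumps by dropping their lower ends.\<close>

definition seqs :: "'v::wellorder \<Rightarrow> 'i::wellorder \<Rightarrow> ('i \<Rightarrow> 'v) set" where
  "seqs t n = {f. (\<forall>i. f i \<le> t) \<and> (\<forall>i\<ge>n. f i = zero_elt) \<and>
                  (\<forall>i<n. f i < t \<longrightarrow> (\<exists>j. i < j \<and> j < n \<and> f j < t))}"

definition seq_lt :: "'v::wellorder \<Rightarrow> 'i::wellorder \<Rightarrow> ('i \<Rightarrow> 'v) \<Rightarrow> ('i \<Rightarrow> 'v) \<Rightarrow> bool" where
  "seq_lt t n f g \<longleftrightarrow> f \<in> seqs t n \<and> g \<in> seqs t n \<and> lex_less f g"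

definition seq_top :: "'v::wellorder \<Rightarrow> 'i::wellorder \<Rightarrow> 'i \<Rightarrow> 'v" where
  "seq_top t n i = (if i < n then t else zero_elt)"

text \<open>If \<open>f j < t\<close> then this sequence lies above \<open>f\<close>, and the nearer the larger \<open>j\<close> is.\<close>

definition bump :: "('i::wellorder \<Rightarrow> 'v::wellorder) \<Rightarrow> 'i \<Rightarrow> 'i \<Rightarrow> 'v" where
  "bump f j m = (if m < j then f m else if m = j then succ_elt (f j) else zero_elt)"

locale seq_space =
  fixes t :: "'v::wellorder" and n :: "'i::wellorder"
  assumes t_pos: "zero_elt < t" and n_pos: "zero_elt < n" and n_limit: "i < n \<Longrightarrow> \<exists>j<n. i < j"
begin

lemma seqs_le: "f \<in> seqs t n \<Longrightarrow> f i \<le> t"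
  unfolding seqs_def by blast

lemma seqs_zero: "f \<in> seqs t n \<Longrightarrow> n \<le> i \<Longrightarrow> f i = zero_elt"
  unfolding seqs_def by blast

lemma seqs_later: "f \<in> seqs t n \<Longrightarrow> i < n \<Longrightarrow> f i < t \<Longrightarrow> \<exists>j. i < j \<and> j < n \<and> f j < t"
  unfolding seqs_def by blast

lemma in_seqs_if_eventually_zero:
  assumes le: "\<And>i. f i \<le> t" and j: "j < n" and zero: "\<And>i. j < i \<Longrightarrow> f i = zero_elt"
  shows "f \<in> seqs t n"
  unfolding seqs_def
proof (intro CollectI conjI allI impI)
  show "f i \<le> t" for i by (rule le)
  show "f i = zero_elt" if "n \<le> i" for i using zero that j by simp
  show "\<exists>k. i < k \<and> k < n \<and> f k < t" if "i < n" for i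
  proof -
    have "max i j < n" using that j by simp
    then obtain k where "k < n" "max i j < k" using n_limit by blast
    then show ?thesis using zero[of k] t_pos by auto
  qed
qed

lemma bump_in: "f \<in> seqs t n \<Longrightarrow> j < n \<Longrightarrow> f j < t \<Longrightarrow> bump f j \<in> seqs t n"
  by (rule in_seqs_if_eventually_zero[of _ j]) (auto simp: bump_def seqs_le succ_elt_le)

lemma less_bump: "f j < t \<Longrightarrow> lex_less f (bump f j)"
  by (rule lexI[of _ j]) (auto simp: bump_def less_succ_elt)

text \<open>As no entry of \<open>f\<close> below \<open>t\<close> is the last one, there is such an entry after the place
  where \<open>f\<close> and \<open>g\<close> first differ; from there on \<open>f\<close> may be changed arbitrarily without reaching
  \<open>g\<close>.\<close>

lemma seq_lt_room:
  assumes "seq_lt t n f g"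
  obtains j where "j < n" "f j < t" "\<And>h. (\<And>m. m < j \<Longrightarrow> h m = f m) \<Longrightarrow> lex_less h g"
proof -
  have fg: "f \<in> seqs t n" "g \<in> seqs t n" and "lex_less f g" using assms unfolding seq_lt_def by auto
  then obtain i where i: "f i < g i" "\<And>j. j < i \<Longrightarrow> f j = g j" unfolding lex_less_def by blast
  have "i < n" using i(1) seqs_zero[OF fg(2), of i] by (metis not_less not_less_zero_elt)
  moreover have "f i < t" using i(1) seqs_le[OF fg(2), of i] by simp
  ultimately obtain j where j: "i < j" "j < n" "f j < t" using seqs_later fg by blast
  have "lex_less h g" if "\<And>m. m < j \<Longrightarrow> h m = f m" for h
    by (rule lexI[of _ i]) (use i that j in auto)
  then show thesis using that j by blast
qed

lemma lin_ord_seqs: "lin_ord (seqs t n) (seq_lt t n)"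
proof
  show "seq_lt t n f h" if "seq_lt t n f g" "seq_lt t n g h" for f g h
    using that lex_trans unfolding seq_lt_def by blast
  show "seq_lt t n f g \<or> f = g \<or> seq_lt t n g f" if "f \<in> seqs t n" "g \<in> seqs t n" for f g
    using that lex_total[of f g] unfolding seq_lt_def by blast
qed (auto simp: seq_lt_def)

lemma seq_lt_complete:
  assumes S: "S \<subseteq> seqs t n"
  shows "\<exists>s\<in>seqs t n. (\<forall>x\<in>S. \<not> seq_lt t n s x) \<and> (\<forall>v. seq_lt t n v s \<longrightarrow> (\<exists>x\<in>S. seq_lt t n v x))"
proof -
  define g where "g = lexsup S"
  have g_le: "g i \<le> t" for i
    unfolding g_def by (rule lexsup_le) (use S seqs_le in blast)
  have g_zero: "g i = zero_elt" if "n \<le> i" for i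
  proof -
    have "g i \<le> zero_elt" unfolding g_def by (rule lexsup_le) (use S seqs_zero[OF _ that] in fastforce)
    then show ?thesis using antisym zero_elt_le by blast
  qed
  have upper: "f = g \<or> lex_less f g" if "f \<in> S" for f
  proof (cases "f = g")
    case False
    then obtain i where i: "f i \<noteq> g i" "\<And>j. j < i \<Longrightarrow> f j = g j" using first_difference[of _ g] by blast
    have "f i \<le> g i"
      unfolding g_def by (rule lexsup_upper[of S i t]) (use S seqs_le that i g_def in auto)
    then show ?thesis using i lexI[of f i g] by auto
  qed simp
  have least: "\<exists>f\<in>S. lex_less h f" if hg: "lex_less h g" for h
  proof -
    obtain i where i: "h i < g i" "\<And>j. j < i \<Longrightarrow> h j = g j" using hg unfolding lex_less_def by blast
    have "\<not> (\<forall>f\<in>S. (\<forall>j<i. f j = g j) \<longrightarrow> f i \<le> h i)"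
    proof
      assume "\<forall>f\<in>S. (\<forall>j<i. f j = g j) \<longrightarrow> f i \<le> h i"
      then have "g i \<le> h i" unfolding g_def by (intro lexsup_le) blast
      then show False using i by simp
    qed
    then obtain f where f: "f \<in> S" "\<forall>j<i. f j = g j" "h i < f i" by (auto simp: not_le)
    then show ?thesis using i by (intro bexI[of _ f] lexI[of _ i]) auto
  qed
  show ?thesis
  proof (cases "g \<in> seqs t n")
    case True
    have "\<not> seq_lt t n g f" if "f \<in> S" for f
      using upper[OF that] lex_asym unfolding seq_lt_def by auto
    moreover have "\<exists>x\<in>S. seq_lt t n v x" if "seq_lt t n v g" for v
      using least[of v] that S unfolding seq_lt_def by blast
    ultimately show ?thesis using True by blast
  next
    case False
    \<comment> \<open>The lexicographic supremum is then the lower end of a jump among all sequences; the upper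
      end of that jump takes over.\<close>
    then obtain i where i: "i < n" "g i < t" "\<And>j. i < j \<Longrightarrow> j < n \<Longrightarrow> \<not> g j < t"
      using g_le g_zero unfolding seqs_def by blast
    have gt: "g j = t" if "i < j" "j < n" for j using i(3)[OF that] g_le[of j] by simp
    have b_in: "bump g i \<in> seqs t n"
      by (rule in_seqs_if_eventually_zero[OF _ i(1)]) (auto simp: bump_def g_le succ_elt_le[OF i(2)])
    have gb: "lex_less g (bump g i)" using less_bump i by blast
    have "\<not> seq_lt t n (bump g i) f" if "f \<in> S" for f
      using upper[OF that] gb lex_trans lex_asym unfolding seq_lt_def by blast
    moreover have "\<exists>x\<in>S. seq_lt t n v x" if v: "seq_lt t n v (bump g i)" for v
    proof -
      have v_in: "v \<in> seqs t n" and vb: "lex_less v (bump g i)" using v unfolding seq_lt_def by auto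
      then obtain m where m: "v m < bump g i m" "\<And>j. j < m \<Longrightarrow> v j = bump g i j"
        unfolding lex_less_def by blast
      have mi: "m \<le> i" using m(1) by (auto simp: bump_def split: if_splits)
      have "lex_less v g"
      proof (cases "v m < g m")
        case True
        then show ?thesis using m mi by (intro lexI[of _ m]) (auto simp: bump_def)
      next
        case False
        then have eq: "m = i" "v i = g i"
          using m(1) mi less_succ_eltD[of "v i" "g i"] by (auto simp: bump_def split: if_splits)
        have "v \<noteq> g" using v_in \<open>g \<notin> seqs t n\<close> by blast
        then obtain k where k: "v k \<noteq> g k" "\<And>j. j < k \<Longrightarrow> v j = g j" using first_difference[of _ g] by blast
        have "\<not> k < i" using k(1) m(2)[of k] eq by (auto simp: bump_def)
        then have ik: "i < k" using k(1) eq by (metis linorder_neqE)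
        have "k < n" using k(1) seqs_zero[OF v_in] g_zero by (metis not_less)
        then have "v k < g k" using gt[OF ik] seqs_le[OF v_in, of k] k(1) by simp
        then show ?thesis using k lexI by blast
      qed
      then show ?thesis using least[of v] S v_in unfolding seq_lt_def by blast
    qed
    ultimately show ?thesis using b_in by blast
  qed
qed

lemma seq_top_in: "seq_top t n \<in> seqs t n"
  unfolding seqs_def seq_top_def by auto

lemma zero_in: "(\<lambda>_. zero_elt) \<in> seqs t n"
  by (rule in_seqs_if_eventually_zero[OF _ n_pos]) (auto)

lemma seq_lt_top_iff: "seq_lt t n f (seq_top t n) \<longleftrightarrow> f \<in> seqs t n \<and> f \<noteq> seq_top t n"
proof -
  have "\<not> lex_less (seq_top t n) f" if "f \<in> seqs t n" for f
    using seqs_le[OF that] seqs_zero[OF that] unfolding lex_less_def seq_top_def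
    by (metis not_le not_less_zero_elt)
  then show ?thesis using seq_top_in lex_total[of f "seq_top t n"] unfolding seq_lt_def by auto
qed

lemma order_continuum_seqs:
  "order_continuum (seqs t n) (seq_lt t n) (\<lambda>_. zero_elt) (seq_top t n)"
proof -
  interpret lin_ord "seqs t n" "seq_lt t n" by (rule lin_ord_seqs)
  show ?thesis
  proof
    show "\<exists>h. seq_lt t n f h \<and> seq_lt t n h g" if fg: "seq_lt t n f g" for f g
    proof -
      obtain j where j: "j < n" "f j < t" "\<And>h. (\<And>m. m < j \<Longrightarrow> h m = f m) \<Longrightarrow> lex_less h g"
        using seq_lt_room[OF fg] by blast
      have "lex_less (bump f j) g" by (rule j(3)) (simp add: bump_def)
      then show ?thesis
        using fg bump_in[of f j] less_bump[of f j] j unfolding seq_lt_def by blast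
    qed
    show "\<not> seq_lt t n f (\<lambda>_. zero_elt)" for f unfolding seq_lt_def lex_less_def by simp
    show "\<not> seq_lt t n (seq_top t n) f" for f
      using seq_lt_top_iff[of f] lt_asym lt_irrefl lt_in2 by blast
    have "(\<lambda>_. zero_elt) \<noteq> seq_top t n"
      using n_pos t_pos fun_cong[of "\<lambda>_. zero_elt" "seq_top t n" zero_elt] by (auto simp: seq_top_def)
    then show "seq_lt t n (\<lambda>_. zero_elt) (seq_top t n)" unfolding seq_lt_top_iff using zero_in by blast
  qed (use seq_lt_complete zero_in seq_top_in in auto)
qed

text \<open>Such a sequence is the limit of the sequences in which the entry \<open>w1\<close> is replaced by a smaller
  one, and countably many smaller entries do not suffice to approach it.\<close>

lemma ucof_if_last_entry_uncountable:
  fixes w1 :: 'v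
  assumes w1: "\<And>C. countable C \<Longrightarrow> C \<subseteq> {..<w1} \<Longrightarrow> \<exists>b<w1. \<forall>c\<in>C. c < b" "w1 \<le> t" "zero_elt < w1"
    and h: "h \<in> seqs t n" "h j = w1" "j < n" "\<And>m. j < m \<Longrightarrow> h m = zero_elt"
  shows "ucof (seq_lt t n) h"
  unfolding ucof_def
proof (intro allI impI, elim conjE)
  fix C assume C: "countable C" "\<forall>c\<in>C. seq_lt t n c h"
  let ?B = "(\<lambda>c. c j) ` {c\<in>C. c j < w1}"
  have "countable ?B" "?B \<subseteq> {..<w1}" using C by auto
  then obtain b where b: "b < w1" "\<And>c. c \<in> C \<Longrightarrow> c j < w1 \<Longrightarrow> c j < b"
    using w1(1)[of ?B] by auto
  let ?y = "h(j := b)"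
  have "b \<le> t" using b(1) w1(2) by simp
  then have y_in: "?y \<in> seqs t n"
    by (intro in_seqs_if_eventually_zero[OF _ h(3)]) (use h seqs_le in auto)
  have "lex_less ?y h" by (rule lexI[of _ j]) (use b h in auto)
  moreover have "lex_less c ?y" if c: "c \<in> C" for c
  proof -
    obtain m where m: "c m < h m" "\<And>i. i < m \<Longrightarrow> c i = h i"
      using C(2) c unfolding seq_lt_def lex_less_def by blast
    have "\<not> j < m" using m(1) h(4) by auto
    then consider "m < j" | "m = j" by fastforce
    then show ?thesis
    proof cases
      case 1
      then show ?thesis using m by (intro lexI[of _ m]) auto
    next
      case 2
      then show ?thesis using m h(2) b(2)[OF c] by (intro lexI[of _ m]) auto
    qed
  qed
  moreover have "c \<in> seqs t n" if "c \<in> C" for c using C(2) that unfolding seq_lt_def by blast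
  ultimately have "seq_lt t n ?y h \<and> (\<forall>c\<in>C. seq_lt t n c ?y)"
    unfolding seq_lt_def using y_in h(1) by simp
  then show "\<exists>y. seq_lt t n y h \<and> (\<forall>c\<in>C. seq_lt t n c y)"
    by (rule exI[of "\<lambda>y. seq_lt t n y h \<and> (\<forall>c\<in>C. seq_lt t n c y)" ?y])
qed

lemma ucof_dense_seqs:
  fixes w1 :: 'v
  assumes w1: "\<And>C. countable C \<Longrightarrow> C \<subseteq> {..<w1} \<Longrightarrow> \<exists>b<w1. \<forall>c\<in>C. c < b" "w1 \<le> t" "zero_elt < w1"
    and fg: "seq_lt t n f g"
  shows "\<exists>h. seq_lt t n f h \<and> seq_lt t n h g \<and> ucof (seq_lt t n) h"
proof -
  obtain j where j: "j < n" "f j < t" "\<And>h. (\<And>m. m < j \<Longrightarrow> h m = f m) \<Longrightarrow> lex_less h g"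
    using seq_lt_room[OF fg] by blast
  obtain k where k: "k < n" "j < k" using n_limit j by blast
  let ?h = "(bump f j)(k := w1)"
  have f: "f \<in> seqs t n" "g \<in> seqs t n" using fg unfolding seq_lt_def by auto
  have "bump f j i \<le> t" for i using seqs_le[OF bump_in[OF f(1) j(1,2)]] .
  then have h_in: "?h \<in> seqs t n"
    by (intro in_seqs_if_eventually_zero[OF _ k(1)]) (use k w1(2) in \<open>auto simp: bump_def\<close>)
  have "lex_less f ?h" by (rule lexI[of _ j]) (use k(2) less_succ_elt[OF j(2)] in \<open>auto simp: bump_def\<close>)
  moreover have "lex_less ?h g" by (rule j(3)) (use k(2) in \<open>auto simp: bump_def\<close>)
  moreover have "ucof (seq_lt t n) ?h"
    by (rule ucof_if_last_entry_uncountable[OF w1 h_in _ k(1)]) (use k in \<open>auto simp: bump_def\<close>)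
  ultimately show ?thesis using f h_in unfolding seq_lt_def by blast
qed

text \<open>The countably many sequences \<open>bump f m\<close> come arbitrarily close to \<open>f\<close> from above.\<close>

lemma not_ucof_rev_if_countable:
  assumes "countable {..<n}"
  shows "\<not> ucof (conversep (seq_lt t n)) f"
proof
  assume u: "ucof (conversep (seq_lt t n)) f"
  interpret lin_ord "seqs t n" "seq_lt t n" by (rule lin_ord_seqs)
  obtain y where "seq_lt t n f y" using u[unfolded ucof_def, rule_format, of "{}"] by auto
  then have f: "f \<in> seqs t n" by (rule lt_in1)
  let ?C = "bump f ` {m. m < n \<and> f m < t}"
  have "countable {m. m < n \<and> f m < t}" by (rule countable_subset[OF _ assms]) auto
  moreover have "\<forall>c\<in>?C. conversep (seq_lt t n) c f"
    using bump_in[OF f] less_bump f unfolding seq_lt_def by auto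
  ultimately obtain y where y: "seq_lt t n f y" "\<And>m. m < n \<Longrightarrow> f m < t \<Longrightarrow> seq_lt t n y (bump f m)"
    using u[unfolded ucof_def, rule_format, of ?C] by auto
  obtain j where j: "j < n" "f j < t" "\<And>h. (\<And>m. m < j \<Longrightarrow> h m = f m) \<Longrightarrow> lex_less h y"
    using seq_lt_room[OF y(1)] by blast
  have "lex_less (bump f j) y" by (rule j(3)) (simp add: bump_def)
  then show False using y(2)[OF j(1,2)] lex_asym unfolding seq_lt_def by blast
qed

text \<open>The top is the limit of the sequences that are \<open>t\<close> up to some place and zero afterwards.\<close>

lemma not_ucof_top_if_countable:
  assumes "countable {..<n}"
  shows "\<not> ucof (seq_lt t n) (seq_top t n)"
proof
  assume u: "ucof (seq_lt t n) (seq_top t n)"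
  define e where "e m i = (if i < m then t else zero_elt)" for m i :: 'i
  have e_in: "e m \<in> seqs t n" if "m < n" for m
    by (rule in_seqs_if_eventually_zero[OF _ that]) (auto simp: e_def)
  have "seq_lt t n (e m) (seq_top t n)" if "m < n" for m
  proof -
    have "e m m \<noteq> seq_top t n m" using t_pos that by (auto simp: e_def seq_top_def)
    then have "e m \<noteq> seq_top t n" by auto
    then show ?thesis unfolding seq_lt_top_iff using e_in[OF that] by blast
  qed
  then have "\<forall>c\<in>e ` {..<n}. seq_lt t n c (seq_top t n)" by blast
  moreover have "countable (e ` {..<n})" using assms by blast
  ultimately obtain y where y: "seq_lt t n y (seq_top t n)" "\<forall>c\<in>e ` {..<n}. seq_lt t n c y"
    using u unfolding ucof_def by blast
  obtain i where i: "y i < seq_top t n i" "\<And>j. j < i \<Longrightarrow> y j = seq_top t n j"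
    using y(1) unfolding seq_lt_def lex_less_def by blast
  have "i < n" using i(1) by (auto simp: seq_top_def split: if_splits)
  then obtain m where m: "m < n" "i < m" using n_limit by blast
  have "lex_less y (e m)"
    by (rule lexI[of _ i]) (use i m \<open>i < n\<close> in \<open>auto simp: e_def seq_top_def\<close>)
  then show False using y(2) m lex_asym unfolding seq_lt_def by blast
qed

definition fin_seqs :: "('i \<Rightarrow> 'v) set" where
  "fin_seqs = {f \<in> seqs t n. \<exists>j<n. \<forall>m>j. f m = zero_elt}"

lemma fin_seqs_dense:
  assumes fg: "seq_lt t n f g"
  shows "\<exists>h\<in>fin_seqs. seq_lt t n f h \<and> seq_lt t n h g"
proof -
  obtain j where j: "j < n" "f j < t" "\<And>h. (\<And>m. m < j \<Longrightarrow> h m = f m) \<Longrightarrow> lex_less h g"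
    using seq_lt_room[OF fg] by blast
  have "lex_less (bump f j) g" by (rule j(3)) (simp add: bump_def)
  moreover have "bump f j \<in> fin_seqs"
    using fg bump_in[of f j] j unfolding fin_seqs_def seq_lt_def by (auto simp: bump_def)
  ultimately show ?thesis
    using fg less_bump[of f j] j unfolding seq_lt_def fin_seqs_def by blast
qed

lemma card_fin_seqs:
  assumes \<kappa>: "Cinfinite \<kappa>" and n: "|{..<n}| \<le>o \<kappa>"
    and pow: "\<And>j. j < n \<Longrightarrow> |Func {..j} {..t}| \<le>o \<kappa>"
  shows "|fin_seqs| \<le>o \<kappa>"
proof -
  have inf: "infinite (Field \<kappa>)" and co: "Card_order \<kappa>" using \<kappa> by (auto simp: cinfinite_def)
  let ?D = "\<lambda>j. {f \<in> seqs t n. \<forall>m>j. f m = zero_elt}"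
  have "|?D j| \<le>o \<kappa>" if "j < n" for j
  proof -
    have "|?D j| \<le>o |Func {..j} {..t}|"
    proof (rule card_of_ordLeqI[of "\<lambda>f m. if m \<le> j then f m else undefined"])
      show "inj_on (\<lambda>f m. if m \<le> j then f m else undefined) (?D j)"
      proof (rule inj_onI, rule ext)
        fix f g m assume fg: "f \<in> ?D j" "g \<in> ?D j"
          "(\<lambda>m. if m \<le> j then f m else undefined) = (\<lambda>m. if m \<le> j then g m else undefined)"
        then show "f m = g m" using fun_cong[OF fg(3), of m] by (cases "m \<le> j") (auto simp: not_le)
      qed
    qed (auto simp: Func_def seqs_le)
    then show ?thesis using pow[OF that] ordLeq_transitive by blast
  qed
  then have "|\<Union>j\<in>{..<n}. ?D j| \<le>o \<kappa>"
    by (intro card_of_UNION_ordLeq_infinite_Field[OF inf co n]) auto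
  moreover have "fin_seqs \<subseteq> (\<Union>j\<in>{..<n}. ?D j)" unfolding fin_seqs_def by auto
  ultimately show ?thesis using card_of_mono1 ordLeq_transitive by blast
qed

lemma card_seqs_le: "|seqs t n| \<le>o |Func {..<n} {..t}|"
proof (rule card_of_ordLeqI[of "\<lambda>f m. if m < n then f m else undefined"])
  show "inj_on (\<lambda>f m. if m < n then f m else undefined) (seqs t n)"
  proof (rule inj_onI, rule ext)
    fix f g m assume fg: "f \<in> seqs t n" "g \<in> seqs t n"
      "(\<lambda>m. if m < n then f m else undefined) = (\<lambda>m. if m < n then g m else undefined)"
    then show "f m = g m" using fun_cong[OF fg(3), of m] seqs_zero[of f m] seqs_zero[of g m] by (cases "m < n") (auto simp: not_less)
  qed
qed (auto simp: Func_def seqs_le)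

lemma card_seqs_ge: "|Func {..<n} {..<t}| \<le>o |seqs t n|"
proof (rule card_of_ordLeqI[of "\<lambda>f m. if m < n then f m else zero_elt"])
  show "inj_on (\<lambda>f m. if m < n then f m else zero_elt) (Func {..<n} {..<t})"
  proof (rule inj_onI, rule ext)
    fix f g m assume fg: "f \<in> Func {..<n} {..<t}" "g \<in> Func {..<n} {..<t}"
      "(\<lambda>m. if m < n then f m else zero_elt) = (\<lambda>m. if m < n then g m else zero_elt)"
    then show "f m = g m" using fun_cong[OF fg(3), of m] by (cases "m < n") (auto simp: Func_def)
  qed
  show "(\<lambda>m. if m < n then f m else zero_elt) \<in> seqs t n" if "f \<in> Func {..<n} {..<t}" for f
    using that n_limit t_pos unfolding seqs_def Func_def by (auto simp: less_imp_le) blast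
qed

end

section \<open>Sums of continuous orders along a well-order\<close>

definition restr :: "'a set \<Rightarrow> ('a \<Rightarrow> 'a \<Rightarrow> bool) \<Rightarrow> 'a \<Rightarrow> 'a \<Rightarrow> bool" where
  "restr C lt x y \<longleftrightarrow> x \<in> C \<and> y \<in> C \<and> lt x y"

context dense_complete begin

text \<open>A convex part of a dense complete order is again such an order, and no cofinalities change at
  points that are not its ends.\<close>

lemma restr_dense_complete:
  assumes CX: "C \<subseteq> X" and conv: "\<And>a b c. a \<in> C \<Longrightarrow> c \<in> C \<Longrightarrow> a \<sqsubset> b \<Longrightarrow> b \<sqsubset> c \<Longrightarrow> b \<in> C"
  shows "dense_complete C (restr C lt)" and "convex_embedding C (restr C lt) X lt (\<lambda>x. x)"
proof -
  interpret C: lin_ord C "restr C lt"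
  proof
    show "restr C lt x y \<or> x = y \<or> restr C lt y x" if "x \<in> C" "y \<in> C" for x y
      using that CX lt_total[of x y] unfolding restr_def by blast
    show "restr C lt x z" if "restr C lt x y" "restr C lt y z" for x y z
      using that lt_trans unfolding restr_def by blast
    show "x \<in> C" "y \<in> C" if "restr C lt x y" for x y using that unfolding restr_def by blast+
    show "\<not> restr C lt x x" for x unfolding restr_def by simp
  qed
  show "dense_complete C (restr C lt)"
  proof
    show "\<exists>z. restr C lt x z \<and> restr C lt z y" if "restr C lt x y" for x y
      using that lt_dense[of x y] conv[of x y] unfolding restr_def by blast
  next
    fix S u assume S: "S \<subseteq> C" "S \<noteq> {}" "u \<in> C" "\<forall>x\<in>S. \<not> restr C lt u x"
    have "\<exists>s\<in>X. (\<forall>x\<in>S. \<not> s \<sqsubset> x) \<and> (\<forall>v. v \<sqsubset> s \<longrightarrow> (\<exists>x\<in>S. v \<sqsubset> x))"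
      by (rule lt_complete[of S u]) (use S CX in \<open>auto simp: restr_def\<close>)
    then obtain s where s: "s \<in> X" "\<forall>x\<in>S. \<not> s \<sqsubset> x" "\<And>v. v \<sqsubset> s \<Longrightarrow> \<exists>x\<in>S. v \<sqsubset> x" by blast
    obtain x where x: "x \<in> S" using S by blast
    have "\<not> u \<sqsubset> s" using s(3)[of u] S(1,3,4) unfolding restr_def by blast
    then have "s \<in> C"
      using conv[of x u s] lt_total[OF s(1), of x] lt_total[OF s(1), of u] x s(2) S CX by blast
    moreover have "\<exists>x\<in>S. restr C lt v x" if "restr C lt v s" for v
      using s(3)[of v] that S(1) unfolding restr_def by blast
    ultimately show "\<exists>s\<in>C. (\<forall>x\<in>S. \<not> restr C lt s x) \<and> (\<forall>v. restr C lt v s \<longrightarrow> (\<exists>x\<in>S. restr C lt v x))"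
      using s(2) unfolding restr_def by blast
  qed
  show "convex_embedding C (restr C lt) X lt (\<lambda>x. x)"
  proof
    show "x \<in> X" if "x \<in> C" for x using that CX by blast
    show "x \<sqsubset> y" if "restr C lt x y" for x y using that unfolding restr_def by blast
    show "v \<in> (\<lambda>x. x) ` C" if "x \<in> C" "y \<in> C" "x \<sqsubset> v" "v \<sqsubset> y" for x y v
      using conv[OF that] by simp
  qed
qed

end

text \<open>All pieces before the last one have a least but no greatest element, so that the bottom of the
  next piece plugs the gap at their upper end.\<close>

locale ordered_sum =
  fixes K :: "'j::wellorder" and C :: "'j \<Rightarrow> 'c set" and L :: "'j \<Rightarrow> 'c \<Rightarrow> 'c \<Rightarrow> bool"
    and bo :: "'j \<Rightarrow> 'c" and tp :: 'c
  assumes piece: "i \<le> K \<Longrightarrow> dense_complete (C i) (L i)"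
    and bo_in: "i \<le> K \<Longrightarrow> bo i \<in> C i" and bo_least: "i \<le> K \<Longrightarrow> \<not> L i x (bo i)"
    and no_top: "i < K \<Longrightarrow> x \<in> C i \<Longrightarrow> \<exists>y. L i x y"
    and tp_in: "tp \<in> C K" and tp_greatest: "\<not> L K tp x" and bo_tp: "L K (bo K) tp"
begin

definition carrier :: "('j \<times> 'c) set" where
  "carrier = {(i, x). i \<le> K \<and> x \<in> C i}"

definition less :: "'j \<times> 'c \<Rightarrow> 'j \<times> 'c \<Rightarrow> bool" where
  "less p q \<longleftrightarrow> p \<in> carrier \<and> q \<in> carrier \<and>
     (fst p < fst q \<or> fst p = fst q \<and> L (fst p) (snd p) (snd q))"

lemma carrier_iff [simp]: "(i, x) \<in> carrier \<longleftrightarrow> i \<le> K \<and> x \<in> C i"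
  by (simp add: carrier_def)

lemma less_iff: "less (i, x) (j, y) \<longleftrightarrow>
    i \<le> K \<and> j \<le> K \<and> x \<in> C i \<and> y \<in> C j \<and> (i < j \<or> i = j \<and> L i x y)"
  by (auto simp: less_def)

lemma piece_lin_ord: "i \<le> K \<Longrightarrow> lin_ord (C i) (L i)"
  using piece unfolding dense_complete_def by blast

lemma lin_ord_sum: "lin_ord carrier less"
proof
  show "\<not> less p p" for p
    using lin_ord.lt_irrefl[OF piece_lin_ord, of "fst p"] unfolding less_def
    by (cases p) auto
  show "less p r" if "less p q" "less q r" for p q r
  proof -
    obtain i x where p: "p = (i, x)" by (cases p)
    obtain j y where q: "q = (j, y)" by (cases q)
    obtain k z where r: "r = (k, z)" by (cases r)
    have "i \<le> K \<Longrightarrow> L i x y \<Longrightarrow> L i y z \<Longrightarrow> L i x z"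
      by (rule lin_ord.lt_trans[OF piece_lin_ord])
    then show ?thesis using that by (auto simp: less_iff p q r)
  qed
  show "less p q \<or> p = q \<or> less q p" if "p \<in> carrier" "q \<in> carrier" for p q
  proof -
    obtain i x where p: "p = (i, x)" by (cases p)
    obtain j y where q: "q = (j, y)" by (cases q)
    have "i \<le> K \<Longrightarrow> i = j \<Longrightarrow> L i x y \<or> x = y \<or> L i y x"
      using lin_ord.lt_total[OF piece_lin_ord, of i x y] that by (auto simp: p q)
    then show ?thesis using that by (auto simp: less_iff p q)
  qed
  show "p \<in> carrier" "q \<in> carrier" if "less p q" for p q using that unfolding less_def by blast+
qed

text \<open>Every interval starting in a piece contains an interval within that piece; density
  statements about the sum thus reduce to the pieces.\<close>

lemma less_in_piece:
  assumes "less (i, x) q"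
  obtains y where "L i x y" "q = (i, y) \<or> less (i, y) q"
proof -
  obtain j z where q: "q = (j, z)" by (cases q)
  consider "i < j" | "i = j" "L i x z" using assms unfolding q less_iff by blast
  then show thesis
  proof cases
    case 1
    then have "i < K" using assms unfolding q less_iff by (meson less_le_trans)
    then obtain y where y: "L i x y" using no_top[of i x] assms unfolding q less_iff by blast
    then have "y \<in> C i" using lin_ord.lt_in2[OF piece_lin_ord y] \<open>i < K\<close> by simp
    then show thesis using that[OF y] assms 1 unfolding q less_iff by blast
  next
    case 2
    then show thesis using that[of z] q by blast
  qed
qed

lemma piece_embedding: "i \<le> K \<Longrightarrow> convex_embedding (C i) (L i) carrier less (\<lambda>x. (i, x))"
proof -
  assume i: "i \<le> K"
  interpret P: lin_ord "C i" "L i" using i by (rule piece_lin_ord)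
  interpret S: lin_ord carrier less by (rule lin_ord_sum)
  show ?thesis
  proof
    show "(i, x) \<in> carrier" if "x \<in> C i" for x using that i by simp
    show "less (i, x) (i, y)" if "L i x y" for x y
      using that i P.lt_in1 P.lt_in2 by (simp add: less_iff)
    show "v \<in> (\<lambda>x. (i, x)) ` C i" if "less (i, x) v" "less v (i, y)" for x y v
      using that by (cases v) (auto simp: less_iff)
  qed
qed

lemma order_continuum_sum: "order_continuum carrier less (zero_elt, bo zero_elt) (K, tp)"
proof -
  interpret S: lin_ord carrier less by (rule lin_ord_sum)
  show ?thesis
  proof
    fix p q assume pq: "less p q"
    obtain i x where p: "p = (i, x)" by (cases p)
    obtain y where y: "L i x y" "q = (i, y) \<or> less (i, y) q" using less_in_piece pq p by blast
    have i: "i \<le> K" using pq by (cases q) (simp add: p less_iff)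
    interpret P: dense_complete "C i" "L i" using i by (rule piece)
    obtain z where z: "L i x z" "L i z y" using P.lt_dense y by blast
    then have "less p (i, z)" "less (i, z) (i, y)"
      using i P.lt_in1 P.lt_in2 by (auto simp: p less_iff)
    then show "\<exists>r. less p r \<and> less r q" using y(2) S.lt_trans by blast
  next
    fix S u assume S: "S \<subseteq> carrier" "S \<noteq> {}"
    define m where "m = (LEAST m. \<forall>p\<in>S. fst p \<le> m)"
    have bdd: "\<forall>p\<in>S. fst p \<le> K" using S by (auto simp: carrier_def)
    have m: "fst p \<le> m" if "p \<in> S" for p
      using LeastI[of "\<lambda>m. \<forall>p\<in>S. fst p \<le> m", OF bdd] that unfolding m_def by blast
    have mK: "m \<le> K" unfolding m_def by (rule Least_le) (rule bdd)
    have m_least: "\<exists>p\<in>S. i < fst p" if "i < m" for i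
      using not_less_Least[OF that[unfolded m_def]] by (auto simp: not_le)
    interpret P: dense_complete "C m" "L m" using mK by (rule piece)
    let ?T = "{x. (m, x) \<in> S}"
    have TC: "?T \<subseteq> C m" using S by auto
    \<comment> \<open>The bottom of a piece is the supremum of everything before it.\<close>
    have bottom: "\<exists>p\<in>S. less v p" if v: "less v (j, bo j)" "j \<le> K" and j: "\<And>i. i < j \<Longrightarrow> \<exists>p\<in>S. i < fst p" for v j
    proof -
      obtain i x where ix: "v = (i, x)" by (cases v)
      have "i < j" using v bo_least by (auto simp: ix less_iff)
      then obtain p where "p \<in> S" "i < fst p" using j by blast
      then show ?thesis using S(1) v(1) by (intro bexI[of _ p]) (auto simp: less_def ix)
    qed
    show "\<exists>s\<in>carrier. (\<forall>x\<in>S. \<not> less s x) \<and> (\<forall>v. less v s \<longrightarrow> (\<exists>x\<in>S. less v x))"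
    proof (cases "?T = {}")
      case True
      have "fst p < m" if "p \<in> S" for p
        using m[OF that] True that by (cases p) (auto simp: le_less)
      then have "\<forall>x\<in>S. \<not> less (m, bo m) x" by (force simp: less_def)
      then show ?thesis using bottom[OF _ mK m_least] bo_in[OF mK] mK
        by (intro bexI[of _ "(m, bo m)"]) auto
    next
      case False
      show ?thesis
      proof (cases "\<exists>u\<in>C m. \<forall>x\<in>?T. \<not> L m u x")
        case True
        then obtain s where s: "s \<in> C m" "\<And>x. x \<in> ?T \<Longrightarrow> \<not> L m s x"
            "\<And>v. L m v s \<Longrightarrow> \<exists>x\<in>?T. L m v x"
          using P.lt_complete[OF TC False] by blast
        have "\<not> less (m, s) p" if "p \<in> S" for p
          using m[OF that] s(2) that by (cases p) (auto simp: less_iff)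
        moreover have "\<exists>p\<in>S. less v p" if v: "less v (m, s)" for v
        proof -
          obtain i x where ix: "v = (i, x)" by (cases v)
          consider "i < m" | "i = m" "L m x s" using v by (auto simp: ix less_iff)
          then show ?thesis
          proof cases
            case 1
            obtain y where "(m, y) \<in> S" using False by blast
            then show ?thesis using 1 v S(1) by (intro bexI[of _ "(m, y)"]) (auto simp: ix less_iff)
          next
            case 2
            then obtain y where "(m, y) \<in> S" "L m x y" using s(3) by blast
            then show ?thesis using 2 v S(1) by (intro bexI[of _ "(m, y)"]) (auto simp: ix less_iff)
          qed
        qed
        ultimately show ?thesis using s(1) mK by (intro bexI[of _ "(m, s)"]) auto
      next
        case False
        then have "m \<noteq> K" using tp_in tp_greatest by blast
        then have "m < K" using mK by simp
        let ?n = "succ_elt m"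
        have n: "m < ?n" "?n \<le> K" using less_succ_elt succ_elt_le \<open>m < K\<close> by blast+
        have "\<not> less (?n, bo ?n) p" if "p \<in> S" for p
          using m[OF that] n by (cases p) (auto simp: less_iff)
        moreover have "\<exists>p\<in>S. less v p" if v: "less v (?n, bo ?n)" for v
        proof -
          obtain i x where ix: "v = (i, x)" by (cases v)
          have "i < ?n" using v bo_least n by (auto simp: ix less_iff)
          then have "i \<le> m" by (rule less_succ_eltD)
          then consider "i < m" | "i = m" by fastforce
          then show ?thesis
          proof cases
            case 1
            then obtain p where "p \<in> S" "i < fst p" using m_least by blast
            then show ?thesis using S(1) v by (intro bexI[of _ p]) (auto simp: less_def ix)
          next
            case 2
            then obtain y where "(m, y) \<in> S" "L m x y" using False v by (auto simp: ix less_iff)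
            then show ?thesis using 2 v S(1) by (intro bexI[of _ "(m, y)"]) (auto simp: ix less_iff)
          qed
        qed
        ultimately show ?thesis using n bo_in by (intro bexI[of _ "(?n, bo ?n)"]) auto
      qed
    qed
  next
    show "(zero_elt, bo zero_elt) \<in> carrier" "(K, tp) \<in> carrier" using bo_in tp_in by auto
    show "\<not> less p (zero_elt, bo zero_elt)" for p using bo_least by (cases p) (auto simp: less_iff)
    show "\<not> less (K, tp) p" for p using tp_greatest by (cases p) (auto simp: less_iff)
    show "less (zero_elt, bo zero_elt) (K, tp)"
    proof (cases "K = zero_elt")
      case True
      have "less (K, bo K) (K, tp)" using bo_in[of K] tp_in bo_tp by (simp add: less_iff)
      then show ?thesis using True by simp
    next
      case False
      then have "zero_elt < K" by (metis le_neq_trans zero_elt_le)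
      then show ?thesis using bo_in[of zero_elt] tp_in by (simp add: less_iff)
    qed
  qed
qed

end

section \<open>The continuum of a code\<close>

text \<open>The index set of the sum: every ordinal is split into two consecutive indices, for the
  forward and the backward piece.\<close>

datatype 'w doubled = Lo (base: 'w) | Hi (base: 'w)

instantiation doubled :: (wellorder) wellorder
begin

definition less_doubled :: "'a doubled \<Rightarrow> 'a doubled \<Rightarrow> bool" where
  "less_doubled i j \<longleftrightarrow> base i < base j \<or> base i = base j \<and> is_Lo i \<and> \<not> is_Lo j"

definition less_eq_doubled :: "'a doubled \<Rightarrow> 'a doubled \<Rightarrow> bool" where
  "less_eq_doubled i j \<longleftrightarrow> i < j \<or> i = j"

instance
proof
  fix x y z :: "'a doubled"
  show "x < y \<longleftrightarrow> x \<le> y \<and> \<not> y \<le> x" by (cases x; cases y) (auto simp: less_doubled_def less_eq_doubled_def)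
  show "x \<le> x" by (simp add: less_eq_doubled_def)
  show "x \<le> y \<Longrightarrow> y \<le> z \<Longrightarrow> x \<le> z"
    by (cases x; cases y; cases z) (auto simp: less_doubled_def less_eq_doubled_def)
  show "x \<le> y \<Longrightarrow> y \<le> x \<Longrightarrow> x = y"
    by (cases x; cases y) (auto simp: less_doubled_def less_eq_doubled_def)
  show "x \<le> y \<or> y \<le> x" by (cases x; cases y) (auto simp: less_doubled_def less_eq_doubled_def)
next
  fix P :: "'a doubled \<Rightarrow> bool" and i
  assume step: "\<And>x. (\<And>y. y < x \<Longrightarrow> P y) \<Longrightarrow> P x"
  have "P (Lo b) \<and> P (Hi b)" for b
  proof (induction b rule: less_induct)
    case (less b)
    have "P (Lo b)"
      by (rule step) (metis doubled.collapse doubled.disc(1) doubled.sel less.IH less_doubled_def)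
    moreover have "P (Hi b)"
    proof (rule step)
      fix y assume "y < Hi b"
      then have "base y < b \<or> y = Lo b" by (cases y) (auto simp: less_doubled_def)
      then show "P y" using less.IH \<open>P (Lo b)\<close> by (cases y) auto
    qed
    ultimately show ?case ..
  qed
  then show "P i" by (cases i) auto
qed

end

lemma doubled_less_simps [simp]:
  "Lo a < Lo b \<longleftrightarrow> a < b" "Hi a < Hi b \<longleftrightarrow> a < b" "Lo a < Hi b \<longleftrightarrow> a \<le> b" "Hi a < Lo b \<longleftrightarrow> a < b"
  by (auto simp: less_doubled_def)

lemma doubled_le_simps [simp]:
  "Lo a \<le> Lo b \<longleftrightarrow> a \<le> b" "Hi a \<le> Hi b \<longleftrightarrow> a \<le> b" "Lo a \<le> Hi b \<longleftrightarrow> a \<le> b" "Hi a \<le> Lo b \<longleftrightarrow> a < b"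
  by (auto simp: less_eq_doubled_def)

text \<open>\<open>B\<close> is the building block and \<open>Z\<close> the end piece. The points \<open>u True\<close> and \<open>u False\<close> of \<open>B\<close> are
  the places where a segment of \<open>B\<close> may be cut off, with uncountable and with countable cofinality.\<close>

locale code_pieces = B: order_continuum B lb b0 b1 + Z: order_continuum Z lz z0 z1
  for B :: "'c set" and lb b0 b1 and Z :: "'c set" and lz z0 z1 +
  fixes u :: "bool \<Rightarrow> 'c" and k :: "'w::wellorder" and A :: "'w set"
  assumes u_pos: "lb b0 (u e)" and ucof_u: "ucof lb (u e) \<longleftrightarrow> e"
    and B_no_right: "\<not> ucof (conversep lb) x"
    and B_ucof_dense: "lb x y \<Longrightarrow> \<exists>p. lb x p \<and> lb p y \<and> ucof lb p"
    and Z_ucof_dense: "lz x y \<Longrightarrow> \<exists>p. lz x p \<and> lz p y \<and> ucof lz p"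
    and k_pos: "zero_elt < k" and k_limit: "\<beta> < k \<Longrightarrow> \<exists>\<gamma><k. \<beta> < \<gamma>" and A_sub: "A \<subseteq> {..<k}"
begin

text \<open>The forward piece lacks its upper end \<open>u (\<beta> \<in> A)\<close>; its place in the sum is taken by the bottom
  of the backward piece, which thereby inherits its cofinality from below.\<close>

definition forward :: "'w \<Rightarrow> 'c set" where "forward \<beta> = {x \<in> B. lb x (u (\<beta> \<in> A))}"

text \<open>This piece enters the sum in reverse order, so that its greatest element \<open>u (\<beta> = zero_elt)\<close>
  becomes the switch and its cofinality becomes that of the switch from above.\<close>

definition backward :: "'w \<Rightarrow> 'c set" where
  "backward \<beta> = {x. lb b0 x \<and> (x = u (\<beta> = zero_elt) \<or> lb x (u (\<beta> = zero_elt)))}"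

text \<open>The greatest index is \<open>Lo k\<close>; it carries the end piece.\<close>

fun piece_set :: "'w doubled \<Rightarrow> 'c set" where
  "piece_set (Lo \<beta>) = (if \<beta> < k then forward \<beta> else Z)"
| "piece_set (Hi \<beta>) = backward \<beta>"

fun piece_less :: "'w doubled \<Rightarrow> 'c \<Rightarrow> 'c \<Rightarrow> bool" where
  "piece_less (Lo \<beta>) = (if \<beta> < k then restr (forward \<beta>) lb else lz)"
| "piece_less (Hi \<beta>) = conversep (restr (backward \<beta>) lb)"

fun piece_bottom :: "'w doubled \<Rightarrow> 'c" where
  "piece_bottom (Lo \<beta>) = (if \<beta> < k then b0 else z0)"
| "piece_bottom (Hi \<beta>) = u (\<beta> = zero_elt)"

lemma forward_piece:
  shows "dense_complete (forward \<beta>) (restr (forward \<beta>) lb)"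
    and "convex_embedding (forward \<beta>) (restr (forward \<beta>) lb) B lb (\<lambda>x. x)"
proof -
  have 1: "forward \<beta> \<subseteq> B" unfolding forward_def by blast
  have 2: "b \<in> forward \<beta>" if "a \<in> forward \<beta>" "c \<in> forward \<beta>" "lb a b" "lb b c" for a b c
    using that B.lt_trans[of b c] B.lt_in1[of b c] unfolding forward_def by blast
  show "dense_complete (forward \<beta>) (restr (forward \<beta>) lb)"
    by (rule B.restr_dense_complete(1)[OF 1]) (rule 2)
  show "convex_embedding (forward \<beta>) (restr (forward \<beta>) lb) B lb (\<lambda>x. x)"
    by (rule B.restr_dense_complete(2)[OF 1]) (rule 2)
qed

lemma backward_piece:
  shows "dense_complete (backward \<beta>) (restr (backward \<beta>) lb)"
    and "convex_embedding (backward \<beta>) (restr (backward \<beta>) lb) B lb (\<lambda>x. x)"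
proof -
  have 1: "backward \<beta> \<subseteq> B" unfolding backward_def using B.lt_in2 by blast
  have 2: "b \<in> backward \<beta>" if "a \<in> backward \<beta>" "c \<in> backward \<beta>" "lb a b" "lb b c" for a b c
    using that B.lt_trans unfolding backward_def by blast
  show "dense_complete (backward \<beta>) (restr (backward \<beta>) lb)"
    by (rule B.restr_dense_complete(1)[OF 1]) (rule 2)
  show "convex_embedding (backward \<beta>) (restr (backward \<beta>) lb) B lb (\<lambda>x. x)"
    by (rule B.restr_dense_complete(2)[OF 1]) (rule 2)
qed

lemma forward_no_top: "x \<in> forward \<beta> \<Longrightarrow> \<exists>y. restr (forward \<beta>) lb x y"
proof -
  assume x: "x \<in> forward \<beta>"
  then obtain y where "lb x y" "lb y (u (\<beta> \<in> A))" using B.lt_dense unfolding forward_def by blast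
  then show ?thesis using x B.lt_in1[of y] unfolding forward_def restr_def by blast
qed

lemma backward_no_bottom: "x \<in> backward \<beta> \<Longrightarrow> \<exists>y. restr (backward \<beta>) lb y x"
proof -
  assume x: "x \<in> backward \<beta>"
  then obtain y where y: "lb b0 y" "lb y x" using B.lt_dense unfolding backward_def by blast
  then have "lb y (u (\<beta> = zero_elt))" using x B.lt_trans unfolding backward_def by blast
  then show ?thesis using x y unfolding backward_def restr_def by blast
qed

sublocale S: ordered_sum "Lo k" piece_set piece_less piece_bottom z1
proof (rule ordered_sum.intro)
  fix i :: "'w doubled" assume i: "i \<le> Lo k"
  show "dense_complete (piece_set i) (piece_less i)"
    using i forward_piece(1) dense_complete.rev_dense_complete[OF backward_piece(1)] Z.dense_complete_axioms
    by (cases i) auto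
  show "piece_bottom i \<in> piece_set i"
    using i u_pos B.bt_in Z.bt_in by (cases i) (auto simp: forward_def backward_def)
  show "\<not> piece_less i x (piece_bottom i)" for x
    using i B.bt_least Z.bt_least B.lt_asym B.lt_irrefl
    by (cases i) (auto simp: restr_def backward_def)
next
  fix i :: "'w doubled" and x assume "i < Lo k" "x \<in> piece_set i"
  then show "\<exists>y. piece_less i x y" using forward_no_top backward_no_bottom by (cases i) auto
next
  show "z1 \<in> piece_set (Lo k)" "\<not> piece_less (Lo k) z1 x" "piece_less (Lo k) (piece_bottom (Lo k)) z1" for x
    using Z.tp_in Z.tp_greatest Z.bt_tp by auto
qed

interpretation O: order_continuum S.carrier S.less "(zero_elt, piece_bottom zero_elt)" "(Lo k, z1)"
  by (rule S.order_continuum_sum)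

lemma piece_ucof:
  assumes "i \<le> Lo k" "piece_less i a x"
  shows "ucof S.less (i, x) \<longleftrightarrow> ucof (piece_less i) x"
proof -
  interpret E: convex_embedding "piece_set i" "piece_less i" S.carrier S.less "\<lambda>x. (i, x)"
    by (rule S.piece_embedding[OF assms(1)])
  show ?thesis by (rule E.ucof_emb[OF assms(2)])
qed

lemma piece_ucof_rev:
  assumes "i \<le> Lo k" "piece_less i x a"
  shows "ucof (conversep S.less) (i, x) \<longleftrightarrow> ucof (conversep (piece_less i)) x"
proof -
  interpret E: convex_embedding "piece_set i" "piece_less i" S.carrier S.less "\<lambda>x. (i, x)"
    by (rule S.piece_embedding[OF assms(1)])
  show ?thesis by (rule E.ucof_emb_rev[OF assms(2)])
qed

lemma forward_ucof:
  assumes "\<beta> < k" "restr (forward \<beta>) lb a x"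
  shows "ucof S.less (Lo \<beta>, x) \<longleftrightarrow> ucof lb x"
proof -
  have "ucof S.less (Lo \<beta>, x) \<longleftrightarrow> ucof (restr (forward \<beta>) lb) x"
    using piece_ucof[of "Lo \<beta>" a x] assms by simp
  then show ?thesis using convex_embedding.ucof_emb[OF forward_piece(2) assms(2)] by simp
qed

lemma forward_not_ucof_rev:
  assumes "\<beta> < k" "x \<in> forward \<beta>"
  shows "\<not> ucof (conversep S.less) (Lo \<beta>, x)"
proof -
  obtain y where y: "restr (forward \<beta>) lb x y" using forward_no_top assms by blast
  have "ucof (conversep S.less) (Lo \<beta>, x) \<longleftrightarrow> ucof (conversep (restr (forward \<beta>) lb)) x"
    using piece_ucof_rev[of "Lo \<beta>" x y] assms y by simp
  then show ?thesis using convex_embedding.ucof_emb_rev[OF forward_piece(2) y] B_no_right by simp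
qed

lemma backward_ucof_rev:
  assumes "\<beta> < k" "x \<in> backward \<beta>"
  shows "ucof (conversep S.less) (Hi \<beta>, x) \<longleftrightarrow> ucof lb x"
proof -
  obtain y where y: "restr (backward \<beta>) lb y x" using backward_no_bottom assms by blast
  have "ucof (conversep S.less) (Hi \<beta>, x) \<longleftrightarrow> ucof (restr (backward \<beta>) lb) x"
    using piece_ucof_rev[of "Hi \<beta>" x y] assms y by simp
  then show ?thesis using convex_embedding.ucof_emb[OF backward_piece(2) y] by simp
qed

lemma backward_not_ucof:
  assumes "\<beta> < k" "restr (backward \<beta>) lb x a"
  shows "\<not> ucof S.less (Hi \<beta>, x)"
proof -
  have "ucof S.less (Hi \<beta>, x) \<longleftrightarrow> ucof (conversep (restr (backward \<beta>) lb)) x"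
    using piece_ucof[of "Hi \<beta>" a x] assms by simp
  then show ?thesis using convex_embedding.ucof_emb_rev[OF backward_piece(2) assms(2)] B_no_right by simp
qed

definition w :: "'w \<Rightarrow> 'w doubled \<times> 'c" where "w \<beta> = (Hi \<beta>, u (\<beta> = zero_elt))"

lemma b0_forward: "b0 \<in> forward \<beta>"
  unfolding forward_def using u_pos B.bt_in by blast

lemma u_backward: "u (\<beta> = zero_elt) \<in> backward \<beta>"
  unfolding backward_def using u_pos by blast

lemma w_in: "\<beta> < k \<Longrightarrow> w \<beta> \<in> S.carrier"
  unfolding w_def using u_backward by simp

text \<open>Below the switch the sum looks like \<open>B\<close> below \<open>u (\<beta> \<in> A)\<close>.\<close>

lemma ucof_w: "\<beta> < k \<Longrightarrow> ucof S.less (w \<beta>) \<longleftrightarrow> \<beta> \<in> A"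
proof -
  assume \<beta>: "\<beta> < k"
  have "ucof lb (u (\<beta> \<in> A)) \<longleftrightarrow> ucof S.less (w \<beta>)"
  proof (rule ucof_transfer[OF B.lin_ord_axioms O.lin_ord_axioms u_pos, of _ "\<lambda>y. (Lo \<beta>, y)"])
    fix y z assume yz: "lb y z" "lb z (u (\<beta> \<in> A))"
    then show "S.less (Lo \<beta>, y) (Lo \<beta>, z)"
      using \<beta> B.lt_trans[OF yz] B.lt_in1 by (auto simp: S.less_iff restr_def forward_def)
  next
    fix y assume "lb y (u (\<beta> \<in> A))"
    then show "S.less (Lo \<beta>, y) (w \<beta>)"
      using \<beta> u_backward B.lt_in1 by (auto simp: S.less_iff w_def forward_def)
  next
    fix v assume v: "S.less (Lo \<beta>, b0) v" "S.less v (w \<beta>)"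
    obtain i y where iy: "v = (i, y)" by (cases v)
    have "Lo \<beta> \<le> i" "i \<le> Hi \<beta>" using v by (auto simp: iy w_def S.less_iff)
    then have "i = Lo \<beta> \<or> i = Hi \<beta>" by (cases i) auto
    moreover have "i \<noteq> Hi \<beta>"
      using v(2) B.lt_asym B.lt_irrefl by (auto simp: iy w_def S.less_iff restr_def backward_def)
    ultimately have "i = Lo \<beta>" by blast
    then show "\<exists>y. lb b0 y \<and> lb y (u (\<beta> \<in> A)) \<and> (Lo \<beta>, y) = v"
      using v(1) \<beta> by (auto simp: iy S.less_iff restr_def forward_def)
  qed
  then show ?thesis using ucof_u by simp
qed

lemma ucof_rev_w: "\<beta> < k \<Longrightarrow> ucof (conversep S.less) (w \<beta>) \<longleftrightarrow> \<beta> = zero_elt"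
  unfolding w_def using backward_ucof_rev[OF _ u_backward] ucof_u by simp

lemma w_mono: "\<beta> < \<gamma> \<Longrightarrow> \<gamma> < k \<Longrightarrow> S.less (w \<beta>) (w \<gamma>)"
  using u_backward by (auto simp: w_def S.less_iff)

lemma switch_w: "\<beta> < k \<Longrightarrow> switch S.less (w \<beta>)"
proof -
  assume \<beta>: "\<beta> < k"
  have "S.less (Lo \<beta>, b0) (w \<beta>)"
    using \<beta> b0_forward u_backward by (auto simp: w_def S.less_iff)
  moreover have "\<not> ucof (conversep S.less) v" if v: "S.less (Lo \<beta>, b0) v" "S.less v (w \<beta>)" for v
  proof -
    obtain i y where iy: "v = (i, y)" by (cases v)
    have "Lo \<beta> \<le> i" "i \<le> Hi \<beta>" using v by (auto simp: iy w_def S.less_iff)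
    then have "i = Lo \<beta> \<or> i = Hi \<beta>" by (cases i) auto
    moreover have "i \<noteq> Hi \<beta>"
      using v(2) B.lt_asym B.lt_irrefl by (auto simp: iy w_def S.less_iff restr_def backward_def)
    ultimately have "i = Lo \<beta>" by blast
    then show ?thesis using v(1) \<beta> forward_not_ucof_rev by (auto simp: iy S.less_iff)
  qed
  moreover obtain y where y: "restr (backward \<beta>) lb y (u (\<beta> = zero_elt))"
    using backward_no_bottom u_backward by blast
  then have "S.less (w \<beta>) (Hi \<beta>, y)"
    using \<beta> by (auto simp: w_def S.less_iff restr_def)
  moreover have "\<not> ucof S.less v" if v: "S.less (w \<beta>) v" "S.less v (Hi \<beta>, y)" for v
  proof -
    obtain i x where iy: "v = (i, x)" by (cases v)
    have "i = Hi \<beta>" using v by (auto simp: iy w_def S.less_iff)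
    then show ?thesis
      using v(1) \<beta> backward_not_ucof[of \<beta> x] by (auto simp: iy S.less_iff w_def)
  qed
  ultimately show ?thesis unfolding switch_def by blast
qed

lemma ucof_in_forward:
  assumes "\<beta> < k" "restr (forward \<beta>) lb x y"
  shows "\<exists>p. S.less (Lo \<beta>, x) p \<and> S.less p (Lo \<beta>, y) \<and> ucof S.less p"
proof -
  have xy: "x \<in> forward \<beta>" "y \<in> forward \<beta>" "lb x y" using assms unfolding restr_def by auto
  then obtain p where p: "lb x p" "lb p y" "ucof lb p" using B_ucof_dense by blast
  then have "p \<in> forward \<beta>" using xy B.lt_trans[OF p(2)] B.lt_in1 unfolding forward_def by blast
  then have "restr (forward \<beta>) lb x p" "restr (forward \<beta>) lb p y" using p xy unfolding restr_def by auto
  then show ?thesis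
    using assms(1) forward_ucof[OF assms(1), of x p] p xy \<open>p \<in> forward \<beta>\<close>
    by (intro exI[of _ "(Lo \<beta>, p)"]) (simp add: S.less_iff)
qed

lemma ucof_rev_in_backward:
  assumes "\<beta> < k" "restr (backward \<beta>) lb y x"
  shows "\<exists>p. S.less (Hi \<beta>, x) p \<and> S.less p (Hi \<beta>, y) \<and> ucof (conversep S.less) p"
proof -
  have xy: "x \<in> backward \<beta>" "y \<in> backward \<beta>" "lb y x" using assms unfolding restr_def by auto
  then obtain p where p: "lb y p" "lb p x" "ucof lb p" using B_ucof_dense by blast
  have "lb b0 p" using xy p B.lt_trans unfolding backward_def by blast
  moreover have "lb p (u (\<beta> = zero_elt))" using xy p B.lt_trans unfolding backward_def by blast
  ultimately have "p \<in> backward \<beta>" unfolding backward_def by blast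
  then have "restr (backward \<beta>) lb y p" "restr (backward \<beta>) lb p x" using p xy unfolding restr_def by auto
  then show ?thesis
    using assms(1) backward_ucof_rev[OF assms(1), of p] p xy \<open>p \<in> backward \<beta>\<close>
    by (intro exI[of _ "(Hi \<beta>, p)"]) (simp add: S.less_iff)
qed

lemma ucof_in_end:
  assumes "lz x y"
  shows "\<exists>p. S.less (Lo k, x) p \<and> S.less p (Lo k, y) \<and> ucof S.less p"
proof -
  obtain p where p: "lz x p" "lz p y" "ucof lz p" using Z_ucof_dense assms by blast
  have "ucof S.less (Lo k, p)" using piece_ucof[of "Lo k" x p] p by simp
  moreover have "S.less (Lo k, x) (Lo k, p)" "S.less (Lo k, p) (Lo k, y)"
    using p Z.lt_in1 Z.lt_in2 by (auto simp: S.less_iff)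
  ultimately show ?thesis by blast
qed

lemma ucof_or_rev_dense:
  assumes pq: "S.less p q"
  shows "\<exists>r. S.less p r \<and> S.less r q \<and> (ucof S.less r \<or> ucof (conversep S.less) r)"
proof -
  obtain i x where p: "p = (i, x)" by (cases p)
  obtain y where y: "piece_less i x y" "q = (i, y) \<or> S.less (i, y) q" using S.less_in_piece pq p by blast
  have i: "i \<le> Lo k" using pq by (cases q) (simp add: p S.less_iff)
  have "\<exists>r. S.less (i, x) r \<and> S.less r (i, y) \<and> (ucof S.less r \<or> ucof (conversep S.less) r)"
  proof (cases i)
    case (Lo \<beta>)
    show ?thesis
    proof (cases "\<beta> < k")
      case True
      then show ?thesis using ucof_in_forward[OF True, of x y] y(1) Lo by auto
    next
      case False
      then have "\<beta> = k" using i Lo by simp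
      then show ?thesis using ucof_in_end[of x y] y(1) Lo by auto
    qed
  next
    case (Hi \<beta>)
    then show ?thesis using ucof_rev_in_backward[of \<beta> y x] y(1) i by auto
  qed
  then show ?thesis using y(2) O.lt_trans p by blast
qed

text \<open>A point of a forward piece or of the end piece, unless it is the top, has points with uncountable cofinality
  from below immediately to its right. A point of a backward piece other than its bottom has points with
  uncountable cofinality from above immediately to its left.\<close>

lemma switch_only_w:
  assumes sw: "switch S.less p"
  shows "\<exists>\<beta><k. p = w \<beta>"
proof -
  obtain a b where a: "S.less a p" "\<And>y. S.less a y \<Longrightarrow> S.less y p \<Longrightarrow> \<not> ucof (conversep S.less) y"
    and b: "S.less p b" "\<And>y. S.less p y \<Longrightarrow> S.less y b \<Longrightarrow> \<not> ucof S.less y"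
    using sw unfolding switch_def by blast
  obtain i x where p: "p = (i, x)" by (cases p)
  obtain y where y: "piece_less i x y" "b = (i, y) \<or> S.less (i, y) b" using S.less_in_piece b(1) p by blast
  have i: "i \<le> Lo k" using b(1) by (cases b) (simp add: p S.less_iff)
  have no: "\<not> (\<exists>r. S.less (i, x) r \<and> S.less r (i, y) \<and> ucof S.less r)"
    using b(2) y(2) O.lt_trans p by blast
  show ?thesis
  proof (cases i)
    case (Lo \<beta>)
    have "\<not> \<beta> < k" using no ucof_in_forward[of \<beta> x y] y(1) Lo by auto
    then have "\<beta> = k" using i Lo by simp
    then show ?thesis using no ucof_in_end[of x y] y(1) Lo by auto
  next
    case (Hi \<beta>)
    then have \<beta>: "\<beta> < k" using i by simp
    have xb: "x \<in> backward \<beta>" using b(1) by (cases b) (simp add: p S.less_iff Hi)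
    have "x = u (\<beta> = zero_elt)"
    proof (rule ccontr)
      assume ne: "x \<noteq> u (\<beta> = zero_elt)"
      then have xu: "lb x (u (\<beta> = zero_elt))" using xb unfolding backward_def by blast
      obtain j z where jz: "a = (j, z)" by (cases a)
      \<comment> \<open>A point of the piece below \<open>x\<close> in the sum, and not below \<open>a\<close>.\<close>
      obtain c where c: "restr (backward \<beta>) lb x c" "a = (Hi \<beta>, c) \<or> S.less a (Hi \<beta>, c)"
      proof (cases "j = Hi \<beta>")
        case True
        then have "restr (backward \<beta>) lb x z" using a(1) by (simp add: p jz Hi S.less_iff)
        then show ?thesis using that[of z] True jz by blast
      next
        case False
        then have "j < Hi \<beta>" using a(1) by (simp add: p jz Hi S.less_iff)
        then have "S.less a (Hi \<beta>, u (\<beta> = zero_elt))"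
          using a(1) \<beta> u_backward by (simp add: p jz Hi S.less_iff)
        then show ?thesis using that[of "u (\<beta> = zero_elt)"] xu xb u_backward unfolding restr_def by blast
      qed
      obtain r where "S.less (Hi \<beta>, c) r" "S.less r (Hi \<beta>, x)" "ucof (conversep S.less) r"
        using ucof_rev_in_backward[OF \<beta> c(1)] by blast
      then show False using a(2) c(2) O.lt_trans p Hi by blast
    qed
    then show ?thesis using \<beta> Hi p unfolding w_def by blast
  qed
qed

lemma coded_continuum_sum:
  "coded_continuum S.carrier S.less (zero_elt, piece_bottom zero_elt) (Lo k, z1) k A w"
proof
  show "switch S.less p \<longleftrightarrow> (\<exists>\<beta><k. p = w \<beta>)" for p
    using switch_only_w switch_w by blast
  show "ucof (conversep S.less) (w \<beta>) \<longleftrightarrow> (\<forall>\<gamma>. \<beta> \<le> \<gamma>)" if "\<beta> < k" for \<beta>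
    using ucof_rev_w[OF that] antisym[of \<beta> zero_elt] zero_elt_le by metis
qed (use ucof_or_rev_dense w_mono ucof_w A_sub k_limit in blast)+

lemma dense_subset_sum:
  assumes DB: "\<And>x y. lb x y \<Longrightarrow> \<exists>d\<in>DB. lb x d \<and> lb d y"
    and DZ: "\<And>x y. lz x y \<Longrightarrow> \<exists>d\<in>DZ. lz x d \<and> lz d y"
    and pq: "S.less p q"
  shows "\<exists>d\<in>S.carrier \<inter> UNIV \<times> (DB \<union> DZ). S.less p d \<and> S.less d q"
proof -
  obtain i x where p: "p = (i, x)" by (cases p)
  obtain y where y: "piece_less i x y" "q = (i, y) \<or> S.less (i, y) q" using S.less_in_piece pq p by blast
  have i: "i \<le> Lo k" using pq by (cases q) (simp add: p S.less_iff)
  have "\<exists>d\<in>DB \<union> DZ. piece_less i x d \<and> piece_less i d y"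
  proof (cases i)
    case (Lo \<beta>)
    show ?thesis
    proof (cases "\<beta> < k")
      case True
      then have xy: "x \<in> forward \<beta>" "y \<in> forward \<beta>" "lb x y" using y(1) Lo by (auto simp: restr_def)
      then obtain d where d: "d \<in> DB" "lb x d" "lb d y" using DB by blast
      then have "d \<in> forward \<beta>" using xy B.lt_trans[OF d(3)] B.lt_in1 unfolding forward_def by blast
      then show ?thesis using d xy True Lo by (intro bexI[of _ d]) (auto simp: restr_def)
    next
      case False
      then show ?thesis using DZ[of x y] y(1) Lo by auto
    qed
  next
    case (Hi \<beta>)
    then have xy: "x \<in> backward \<beta>" "y \<in> backward \<beta>" "lb y x" using y(1) by (auto simp: restr_def)
    then obtain d where d: "d \<in> DB" "lb y d" "lb d x" using DB by blast
    have "lb b0 d" "lb d (u (\<beta> = zero_elt))" using xy d B.lt_trans unfolding backward_def by blast+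
    then have "d \<in> backward \<beta>" unfolding backward_def by blast
    then show ?thesis using d xy Hi by (intro bexI[of _ d]) (auto simp: restr_def)
  qed
  then obtain d where d: "d \<in> DB \<union> DZ" "piece_less i x d" "piece_less i d y" by blast
  have "d \<in> piece_set i" using lin_ord.lt_in2[OF S.piece_lin_ord[OF i] d(2)] .
  moreover have "x \<in> piece_set i" "y \<in> piece_set i"
    using lin_ord.lt_in1[OF S.piece_lin_ord[OF i] d(2)] lin_ord.lt_in2[OF S.piece_lin_ord[OF i] d(3)] by auto
  ultimately have "S.less p (i, d)" "S.less (i, d) (i, y)" "(i, d) \<in> S.carrier"
    using d i by (auto simp: p S.less_iff)
  then show ?thesis using d(1) y(2) O.lt_trans by (intro bexI[of _ "(i, d)"]) blast+
qed

lemma carrier_subset: "S.carrier \<subseteq> ({..Lo k} \<times> B) \<union> ({Lo k} \<times> Z)"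
proof
  fix p assume p: "p \<in> S.carrier"
  obtain i x where ix: "p = (i, x)" by (cases p)
  have "backward \<beta> \<subseteq> B" "forward \<beta> \<subseteq> B" for \<beta> unfolding backward_def forward_def using B.lt_in2 by blast+
  then show "p \<in> ({..Lo k} \<times> B) \<union> ({Lo k} \<times> Z)"
    using p by (cases i) (auto simp: ix le_less split: if_splits)
qed

lemma end_in_carrier: "{Lo k} \<times> Z \<subseteq> S.carrier"
  by auto

end

section \<open>Initial ordinals\<close>

text \<open>A copy of \<open>'a\<close> that is ordered in the order type of its cardinality.\<close>

typedef 'a wo = "UNIV :: 'a set" morphisms of_wo to_wo
  by simp

instantiation wo :: (type) wellorder
begin

definition less_eq_wo :: "'a wo \<Rightarrow> 'a wo \<Rightarrow> bool" where
  "less_eq_wo x y \<longleftrightarrow> (of_wo x, of_wo y) \<in> |UNIV :: 'a set|"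

definition less_wo :: "'a wo \<Rightarrow> 'a wo \<Rightarrow> bool" where
  "less_wo x y \<longleftrightarrow> x \<le> y \<and> x \<noteq> y"

instance
proof
  have wo: "Well_order |UNIV :: 'a set|" by (rule card_of_Well_order)
  then have lin: "linear_order_on UNIV |UNIV :: 'a set|" and wf: "wf ( |UNIV :: 'a set| - Id)"
    by (auto simp: well_order_on_def Field_card_of)
  fix x y z :: "'a wo"
  show antisym: "x \<le> y \<Longrightarrow> y \<le> x \<Longrightarrow> x = y" for x y :: "'a wo"
    using lin of_wo_inject unfolding less_eq_wo_def linear_order_on_def partial_order_on_def antisym_def
    by blast
  then show "x < y \<longleftrightarrow> x \<le> y \<and> \<not> y \<le> x"
    using lin by (auto simp: less_wo_def less_eq_wo_def linear_order_on_def partial_order_on_def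
      preorder_on_def refl_on_def)
  show "x \<le> x"
    using lin by (auto simp: less_eq_wo_def linear_order_on_def partial_order_on_def
      preorder_on_def refl_on_def)
  show "x \<le> y \<Longrightarrow> y \<le> z \<Longrightarrow> x \<le> z"
    using lin unfolding less_eq_wo_def linear_order_on_def partial_order_on_def preorder_on_def trans_def
    by blast
  show "x \<le> y \<or> y \<le> x"
    using lin \<open>x \<le> x\<close> of_wo_inject[of x y]
    unfolding less_eq_wo_def linear_order_on_def total_on_def by (cases "of_wo x = of_wo y") auto
  fix P :: "'a wo \<Rightarrow> bool"
  assume step: "\<And>x. (\<And>y. y < x \<Longrightarrow> P y) \<Longrightarrow> P x"
  have "P (to_wo a)" for a
  proof (induction a rule: wf_induct_rule[OF wf])
    case (1 a)
    show ?case
    proof (rule step)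
      fix y :: "'a wo" assume "y < to_wo a"
      then have "(of_wo y, a) \<in> |UNIV| - Id"
        by (auto simp: less_wo_def less_eq_wo_def to_wo_inverse of_wo_inverse)
      then show "P y" using 1[of "of_wo y"] by (simp add: of_wo_inverse)
    qed
  qed
  then show "P x" using of_wo_inverse by metis
qed

end

text \<open>Every cardinal below that of \<open>'a\<close> is represented by an element of \<open>'a wo\<close> that is an initial
  ordinal.\<close>

lemma initial_segment_exists:
  fixes p :: "'b rel"
  assumes p: "Card_order p" "p <o |UNIV :: 'a set|"
  obtains x :: "'a wo" where "|{..<x}| =o p" "\<forall>y<x. |{..<y}| <o p"
proof -
  let ?r = "|UNIV :: 'a set|"
  have wo: "Well_order ?r" "Well_order p" using p by (auto simp: card_of_Well_order card_order_on_def)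
  obtain a where a: "p =o Restr ?r (underS ?r a)"
    using p(2) ordLess_iff_ordIso_Restr[OF wo] by blast
  have "wo_rel ?r" using wo by (simp add: wo_rel_def)
  then have "wo_rel.ofilter ?r (underS ?r a)" by (rule wo_rel.underS_ofilter)
  then have F: "Field (Restr ?r (underS ?r a)) = underS ?r a" using Field_Restr_ofilter wo by blast
  have "p =o |Field p|" using p card_of_Field_ordIso ordIso_symmetric by blast
  also have "|Field p| =o |underS ?r a|" using card_of_cong[OF a] unfolding F .
  finally have pa: "p =o |underS ?r a|" .
  have "bij_betw to_wo (underS ?r a) {..<to_wo a}"
  proof (rule bij_betw_imageI)
    show "inj_on to_wo (underS ?r a)" by (auto simp: inj_on_def to_wo_inject)
    show "to_wo ` underS ?r a = {..<to_wo a}"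
    proof (intro equalityI subsetI)
      fix x assume "x \<in> to_wo ` underS ?r a"
      then show "x \<in> {..<to_wo a}"
        by (auto simp: underS_def less_wo_def less_eq_wo_def to_wo_inverse to_wo_inject)
    next
      fix x assume "x \<in> {..<to_wo a}"
      then have "of_wo x \<in> underS ?r a"
        by (auto simp: underS_def less_wo_def less_eq_wo_def to_wo_inverse of_wo_inverse)
      then show "x \<in> to_wo ` underS ?r a" by (metis image_eqI of_wo_inverse)
    qed
  qed
  then have "|underS ?r a| =o |{..<to_wo a}|" using card_of_ordIso by blast
  then have ex: "\<exists>x :: 'a wo. p \<le>o |{..<x}|"
    using pa ordIso_transitive ordIso_iff_ordLeq by blast
  define x :: "'a wo" where "x = (LEAST x. p \<le>o |{..<x}| )"
  have px: "p \<le>o |{..<x}|" unfolding x_def by (rule LeastI_ex) (rule ex)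
  have below: "|{..<y}| <o p" if "y < x" for y
  proof -
    have "\<not> p \<le>o |{..<y}|"
      using not_less_Least[of y "\<lambda>x. p \<le>o |{..<x}|"] that unfolding x_def by blast
    then show ?thesis using not_ordLeq_iff_ordLess[OF card_of_Well_order[of "{..<y}"] wo(2)] by blast
  qed
  have "x \<le> to_wo a" unfolding x_def
    by (rule Least_le) (use pa \<open>|underS ?r a| =o |{..<to_wo a}|\<close> ordIso_transitive ordIso_iff_ordLeq in blast)
  then have "{..<x} \<subseteq> {..<to_wo a}" by auto
  then have "|{..<x}| \<le>o |{..<to_wo a}|" by (rule card_of_mono1)
  also have "|{..<to_wo a}| =o p"
    using pa \<open>|underS ?r a| =o |{..<to_wo a}|\<close> ordIso_transitive ordIso_symmetric by blast
  finally have "|{..<x}| =o p" using px ordIso_iff_ordLeq by blast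
  then show thesis using that below by blast
qed

lemma card_insert_infinite: "infinite A \<Longrightarrow> |insert a A| =o |A|"
proof -
  assume A: "infinite A"
  have "|{a}| \<le>o |A|"
    by (rule ordLess_imp_ordLeq, rule finite_ordLess_infinite)
      (use A in \<open>auto simp: Field_card_of card_of_well_order_on\<close>)
  then have "|{a} \<union> A| \<le>o |A|"
    using card_of_Un_ordLeq_infinite_Field[of "|A|" "{a}" A] A card_of_Card_order[of A]
      ordLeq_refl[OF card_of_Card_order[of A]] by (simp add: Field_card_of)
  then show ?thesis
    using card_of_mono1[OF subset_insertI, of A a] by (simp add: ordIso_iff_ordLeq[of "|insert a A|" "|A|"])
qed

lemma card_atMost_infinite: "infinite {..<x::'a::linorder} \<Longrightarrow> |{..x}| =o |{..<x}|"
proof -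
  assume "infinite {..<x}"
  moreover have "insert x {..<x} = {..x}" by auto
  ultimately show ?thesis using card_insert_infinite[of "{..<x}" x] by simp
qed

text \<open>An infinite initial ordinal is a limit: a last element could be removed without changing the
  cardinality.\<close>

lemma initial_limit:
  fixes x :: "'a::wellorder" and p :: "'b rel"
  assumes x: "|{..<x}| =o p" "\<forall>y<x. |{..<y}| <o p" and p: "Cinfinite p"
  shows "zero_elt < x" and "y < x \<Longrightarrow> \<exists>z<x. y < z" and "infinite {..<x}"
proof -
  have "infinite (Field |{..<x}| )" using Cinfinite_cong[OF ordIso_symmetric[OF x(1)] p]
    by (simp add: cinfinite_def)
  then show inf: "infinite {..<x}" by (simp add: Field_card_of)
  then have "{..<x} \<noteq> {}" by auto
  then obtain y0 where "y0 < x" by auto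
  then show "zero_elt < x" using zero_elt_le le_less_trans by blast
  show "\<exists>z<x. y < z" if y: "y < x"
  proof (rule ccontr)
    assume no: "\<not> (\<exists>z<x. y < z)"
    then have "\<And>z. z < x \<Longrightarrow> z \<le> y" by (metis not_less)
    then have eq: "{..<x} = {..y}" using y by auto
    moreover have "{..y} = insert y {..<y}" by auto
    ultimately have "infinite {..<y}" using inf by simp
    then have "|{..<x}| =o |{..<y}|" using card_atMost_infinite eq by metis
    then have "p =o |{..<y}|" using x(1) ordIso_symmetric ordIso_transitive by blast
    then show False using x(2)[rule_format, OF y] not_ordLess_ordIso ordIso_symmetric by blast
  qed
qed

lemma countable_iff_natLeq: "countable A \<longleftrightarrow> |A| \<le>o natLeq"
proof -
  have "countable A \<longleftrightarrow> |A| \<le>o |UNIV :: nat set|"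
    unfolding countable_def using card_of_ordLeq[of A "UNIV :: nat set"] by auto
  also have "\<dots> \<longleftrightarrow> |A| \<le>o natLeq"
    using card_of_nat ordLeq_ordIso_trans ordIso_symmetric by blast
  finally show ?thesis .
qed

text \<open>If a countable set were cofinal in the first uncountable ordinal, the latter would be a countable
  union of countable initial segments.\<close>

lemma first_uncountable_regular:
  fixes w1 :: "'a::wellorder"
  assumes w1: "|{..<w1}| =o cardSuc natLeq" "\<forall>y<w1. |{..<y}| <o cardSuc natLeq"
    and C: "countable C" "C \<subseteq> {..<w1}"
  shows "\<exists>b<w1. \<forall>c\<in>C. c < b"
proof (rule ccontr)
  assume no: "\<not> (\<exists>b<w1. \<forall>c\<in>C. c < b)"
  have seg: "countable {..c}" if "c < w1" for c
  proof -
    have "countable {..<c}"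
      unfolding countable_iff_natLeq
      using w1(2)[rule_format, OF that] cardSuc_ordLeq_ordLess[OF natLeq_Card_order card_of_Card_order] by blast
    moreover have "{..c} = insert c {..<c}" by auto
    ultimately show ?thesis by simp
  qed
  have "{..<w1} \<subseteq> (\<Union>c\<in>C. {..c})"
  proof
    fix b assume "b \<in> {..<w1}"
    then obtain c where "c \<in> C" "\<not> c < b" using no by auto
    then show "b \<in> (\<Union>c\<in>C. {..c})" by (auto simp: not_less)
  qed
  moreover have "countable (\<Union>c\<in>C. {..c})" using C seg by blast
  ultimately have "countable {..<w1}" using countable_subset by blast
  then have "cardSuc natLeq \<le>o natLeq"
    unfolding countable_iff_natLeq using w1(1) ordIso_symmetric ordIso_ordLeq_trans by blast
  then show False using cardSuc_greater[OF natLeq_Card_order] not_ordLess_ordLeq by blast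
qed

section \<open>Cardinal arithmetic\<close>

lemma card_of_Func: "|Func A B| = |B| ^c |A|"
  by (simp add: cexp_def Field_card_of)

text \<open>Enlarging the base \<open>l\<close> to at most \<open>l ^c natLeq\<close> is absorbed by infinite exponents. This
  allows passing from a countable \<open>l\<close> to an uncountable \<open>m\<close>.\<close>

lemma cexp_absorb:
  fixes l :: "'l rel" and m :: "'m rel" and \<mu> :: "'n rel"
  assumes l: "Card_order l" "l \<le>o m" "m \<le>o l ^c natLeq" and \<mu>: "Cinfinite \<mu>"
  shows "m ^c \<mu> =o l ^c \<mu>"
proof -
  have co: "Card_order \<mu>" using \<mu> by blast
  have "m ^c \<mu> \<le>o (l ^c natLeq) ^c \<mu>" using cexp_mono1[OF l(3) co] .
  also have "(l ^c natLeq) ^c \<mu> =o l ^c (natLeq *c \<mu>)" using cexp_cprod[OF l(1)] .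
  also have "l ^c (natLeq *c \<mu>) =o l ^c \<mu>"
  proof (rule cexp_cong2[OF _ l(1)])
    have "natLeq \<le>o \<mu>" using \<mu> natLeq_ordLeq_cinfinite by blast
    then have "\<mu> *c natLeq =o \<mu>"
      using cprod_infinite1'[OF \<mu>] Cinfinite_Cnotzero[OF natLeq_Cinfinite] by blast
    then show "natLeq *c \<mu> =o \<mu>" using cprod_com ordIso_transitive by blast
    show "Card_order (natLeq *c \<mu>)" by (simp add: cprod_def card_of_Card_order)
  qed
  finally have "m ^c \<mu> \<le>o l ^c \<mu>" .
  moreover have "l ^c \<mu> \<le>o m ^c \<mu>" using cexp_mono1[OF l(2) co] .
  ultimately show ?thesis using ordIso_iff_ordLeq by blast
qed

lemma card_Func_finite:
  fixes r :: "'r rel" and A :: "'a set" and B :: "'b set"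
  assumes "finite A" and r: "Cinfinite r" and B: "|B| \<le>o r"
  shows "|Func A B| \<le>o r"
  using assms(1)
proof (induction A rule: finite_induct)
  case empty
  have "(Func {} B :: ('a \<Rightarrow> 'b) set) = {\<lambda>x. undefined}" by (auto simp: Func_def)
  then have "finite (Field |Func {} B :: ('a \<Rightarrow> 'b) set| )" by (simp add: Field_card_of)
  then show ?case
    using r finite_ordLess_infinite[OF card_of_Well_order[of "Func {} B :: ('a \<Rightarrow> 'b) set"], of r]
    by (auto intro!: ordLess_imp_ordLeq simp: card_order_on_def cinfinite_def)
next
  case (insert a A)
  have "|Func (insert a A) B| \<le>o |B \<times> Func A B|"
  proof (rule card_of_ordLeqI[of "\<lambda>f. (f a, f(a := undefined))"])
    show "inj_on (\<lambda>f. (f a, f(a := undefined))) (Func (insert a A) B)"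
    proof (rule inj_onI, rule ext)
      fix f g x assume "(f a, f(a := undefined)) = (g a, g(a := undefined))"
      then have "f a = g a" "(f(a := undefined)) x = (g(a := undefined)) x" by auto
      then show "f x = g x" by (cases "x = a") auto
    qed
    show "(f a, f(a := undefined)) \<in> B \<times> Func A B" if "f \<in> Func (insert a A) B" for f
      using that insert.hyps by (auto simp: Func_def)
  qed
  also have "|B \<times> Func A B| \<le>o r"
    using card_of_Times_ordLeq_infinite_Field[OF _ B insert.IH] r by (auto simp: cinfinite_def)
  finally show ?case .
qed

lemma cardSuc_natLeq_le_continuum: "cardSuc natLeq \<le>o ctwo ^c natLeq"
  using cardSuc_ordLess_ordLeq[OF natLeq_Card_order Card_order_cexp] ordLess_ctwo_cexp[OF natLeq_Card_order]
  by blast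

section \<open>Families of continua, one for every code\<close>

lemma coded_family:
  fixes k :: "'w::wellorder" and Q :: "'a topology \<Rightarrow> bool"
  assumes P: "\<forall>A\<in>Pow {..<k}.
      \<exists>(X :: 'a set) lt bt tp w. coded_continuum X lt bt tp k A w \<and> Q (topo X lt)"
    and k: "zero_elt < k"
  shows "\<exists>\<F>. (\<forall>T\<in>\<F>. linearly_ordered_continuum T \<and> totally_pathwise_disconnected T \<and> Q T) \<and>
     incomparable \<F> \<and> |\<F>| =o |Pow {..<k}|"
proof -
  have "\<exists>X lt. \<forall>A\<in>Pow {..<k}. \<exists>bt tp w. coded_continuum (X A :: 'a set) (lt A) bt tp k A w \<and> Q (topo (X A) (lt A))"
  proof -
    have "\<exists>p. \<forall>A\<in>Pow {..<k}. \<exists>bt tp w.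
        coded_continuum (fst (p A) :: 'a set) (snd (p A)) bt tp k A w \<and> Q (topo (fst (p A)) (snd (p A)))"
    proof (rule bchoice, rule ballI)
      fix A assume "A \<in> Pow {..<k}"
      then obtain X :: "'a set" and lt bt tp w
        where "coded_continuum X lt bt tp k A w \<and> Q (topo X lt)" using P by blast
      then show "\<exists>p. \<exists>bt tp w. coded_continuum (fst p :: 'a set) (snd p) bt tp k A w \<and> Q (topo (fst p) (snd p))"
        by (intro exI[of _ "(X, lt)"] exI) auto
    qed
    then obtain p where "\<forall>A\<in>Pow {..<k}. \<exists>bt tp w.
        coded_continuum (fst (p A) :: 'a set) (snd (p A)) bt tp k A w \<and> Q (topo (fst (p A)) (snd (p A)))" ..
    then show ?thesis by (intro exI[of _ "\<lambda>A. fst (p A)"] exI[of _ "\<lambda>A. snd (p A)"])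
  qed
  then obtain X :: "'w set \<Rightarrow> 'a set" and lt where XP: "\<forall>A\<in>Pow {..<k}. \<exists>bt tp w.
      coded_continuum (X A) (lt A) bt tp k A w \<and> Q (topo (X A) (lt A))" by blast
  define F where "F A = topo (X A) (lt A)" for A
  have F_eq: "A = A'"
    if A: "A \<subseteq> {..<k}" "A' \<subseteq> {..<k}" "F A homeomorphic_space subtopology (F A') S" for A A' S
  proof -
    obtain bt tp w where X: "coded_continuum (X A) (lt A) bt tp k A w" using XP A(1) by blast
    obtain bt' tp' w' where X': "coded_continuum (X A') (lt A') bt' tp' k A' w'" using XP A(2) by blast
    show ?thesis
      by (rule code_eq_if_homeomorphic[OF X X' _ A(3)[unfolded F_def]]) (use k in blast)
  qed
  have "inj_on F (Pow {..<k})"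
  proof (rule inj_onI)
    fix A A' assume "A \<in> Pow {..<k}" "A' \<in> Pow {..<k}" "F A = F A'"
    then show "A = A'" using F_eq[of A A' "topspace (F A')"] homeomorphic_space_refl[of "F A'"] by simp
  qed
  then have card: "|F ` Pow {..<k}| =o |Pow {..<k}|"
    using card_of_ordIso ordIso_symmetric inj_on_imp_bij_betw by blast
  have "incomparable (F ` Pow {..<k})"
    unfolding incomparable_def
  proof (intro ballI impI notI, elim exE conjE)
    fix T T' S
    assume T: "T \<in> F ` Pow {..<k}" "T' \<in> F ` Pow {..<k}" and ne: "T \<noteq> T'"
      and hom: "T homeomorphic_space subtopology T' S"
    obtain A A' where "A \<subseteq> {..<k}" "A' \<subseteq> {..<k}" "T = F A" "T' = F A'" using T by blast
    then show False using F_eq[of A A' S] hom ne by blast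
  qed
  moreover have "linearly_ordered_continuum T \<and> totally_pathwise_disconnected T \<and> Q T"
    if "T \<in> F ` Pow {..<k}" for T
  proof -
    obtain A where A: "A \<in> Pow {..<k}" "T = topo (X A) (lt A)" using \<open>T \<in> _\<close> unfolding F_def by blast
    obtain bt tp w where X: "coded_continuum (X A) (lt A) bt tp k A w" "Q (topo (X A) (lt A))"
      using XP A(1) by blast
    interpret coded_continuum "X A" "lt A" bt tp k A w by fact
    have "totally_pathwise_disconnected (topo (X A) (lt A))"
      by (rule totally_pathwise_disconnected_topo) (rule ucof_dense)
    then show ?thesis unfolding A(2) using linearly_ordered_continuum_topo X(2) by simp
  qed
  ultimately show ?thesis using card by (intro exI[of _ "F ` Pow {..<k}"] conjI ballI) auto
qed

lemma (in coded_continuum) transported_copy: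
  fixes \<kappa> :: "'k rel"
  assumes D: "D \<subseteq> X" "\<And>x y. lt x y \<Longrightarrow> \<exists>d\<in>D. lt x d \<and> lt d y" "|D| \<le>o \<kappa>"
    and \<kappa>: "Cinfinite \<kappa>" and k: "|{..<k}| =o \<kappa>" and le: "|X| \<le>o |UNIV :: 'b set|"
  shows "\<exists>(Y :: 'b set) lt' bt' tp' v. coded_continuum Y lt' bt' tp' k A v \<and>
     weight (topo Y lt') =o \<kappa> \<and> |Y| =o |X|"
proof -
  obtain g :: "'a \<Rightarrow> 'b" where g: "inj_on g X" using card_of_ordLeq[of X "UNIV :: 'b set"] le by auto
  let ?lt = "\<lambda>u v. \<exists>x y. u = g x \<and> v = g y \<and> lt x y"
  note tr = coded_continuum_transport[OF coded_continuum_axioms g]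
  interpret T: coded_continuum "g ` X" ?lt "g bt" "g tp" k A "g \<circ> w" by (rule tr(1))
  have "weight (topo (g ` X) ?lt) \<le>o \<kappa>"
  proof (rule T.weight_le_dense[OF _ _ _ \<kappa>])
    show "g ` D \<subseteq> g ` X" using D by blast
    show "\<exists>d\<in>g ` D. ?lt u d \<and> ?lt d v" if "?lt u v" for u v
    proof -
      obtain x y where xy: "u = g x" "v = g y" "lt x y" using \<open>?lt u v\<close> by blast
      then obtain d where "d \<in> D" "lt x d" "lt d y" using D(2) by blast
      then show ?thesis using xy by blast
    qed
    show "|g ` D| \<le>o \<kappa>" using card_of_image D(3) ordLeq_transitive by blast
  qed
  moreover have "\<kappa> \<le>o weight (topo (g ` X) ?lt)"
  proof -
    have "|{..<k}| \<le>o weight (topo (g ` X) ?lt)"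
      by (rule T.weight_ge_increasing[OF T.w_mono k_limit])
    then show ?thesis using k ordIso_symmetric ordIso_ordLeq_trans by blast
  qed
  ultimately have "weight (topo (g ` X) ?lt) =o \<kappa>" using ordIso_iff_ordLeq by blast
  moreover have "|g ` X| =o |X|"
    using card_of_ordIso ordIso_symmetric inj_on_imp_bij_betw[OF g] by blast
  ultimately show ?thesis using tr(1) by blast
qed

lemma is_max_card_cong:
  fixes m :: "'m rel" and m' :: "'n rel" and s :: "'s rel" and s' :: "'t rel"
  assumes "is_max_card m r s" "m =o m'" "s =o s'"
  shows "is_max_card m' r s'"
  using assms unfolding is_max_card_def
  by (meson ordIso_ordLeq_trans ordIso_symmetric ordIso_transitive ordLeq_ordIso_trans)

context code_pieces begin

lemma card_index:
  fixes \<kappa> :: "'k rel"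
  assumes \<kappa>: "Cinfinite \<kappa>" and k: "|{..<k}| =o \<kappa>"
  shows "|{..Lo k}| \<le>o \<kappa>"
proof -
  have inf: "infinite (Field \<kappa>)" and co: "Card_order \<kappa>" using \<kappa> by (auto simp: cinfinite_def)
  have "infinite {..<k}"
    using Cinfinite_cong[OF ordIso_symmetric[OF k] \<kappa>] by (simp add: cinfinite_def Field_card_of)
  then have kk: "|{..k}| \<le>o \<kappa>" using card_atMost_infinite k ordIso_transitive ordIso_iff_ordLeq by blast
  have "|Lo ` {..k}| \<le>o \<kappa>" "|Hi ` {..k}| \<le>o \<kappa>"
    using card_of_image[of Lo "{..k}"] card_of_image[of Hi "{..k}"] kk ordLeq_transitive by blast+
  then have "|Lo ` {..k} \<union> Hi ` {..k}| \<le>o \<kappa>"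
    using card_of_Un_ordLeq_infinite_Field[OF inf _ _ co] by blast
  moreover have "{..Lo k} \<subseteq> Lo ` {..k} \<union> Hi ` {..k}"
  proof
    fix i assume "i \<in> {..Lo k}"
    then show "i \<in> Lo ` {..k} \<union> Hi ` {..k}" by (cases i) auto
  qed
  ultimately show ?thesis using card_of_mono1 ordLeq_transitive by blast
qed

text \<open>The sum consists of \<open>\<kappa>\<close> parts of \<open>B\<close> and one copy of \<open>Z\<close>, and \<open>Z\<close> is at least as large
  as \<open>B\<close>.\<close>

lemma card_carrier:
  fixes \<kappa> :: "'k rel"
  assumes \<kappa>: "Cinfinite \<kappa>" and k: "|{..<k}| =o \<kappa>" and BZ: "|B| \<le>o |Z|"
  shows "is_max_card |S.carrier| \<kappa> |Z|"
proof -
  have co: "Card_order \<kappa>" using \<kappa> by blast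
  have bound: "|S.carrier| \<le>o r" if r: "Cinfinite r" "\<kappa> \<le>o r" "|Z| \<le>o r" for r :: "'r rel"
  proof -
    have inf: "infinite (Field r)" and cor: "Card_order r" using r(1) by (auto simp: cinfinite_def)
    have "|{..Lo k}| \<le>o r" using card_index[OF \<kappa> k] r(2) ordLeq_transitive by blast
    moreover have "|B| \<le>o r" using BZ r(3) ordLeq_transitive by blast
    ultimately have 1: "|{..Lo k} \<times> B| \<le>o r"
      using card_of_Times_ordLeq_infinite_Field[OF inf _ _ cor] by blast
    have "|Pair (Lo k) ` Z| \<le>o r" using card_of_image r(3) ordLeq_transitive by blast
    moreover have "{Lo k} \<times> Z = Pair (Lo k) ` Z" by auto
    ultimately have "|{Lo k} \<times> Z| \<le>o r" by simp
    then have "|({..Lo k} \<times> B) \<union> ({Lo k} \<times> Z)| \<le>o r"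
      using card_of_Un_ordLeq_infinite_Field[OF inf 1 _ cor] by blast
    then show ?thesis using card_of_mono1[OF carrier_subset] ordLeq_transitive by blast
  qed
  have "inj_on w {..<k}" by (auto simp: inj_on_def w_def)
  then have "|{..<k}| \<le>o |S.carrier|"
    by (rule card_of_ordLeqI) (use w_in in auto)
  then have ge: "\<kappa> \<le>o |S.carrier|" using k ordIso_symmetric ordIso_ordLeq_trans by blast
  have geZ: "|Z| \<le>o |S.carrier|"
    by (rule card_of_ordLeqI[of "Pair (Lo k)"]) (use end_in_carrier in \<open>auto simp: inj_on_def\<close>)
  consider "\<kappa> \<le>o |Z|" | "|Z| \<le>o \<kappa>"
    using ordLeq_total[of \<kappa> "|Z|"] co card_of_Well_order[of Z] by (auto simp: card_order_on_def)
  then show ?thesis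
  proof cases
    case 1
    then have "Cinfinite |Z|" using cinfinite_mono \<kappa> card_of_Card_order by blast
    then have "|S.carrier| \<le>o |Z|"
      using bound 1 ordLeq_refl[OF card_of_Card_order[of Z]] by blast
    then show ?thesis unfolding is_max_card_def using geZ 1 ordIso_iff_ordLeq by blast
  next
    case 2
    then have "|S.carrier| \<le>o \<kappa>" using bound \<kappa> ordLeq_refl[OF co] by blast
    then show ?thesis unfolding is_max_card_def using ge 2 ordIso_iff_ordLeq by blast
  qed
qed

end

text \<open>The two families differ only in the end piece. The assumption \<open>pow\<close> bounds the number of
  eventually zero sequences, hence the weight.\<close>

lemma family_with_end:
  fixes \<kappa> :: "'k rel" and w1 om k t n :: "'k set wo"
  assumes \<kappa>: "Cinfinite \<kappa>"
    and w1: "|{..<w1}| =o cardSuc natLeq" "\<forall>y<w1. |{..<y}| <o cardSuc natLeq"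
    and om: "|{..<om}| =o natLeq" "\<forall>y < om. |{..<y}| <o natLeq"
    and k: "|{..<k}| =o \<kappa>" "\<forall>y<k. |{..<y}| <o \<kappa>"
    and unc: "natLeq <o \<kappa>"
    and t: "w1 \<le> t" and n: "zero_elt < n" "\<And>i. i < n \<Longrightarrow> \<exists>j<n. i < j" "|{..<n}| \<le>o \<kappa>"
    and pow: "\<And>j. j < n \<Longrightarrow> |Func {..j} {..t}| \<le>o \<kappa>"
    and size: "|seqs w1 om| \<le>o |seqs t n|" "|seqs t n| \<le>o |UNIV :: 'k set set|"
  shows "\<exists>\<F> :: 'k set topology set.
    (\<forall>T\<in>\<F>. linearly_ordered_continuum T \<and> totally_pathwise_disconnected T \<and>
       (weight T =o \<kappa> \<and> is_max_card |topspace T| \<kappa> |seqs t n| )) \<and>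
    incomparable \<F> \<and> |\<F>| =o ctwo ^c \<kappa>"
proof -
  have inf: "infinite (Field \<kappa>)" and co: "Card_order \<kappa>" using \<kappa> by (auto simp: cinfinite_def)
  note w1_lim = initial_limit[OF w1 Cinfinite_cardSuc[OF natLeq_Cinfinite]]
  note om_lim = initial_limit[OF om natLeq_Cinfinite]
  note k_lim = initial_limit[OF k \<kappa>]
  have reg: "\<exists>b<w1. \<forall>c\<in>C. c < b" if "countable C" "C \<subseteq> {..<w1}" for C
    using first_uncountable_regular[OF w1 that] .
  have om_count: "countable {..<om}" unfolding countable_iff_natLeq using om(1) ordIso_iff_ordLeq by blast
  interpret I: seq_space w1 om by unfold_locales (use w1_lim(1) om_lim in auto)
  interpret J: seq_space t n by unfold_locales (use w1_lim(1) t n in auto)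
  \<comment> \<open>The sequence that starts with \<open>w1\<close> and continues with zeros has uncountable cofinality from
    below; the top of the building block has countable cofinality.\<close>
  define v :: "'k set wo \<Rightarrow> 'k set wo" where "v i = (if i = zero_elt then w1 else zero_elt)" for i
  have v_in: "v \<in> seqs w1 om"
    by (rule I.in_seqs_if_eventually_zero[OF _ om_lim(1)]) (auto simp: v_def)
  have v_ucof: "ucof (seq_lt w1 om) v"
    by (rule I.ucof_if_last_entry_uncountable[OF reg _ w1_lim(1) v_in _ om_lim(1)]) (auto simp: v_def)
  define u where "u e = (if e then v else seq_top w1 om)" for e
  have fin_I: "|I.fin_seqs| \<le>o \<kappa>"
  proof (rule I.card_fin_seqs[OF \<kappa>])
    show "|{..<om}| \<le>o \<kappa>" using om(1) unc ordIso_ordLess_trans ordLess_imp_ordLeq by blast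
    have "|{..w1}| =o cardSuc natLeq"
      using card_atMost_infinite[OF w1_lim(3)] w1(1) ordIso_transitive by blast
    moreover have "cardSuc natLeq \<le>o \<kappa>" using unc cardSuc_ordLess_ordLeq[OF natLeq_Card_order co] by blast
    ultimately have le: "|{..w1}| \<le>o \<kappa>" using ordIso_ordLeq_trans by blast
    fix j assume "j < om"
    then have "finite {..<j}" using om(2) finite_iff_ordLess_natLeq by blast
    moreover have "{..j} = insert j {..<j}" by auto
    ultimately have "finite {..j}" by simp
    then show "|Func {..j} {..w1}| \<le>o \<kappa>" using card_Func_finite \<kappa> le by blast
  qed
  have fin_J: "|J.fin_seqs| \<le>o \<kappa>" by (rule J.card_fin_seqs[OF \<kappa> n(3) pow])
  have copy: "\<forall>A\<in>Pow {..<k}. \<exists>(X :: 'k set set) lt bt tp w. coded_continuum X lt bt tp k A w \<and>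
      (weight (topo X lt) =o \<kappa> \<and> is_max_card |topspace (topo X lt)| \<kappa> |seqs t n| )"
  proof
    fix A assume "A \<in> Pow {..<k}"
    then have A: "A \<subseteq> {..<k}" by simp
    interpret B: order_continuum "seqs w1 om" "seq_lt w1 om" "\<lambda>_. zero_elt" "seq_top w1 om"
      by (rule I.order_continuum_seqs)
    interpret Z: order_continuum "seqs t n" "seq_lt t n" "\<lambda>_. zero_elt" "seq_top t n"
      by (rule J.order_continuum_seqs)
    interpret P: code_pieces "seqs w1 om" "seq_lt w1 om" "\<lambda>_. zero_elt" "seq_top w1 om"
      "seqs t n" "seq_lt t n" "\<lambda>_. zero_elt" "seq_top t n" u k A
    proof
      have "v zero_elt \<noteq> zero_elt" using w1_lim(1) by (simp add: v_def)
      then have "v \<noteq> (\<lambda>_. zero_elt)" by auto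
      then have "seq_lt w1 om (\<lambda>_. zero_elt) v"
        using B.lt_total[OF B.bt_in v_in] B.bt_least by blast
      then show "seq_lt w1 om (\<lambda>_. zero_elt) (u e)" for e using B.bt_tp by (simp add: u_def)
      show "ucof (seq_lt w1 om) (u e) \<longleftrightarrow> e" for e
        using v_ucof I.not_ucof_top_if_countable[OF om_count] by (simp add: u_def)
      show "\<not> ucof (conversep (seq_lt w1 om)) x" for x
        by (rule I.not_ucof_rev_if_countable[OF om_count])
      show "\<exists>p. seq_lt w1 om x p \<and> seq_lt w1 om p y \<and> ucof (seq_lt w1 om) p" if "seq_lt w1 om x y" for x y
        by (rule I.ucof_dense_seqs[OF reg order_refl w1_lim(1) that])
      show "\<exists>p. seq_lt t n x p \<and> seq_lt t n p y \<and> ucof (seq_lt t n) p" if "seq_lt t n x y" for x y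
        by (rule J.ucof_dense_seqs[OF reg t w1_lim(1) that])
      show "zero_elt < k" by (rule k_lim(1))
      show "\<exists>\<gamma><k. \<beta> < \<gamma>" if "\<beta> < k" for \<beta> by (rule k_lim(2)[OF that])
      show "A \<subseteq> {..<k}" by (rule A)
    qed
    interpret C: coded_continuum P.S.carrier P.S.less "(zero_elt, P.piece_bottom zero_elt)" "(Lo k, seq_top t n)" k A P.w
      by (rule P.coded_continuum_sum)
    let ?D = "P.S.carrier \<inter> UNIV \<times> (I.fin_seqs \<union> J.fin_seqs)"
    have "|I.fin_seqs \<union> J.fin_seqs| \<le>o \<kappa>"
      using card_of_Un_ordLeq_infinite_Field[OF inf fin_I fin_J co] .
    then have "|{..Lo k} \<times> (I.fin_seqs \<union> J.fin_seqs)| \<le>o \<kappa>"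
      using card_of_Times_ordLeq_infinite_Field[OF inf P.card_index[OF \<kappa> k(1)] _ co] by blast
    moreover have "?D \<subseteq> {..Lo k} \<times> (I.fin_seqs \<union> J.fin_seqs)" by auto
    ultimately have D: "|?D| \<le>o \<kappa>" using card_of_mono1 ordLeq_transitive by blast
    have max: "is_max_card |P.S.carrier| \<kappa> |seqs t n|"
      by (rule P.card_carrier[OF \<kappa> k(1) size(1)])
    have "\<kappa> \<le>o |UNIV :: 'k set set|"
    proof -
      have "\<kappa> =o |Field \<kappa>|" using co card_of_Field_ordIso ordIso_symmetric by blast
      also have "|Field \<kappa>| \<le>o |UNIV :: 'k set|" by (rule card_of_mono1) simp
      also have "|UNIV :: 'k set| \<le>o |UNIV :: 'k set set|"
        by (rule card_of_ordLeqI[of "\<lambda>x. {x}"]) (auto simp: inj_on_def)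
      finally show ?thesis .
    qed
    then have "|P.S.carrier| \<le>o |UNIV :: 'k set set|"
      using max[unfolded is_max_card_def] size(2) by (metis ordIso_ordLeq_trans)
    from C.transported_copy[OF _ _ D \<kappa> k(1) this] obtain Y :: "'k set set" and lt' bt' tp' w'
      where Y: "coded_continuum Y lt' bt' tp' k A w'" "weight (topo Y lt') =o \<kappa>" "|Y| =o |P.S.carrier|"
      using P.dense_subset_sum[OF I.fin_seqs_dense J.fin_seqs_dense] by blast
    have "is_max_card |topspace (topo Y lt')| \<kappa> |seqs t n|"
      using is_max_card_cong[OF max ordIso_symmetric[OF Y(3)]] card_of_refl by auto
    then show "\<exists>(X :: 'k set set) lt bt tp w. coded_continuum X lt bt tp k A w \<and>
        (weight (topo X lt) =o \<kappa> \<and> is_max_card |topspace (topo X lt)| \<kappa> |seqs t n| )"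
      using Y(1,2) by blast
  qed
  have "|Pow {..<k}| =o ctwo ^c |{..<k}|"
    using card_of_Pow_Func[of "{..<k}"] card_of_Func[of "{..<k}" "UNIV :: bool set"] by (simp add: ctwo_def)
  also have "ctwo ^c |{..<k}| =o ctwo ^c \<kappa>"
    by (rule cexp_cong2[OF k(1) Card_order_ctwo card_of_Card_order])
  finally have "|Pow {..<k}| =o ctwo ^c \<kappa>" .
  moreover obtain \<F> :: "'k set topology set" where
    "\<forall>T\<in>\<F>. linearly_ordered_continuum T \<and> totally_pathwise_disconnected T \<and>
       (weight T =o \<kappa> \<and> is_max_card |topspace T| \<kappa> |seqs t n| )"
    "incomparable \<F>" "|\<F>| =o |Pow {..<k}|"
    using coded_family[OF copy k_lim(1)] by (elim exE conjE) (rule that)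
  ultimately show ?thesis
    by (intro exI[of _ \<F>] conjI) (auto intro: ordIso_transitive)
qed

lemma card_seqs:
  fixes t :: "'v::wellorder" and n :: "'i::wellorder" and m :: "'m rel" and \<nu> :: "'n rel"
  assumes "seq_space t n" and t: "|{..<t}| =o m" and n: "|{..<n}| =o \<nu>"
    and m: "Cinfinite m" and \<nu>: "Card_order \<nu>"
  shows "|seqs t n| =o m ^c \<nu>"
proof -
  interpret seq_space t n by fact
  have "infinite {..<t}"
    using Cinfinite_cong[OF ordIso_symmetric[OF t] m] by (simp add: cinfinite_def Field_card_of)
  then have t': "|{..t}| =o m" using card_atMost_infinite t ordIso_transitive by blast
  have "|seqs t n| \<le>o |{..t}| ^c |{..<n}|" using card_seqs_le by (simp add: card_of_Func)
  also have "|{..t}| ^c |{..<n}| =o m ^c \<nu>"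
    by (rule cexp_cong[OF t' n \<nu> card_of_Card_order])
  finally have le: "|seqs t n| \<le>o m ^c \<nu>" .
  have "m ^c \<nu> =o |{..<t}| ^c |{..<n}|"
    by (rule cexp_cong[OF ordIso_symmetric[OF t] ordIso_symmetric[OF n] card_of_Card_order \<nu>])
  also have "|{..<t}| ^c |{..<n}| \<le>o |seqs t n|" using card_seqs_ge by (simp add: card_of_Func)
  finally show ?thesis using le ordIso_iff_ordLeq by blast
qed

section \<open>The two families\<close>

theorem theorem3:
  fixes \<kappa> :: "'k rel" and l :: "'l rel"
  assumes "Cinfinite \<kappa>" and "Cinfinite l" and "natLeq <o \<kappa>" and "l \<le>o \<kappa>"
  shows "\<exists>(\<F> :: 'k set topology set) (\<G> :: 'k set topology set).
    (\<forall>X \<in> \<F> \<union> \<G>. linearly_ordered_continuum X \<and> totally_pathwise_disconnected X) \<and>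
    incomparable \<F> \<and> incomparable \<G> \<and>
    |\<F>| =o ctwo ^c \<kappa> \<and> |\<G>| =o ctwo ^c \<kappa> \<and>
    (\<forall>X \<in> \<F> \<union> \<G>. weight X =o \<kappa>) \<and>
    (\<forall>X \<in> \<F>. is_max_card |topspace X| \<kappa> (ctwo ^c natLeq)) \<and>
    (\<forall>X \<in> \<G>. |topspace X| =o l ^c nu l \<kappa> \<and> weight X <o |topspace X| )"
proof -
  note \<kappa> = assms(1) and l = assms(2)
  have co: "Card_order \<kappa>" and col: "Card_order l" using \<kappa> l by auto
  have nu: "Cinfinite (nu l \<kappa>)" "\<kappa> <o l ^c nu l \<kappa>" using nu_props[OF l \<kappa>] by auto
  have con: "Card_order (nu l \<kappa>)" using nu by blast
  define m where "m = l +c cardSuc natLeq"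
  have S: "Cinfinite (cardSuc natLeq)" using Cinfinite_cardSuc[OF natLeq_Cinfinite] .
  have Sco: "Card_order (cardSuc natLeq)" using S by blast
  have m: "Cinfinite m" unfolding m_def by (rule Cinfinite_csum1[OF l])
  have lm: "l \<le>o m" and Sm: "cardSuc natLeq \<le>o m"
    unfolding m_def using ordLeq_csum1[OF col] ordLeq_csum2[OF Sco] by auto
  have S\<kappa>: "cardSuc natLeq \<le>o \<kappa>"
    using assms(3) cardSuc_ordLess_ordLeq[OF natLeq_Card_order co] by blast
  have m\<kappa>: "m \<le>o \<kappa>" unfolding m_def by (rule csum_cinfinite_bound[OF assms(4) S\<kappa> col Sco \<kappa>])
  have ctwo_l: "ctwo \<le>o l" by (rule ctwo_ordLeq_Cinfinite[OF l])
  have l_pow: "l \<le>o l ^c natLeq" by (rule ordLeq_cexp1[OF Cinfinite_Cnotzero[OF natLeq_Cinfinite] col])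
  have S_pow: "cardSuc natLeq \<le>o l ^c natLeq"
    using cardSuc_natLeq_le_continuum cexp_mono1[OF ctwo_l natLeq_Card_order] ordLeq_transitive by blast
  have m_pow: "m \<le>o l ^c natLeq" unfolding m_def
    by (rule csum_cinfinite_bound[OF l_pow S_pow col Sco Cinfinite_cexp[OF ctwo_l natLeq_Cinfinite]])
  have nu_le: "nu l \<kappa> \<le>o \<kappa>"
  proof (rule nu_least[OF l \<kappa> \<kappa>])
    show "\<kappa> <o l ^c \<kappa>"
      using ordLess_ctwo_cexp[OF co] cexp_mono1[OF ctwo_l co] ordLess_ordLeq_trans by blast
  qed
  \<comment> \<open>The power set must provide room for the ordinals involved and for the points of the continua.\<close>
  have \<kappa>P: "\<kappa> <o |UNIV :: 'k set set|"
  proof -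
    have "\<kappa> =o |Field \<kappa>|" using co card_of_Field_ordIso ordIso_symmetric by blast
    also have "|Field \<kappa>| \<le>o |UNIV :: 'k set|" by (rule card_of_mono1) simp
    also have "|UNIV :: 'k set| <o |Pow (UNIV :: 'k set)|" by (rule card_of_Pow)
    finally show ?thesis by simp
  qed
  have pow\<kappa>: "ctwo ^c \<kappa> \<le>o |UNIV :: 'k set set|"
  proof -
    have "ctwo ^c \<kappa> =o |Pow (Field \<kappa>)|"
      using card_of_Pow_Func[of "Field \<kappa>"] by (simp add: cexp_def ctwo_def Field_card_of ordIso_symmetric)
    also have "|Pow (Field \<kappa>)| \<le>o |UNIV :: 'k set set|" by (rule card_of_mono1) simp
    finally show ?thesis .
  qed
  note seg = initial_segment_exists[where 'a = "'k set"]
  obtain w1 :: "'k set wo" where w1: "|{..<w1}| =o cardSuc natLeq" "\<forall>y<w1. |{..<y}| <o cardSuc natLeq"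
    using seg[OF Sco ordLeq_ordLess_trans[OF S\<kappa> \<kappa>P]] by blast
  obtain om :: "'k set wo" where om: "|{..<om}| =o natLeq" "\<forall>y < om. |{..<y}| <o natLeq"
    using seg[OF natLeq_Card_order ordLess_transitive[OF assms(3) \<kappa>P]] by blast
  obtain k :: "'k set wo" where k: "|{..<k}| =o \<kappa>" "\<forall>y<k. |{..<y}| <o \<kappa>"
    using seg[OF co \<kappa>P] by blast
  obtain t :: "'k set wo" where t: "|{..<t}| =o m" "\<forall>y<t. |{..<y}| <o m"
    using seg[OF _ ordLeq_ordLess_trans[OF m\<kappa> \<kappa>P]] m by blast
  obtain n :: "'k set wo" where n: "|{..<n}| =o nu l \<kappa>" "\<forall>y<n. |{..<y}| <o nu l \<kappa>"
    using seg[OF con ordLeq_ordLess_trans[OF nu_le \<kappa>P]] by blast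
  note w1_lim = initial_limit[OF w1 S] and om_lim = initial_limit[OF om natLeq_Cinfinite]
    and t_lim = initial_limit[OF t m] and n_lim = initial_limit[OF n nu(1)]
  interpret I: seq_space w1 om by unfold_locales (use w1_lim(1) om_lim in auto)
  interpret J: seq_space t n by unfold_locales (use t_lim(1) n_lim in auto)
  have w1_t: "w1 \<le> t"
  proof (rule ccontr)
    assume "\<not> w1 \<le> t"
    then have "|{..<t}| <o cardSuc natLeq" using w1(2) by simp
    then have "m <o cardSuc natLeq" using t(1) ordIso_symmetric ordIso_ordLess_trans by blast
    then show False using Sm not_ordLess_ordLeq by blast
  qed
  have "|seqs w1 om| =o cardSuc natLeq ^c natLeq"
    by (rule card_seqs[OF I.seq_space_axioms w1(1) om(1) S natLeq_Card_order])
  also have "cardSuc natLeq ^c natLeq =o ctwo ^c natLeq"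
  proof (rule cexp_absorb[OF Card_order_ctwo _ cardSuc_natLeq_le_continuum natLeq_Cinfinite])
    show "ctwo \<le>o cardSuc natLeq" by (rule ctwo_ordLeq_Cinfinite[OF S])
  qed
  finally have F_size: "|seqs w1 om| =o ctwo ^c natLeq" .
  have "|seqs t n| =o m ^c nu l \<kappa>"
    by (rule card_seqs[OF J.seq_space_axioms t(1) n(1) m con])
  also have "m ^c nu l \<kappa> =o l ^c nu l \<kappa>" by (rule cexp_absorb[OF col lm m_pow nu(1)])
  finally have G_size: "|seqs t n| =o l ^c nu l \<kappa>" .
  have "natLeq \<le>o nu l \<kappa>" using nu(1) natLeq_ordLeq_cinfinite by blast
  then have "ctwo ^c natLeq \<le>o l ^c nu l \<kappa>"
    by (intro cexp_mono[OF ctwo_l]) (use natLeq_Card_order Cinfinite_Cnotzero[OF natLeq_Cinfinite] in auto)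
  then have FG: "|seqs w1 om| \<le>o |seqs t n|"
    using F_size G_size ordIso_ordLeq_trans ordLeq_ordIso_trans ordIso_symmetric by blast
  have "l ^c nu l \<kappa> \<le>o ctwo ^c \<kappa>"
  proof -
    have "l \<le>o ctwo ^c \<kappa>" using assms(4) ordLess_ctwo_cexp[OF co] ordLess_imp_ordLeq ordLeq_transitive by blast
    then have "l ^c nu l \<kappa> \<le>o (ctwo ^c \<kappa>) ^c nu l \<kappa>" by (rule cexp_mono1[OF _ con])
    also have "(ctwo ^c \<kappa>) ^c nu l \<kappa> =o ctwo ^c (\<kappa> *c nu l \<kappa>)" by (rule cexp_cprod[OF Card_order_ctwo])
    also have "ctwo ^c (\<kappa> *c nu l \<kappa>) =o ctwo ^c \<kappa>"
    proof (rule cexp_cong2[OF _ Card_order_ctwo])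
      show "\<kappa> *c nu l \<kappa> =o \<kappa>" by (rule cprod_infinite1'[OF \<kappa> Cinfinite_Cnotzero[OF nu(1)] nu_le])
      show "Card_order (\<kappa> *c nu l \<kappa>)" by (simp add: cprod_def card_of_Card_order)
    qed
    finally show ?thesis .
  qed
  then have G_small: "|seqs t n| \<le>o |UNIV :: 'k set set|"
    using G_size pow\<kappa> ordIso_ordLeq_trans ordLeq_transitive by blast
  then have F_small: "|seqs w1 om| \<le>o |UNIV :: 'k set set|" using FG ordLeq_transitive by blast
  have t\<kappa>: "|{..t}| \<le>o \<kappa>" and t_m: "|{..t}| =o m"
    using card_atMost_infinite[OF t_lim(3)] t(1) m\<kappa> ordIso_transitive ordIso_ordLeq_trans by blast+
  have w1\<kappa>: "|{..w1}| \<le>o \<kappa>"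
    using card_atMost_infinite[OF w1_lim(3)] w1(1) S\<kappa> ordIso_transitive ordIso_ordLeq_trans by blast
  have F_pow: "|Func {..j} {..w1}| \<le>o \<kappa>" if "j < om" for j
  proof -
    have "finite {..<j}" using that om(2) finite_iff_ordLess_natLeq by blast
    moreover have "{..j} = insert j {..<j}" by auto
    ultimately have "finite {..j}" by simp
    then show ?thesis using card_Func_finite \<kappa> w1\<kappa> by blast
  qed
  \<comment> \<open>Initial segments of \<open>n\<close> are smaller than \<open>nu l \<kappa>\<close>, so by minimality the power cannot
    exceed \<open>\<kappa>\<close>.\<close>
  have G_pow: "|Func {..j} {..t}| \<le>o \<kappa>" if j: "j < n" for j
  proof (cases "finite {..j}")
    case True
    then show ?thesis using card_Func_finite \<kappa> t\<kappa> by blast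
  next
    case False
    moreover have "{..j} = insert j {..<j}" by auto
    ultimately have "infinite {..<j}" by simp
    then have jj: "|{..j}| =o |{..<j}|" by (rule card_atMost_infinite)
    let ?\<mu> = "|{..j}|"
    have \<mu>: "Cinfinite ?\<mu>"
      using False card_of_Card_order[of "{..j}"] by (simp add: cinfinite_def Field_card_of)
    have less: "?\<mu> <o nu l \<kappa>" using jj n(2)[rule_format, OF j] ordIso_ordLess_trans by blast
    have "\<not> \<kappa> <o l ^c ?\<mu>"
      using nu_least[OF l \<kappa> \<mu>] less not_ordLess_ordLeq by blast
    then have "l ^c ?\<mu> \<le>o \<kappa>"
      using not_ordLess_iff_ordLeq[of "l ^c ?\<mu>" \<kappa>] co Card_order_cexp[of l ?\<mu>] by (simp add: card_order_on_def)
    moreover have "|{..t}| ^c ?\<mu> =o m ^c ?\<mu>" by (rule cexp_cong1[OF t_m card_of_Card_order])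
    moreover have "m ^c ?\<mu> =o l ^c ?\<mu>" by (rule cexp_absorb[OF col lm m_pow \<mu>])
    ultimately have "|{..t}| ^c ?\<mu> \<le>o \<kappa>" by (metis ordIso_ordLeq_trans)
    then show ?thesis by (simp add: card_of_Func)
  qed
  have om\<kappa>: "|{..<om}| \<le>o \<kappa>"
    using om(1) assms(3) ordIso_ordLess_trans ordLess_imp_ordLeq by blast
  have n\<kappa>: "|{..<n}| \<le>o \<kappa>" using n(1) nu_le ordIso_ordLeq_trans by blast
  obtain \<F> :: "'k set topology set" where F:
    "\<forall>T\<in>\<F>. linearly_ordered_continuum T \<and> totally_pathwise_disconnected T \<and>
       (weight T =o \<kappa> \<and> is_max_card |topspace T| \<kappa> |seqs w1 om| )"
    "incomparable \<F>" "|\<F>| =o ctwo ^c \<kappa>"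
    using family_with_end[OF \<kappa> w1 om k assms(3) order_refl om_lim(1,2) om\<kappa> F_pow
        ordLeq_refl[OF card_of_Card_order] F_small] by blast
  obtain \<G> :: "'k set topology set" where G:
    "\<forall>T\<in>\<G>. linearly_ordered_continuum T \<and> totally_pathwise_disconnected T \<and>
       (weight T =o \<kappa> \<and> is_max_card |topspace T| \<kappa> |seqs t n| )"
    "incomparable \<G>" "|\<G>| =o ctwo ^c \<kappa>"
    using family_with_end[OF \<kappa> w1 om k assms(3) w1_t n_lim(1,2) n\<kappa> G_pow FG G_small] by blast
  have F_card: "is_max_card |topspace X| \<kappa> (ctwo ^c natLeq)" if "X \<in> \<F>" for X
    using is_max_card_cong[OF _ card_of_refl F_size] F(1) that by blast
  have G_card: "|topspace X| =o l ^c nu l \<kappa> \<and> weight X <o |topspace X|" if "X \<in> \<G>" for X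
  proof -
    have "is_max_card |topspace X| \<kappa> (l ^c nu l \<kappa>)" and wX: "weight X =o \<kappa>"
      using is_max_card_cong[OF _ card_of_refl G_size] G(1) that by blast+
    then have eq: "|topspace X| =o l ^c nu l \<kappa>"
      using nu(2) not_ordLess_ordLeq unfolding is_max_card_def by blast
    have "weight X <o l ^c nu l \<kappa>" using wX nu(2) by (rule ordIso_ordLess_trans)
    then have "weight X <o |topspace X|" using ordIso_symmetric[OF eq] by (rule ordLess_ordIso_trans)
    then show ?thesis using eq by blast
  qed
  show ?thesis
    by (intro exI[of _ \<F>] exI[of _ \<G>] conjI) (use F G F_card G_card in blast)+
qed

end
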